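(* (a) One has $$\int_0^\infty \frac{[\pi I_{0}(t)+iK_0(t)]^m+[\pi I_{0}(t)-iK_0(t)]^m}{i}[K_0(t)]^m t^n\,dt=0$$ for all integers $m>1$, $n\geq 0$ such that $\frac{m-n}{2}$ is a positive integer, and $$\int_0^\infty \frac{[\pi I_{0}(t)+iK_0(t)]^m-[\pi I_{0}(t)-iK_0(t)]^m}{i}[K_0(t)]^m t^n\,dt=0$$ for all integers $m>0$, $n\geq 0$ such that $\frac{m-n-1}{2}$ is a positive integer. (b) The numbers $$A(n):=\left(\frac{2}{\pi}\right)^4\int_0^\infty\left\{[\pi I_0(t)]^2-[K_0(t)]^2\right\}I_0(t)[K_0(t)]^5(2t)^{2n-1}\,dt$$ are integers for all integers $n>0$. More generally, for all integers $m,n>0$, the integral $$C_{m,n}=\frac{2^{1+2(n-1)[1-(-1)^{m}]}}{\pi^{m+1}}\int_0^\infty \frac{[\pi I_0(t)+i K_{0}(t)]^{m}-[\pi I_0(t)-i K_{0}(t)]^{m}}{i}[K_0(t)]^{m}(2t)^{2n+m-3}\,dt$$ evaluates to a positive integer.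
   Context: $I_0(t)=\frac1\pi\int_0^\pi e^{t\cos\theta}\,d\theta$ and $K_0(t)=\int_0^\infty e^{-t\cosh u}\,du$ ($t>0$) are the modified Bessel functions of the first and second kind of order zero; $i=\sqrt{-1}$. *)

theory Defs
  imports "HOL-Analysis.Analysis"
begin

definition bessel_I0 :: "real \<Rightarrow> real" where
  "bessel_I0 t = 1 / pi * (LBINT \<theta>:{0..pi}. exp (t * cos \<theta>))"

text \<open>Meaningful for \<open>t > 0\<close> only; every integral over \<open>t\<close> below is over \<open>{0<..}\<close>.\<close>

definition bessel_K0 :: "real \<Rightarrow> real" where
  "bessel_K0 t = (LBINT u:{0..}. exp (- t * cosh u))"

definition sum_integrand :: "nat \<Rightarrow> nat \<Rightarrow> real \<Rightarrow> complex" where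
  "sum_integrand m n t =
     ((complex_of_real (pi * bessel_I0 t) + \<i> * complex_of_real (bessel_K0 t)) ^ m
      + (complex_of_real (pi * bessel_I0 t) - \<i> * complex_of_real (bessel_K0 t)) ^ m) / \<i>
     * complex_of_real (bessel_K0 t) ^ m * complex_of_real t ^ n"

definition diff_integrand :: "nat \<Rightarrow> nat \<Rightarrow> real \<Rightarrow> complex" where
  "diff_integrand m n t =
     ((complex_of_real (pi * bessel_I0 t) + \<i> * complex_of_real (bessel_K0 t)) ^ m
      - (complex_of_real (pi * bessel_I0 t) - \<i> * complex_of_real (bessel_K0 t)) ^ m) / \<i>
     * complex_of_real (bessel_K0 t) ^ m * complex_of_real t ^ n"

text \<open>The natural-number exponents \<open>2 * n - 1\<close> and \<open>2 * n + m - 3\<close> below are used for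
  \<open>m, n > 0\<close> only, where the subtraction does not truncate.\<close>

definition A_integrand :: "nat \<Rightarrow> real \<Rightarrow> real" where
  "A_integrand n t =
     ((pi * bessel_I0 t)\<^sup>2 - (bessel_K0 t)\<^sup>2) * bessel_I0 t * bessel_K0 t ^ 5 * (2 * t) ^ (2 * n - 1)"

definition A_num :: "nat \<Rightarrow> real" where
  "A_num n = (2 / pi) ^ 4 * (LBINT t:{0<..}. A_integrand n t)"

definition C_integrand :: "nat \<Rightarrow> nat \<Rightarrow> real \<Rightarrow> complex" where
  "C_integrand m n t =
     ((complex_of_real (pi * bessel_I0 t) + \<i> * complex_of_real (bessel_K0 t)) ^ m
      - (complex_of_real (pi * bessel_I0 t) - \<i> * complex_of_real (bessel_K0 t)) ^ m) / \<i>
     * complex_of_real (bessel_K0 t) ^ m * complex_of_real (2 * t) ^ (2 * n + m - 3)"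

definition C_num :: "nat \<Rightarrow> nat \<Rightarrow> complex" where
  "C_num m n =
     2 powi (1 + 2 * (int n - 1) * (1 - (- 1) ^ m)) / complex_of_real pi ^ (m + 1)
     * (LBINT t:{0<..}. C_integrand m n t)"

end

(*
  Put Z(t) = K0(t) (pi I0(t) - i K0(t)). Both integrands in the theorem are, up to constants, real or
  imaginary parts of Z(t)^m t^n. Up to a factor, Z(t) is K0(t) K0(-t) continued into the upper half
  plane, so Z extends holomorphically to a neighbourhood of the closed first quadrant (without 0), and
  the extension is purely imaginary on the positive imaginary axis. Rotating the contour from the positive
  real to the positive imaginary axis therefore kills one of the two parts, except for the residue at
  infinity of Z(z)^m z^n, which is read off from the asymptotic expansion
  Z(z) ~ pi/(2z) y(1/(2z)), where y(x) = p(x) p(-x) and p is the formal series in K0(z) ~ sqrt(pi/(2z)) exp(-z) p(1/(2z)).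

  Hence C_{m,n} is a power of 2 times the coefficient of x^(2n-2) in y^m. The coefficients b_j of y are positive for
  even j because (j+2) b_{j+2} = (j+1)^3 b_j, and 2^j b_j is an integer. For even m no power of 2 is needed,
  since g = y^2 has integer coefficients: the constancy of the Wronskian of the two formal solutions
  gives g - 1 = x^4 g'' + 2 x^3 g' + x^2 g - 3 x^4 r with r g = (g'/2)^2, which determines g recursively over
  the integers. Finally A(n+1) = C_{4,n} and A(1) = 0.
*)
theory Submission
  imports Defs "HOL-Complex_Analysis.Complex_Analysis"
begin

section \<open>Formal series of the product of the two Bessel solutions\<close>

text \<open>The Bessel functions are not continued as such. Both factors of Z are, up to
  exponentials, Laplace-type integrals of the algebraic kernels 1 / sqrt (v (1 + v)) and 1 / sqrt (v
  (1 - v)), and turning the path of v away from the real axis continues them in z. The branch point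
  v = 1 of the second kernel lies on the real path; passing below it is what produces pi I0 - i K0.
  The same integrals give the asymptotic series, by expanding 1 / sqrt (1 + v) and 1 / sqrt (1 - v)
  under the integral sign. The obstacle at infinity is that Z^m z^n may grow, so an arc cannot
  simply be dropped. The truncated expansion is subtracted together with an explicit primitive:
  between r and i r the even powers of z in that primitive change by real amounts, and only the
  logarithm contributes an imaginary one. All deformations use a primitive on a half plane and its
  change along chords between the end points; no curved path occurs.\<close>

definition bessel_fps :: "real fps" where
  "bessel_fps = Abs_fps (\<lambda>j. (-1) ^ j * (pochhammer (1/2) j)\<^sup>2 / fact j)"

definition bessel_fps_neg :: "real fps" where
  "bessel_fps_neg = Abs_fps (\<lambda>j. (pochhammer (1/2) j)\<^sup>2 / fact j)"

definition product_fps :: "real fps" where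
  "product_fps = bessel_fps * bessel_fps_neg"

text \<open>This is Bessel's equation of order zero in the variable x = 1 / (2 z), for a solution
  stripped of sqrt (pi / (2 z)) exp (- z). On coefficients it is a two-term recursion, because j (j
  - 1) + 2 j + 1/4 = (j + 1/2)^2.\<close>

lemma bessel_fps_ode:
  "fps_X\<^sup>2 * fps_deriv (fps_deriv bessel_fps) + 2 * fps_X * fps_deriv bessel_fps
     + fps_deriv bessel_fps + fps_const (1/4) * bessel_fps = 0"
proof (rule fps_ext)
  fix j
  have "real (Suc j) * bessel_fps $ Suc j = - (real j + 1/2)\<^sup>2 * bessel_fps $ j"
    by (simp add: bessel_fps_def pochhammer_rec'[of "1/2 :: real" j] power_mult_distrib divide_simps del: of_nat_Suc)
  then show "(fps_X\<^sup>2 * fps_deriv (fps_deriv bessel_fps) + 2 * fps_X * fps_deriv bessel_fps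
     + fps_deriv bessel_fps + fps_const (1/4) * bessel_fps) $ j = 0 $ j"
    by (cases j; cases "j - 1")
       (auto simp: mult.assoc numeral_fps_const fps_X_power_mult_nth power2_eq_square algebra_simps)
qed

lemma bessel_fps_neg_ode:
  "fps_X\<^sup>2 * fps_deriv (fps_deriv bessel_fps_neg) + 2 * fps_X * fps_deriv bessel_fps_neg
     - fps_deriv bessel_fps_neg + fps_const (1/4) * bessel_fps_neg = 0"
proof (rule fps_ext)
  fix j
  have "real (Suc j) * bessel_fps_neg $ Suc j = (real j + 1/2)\<^sup>2 * bessel_fps_neg $ j"
    by (simp add: bessel_fps_neg_def pochhammer_rec'[of "1/2 :: real" j] power_mult_distrib divide_simps del: of_nat_Suc)
  then show "(fps_X\<^sup>2 * fps_deriv (fps_deriv bessel_fps_neg) + 2 * fps_X * fps_deriv bessel_fps_neg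
     - fps_deriv bessel_fps_neg + fps_const (1/4) * bessel_fps_neg) $ j = 0 $ j"
    by (cases j; cases "j - 1")
       (auto simp: mult.assoc numeral_fps_const fps_X_power_mult_nth power2_eq_square algebra_simps)
qed

text \<open>Up to the factor - x^2 the left side is the Wronskian of exp (- 1 / (2 x)) p and exp (1
  / (2 x)) q, where p and q are the two series; the term p q comes from differentiating the
  exponentials. The two equations make its derivative vanish, so its constant coefficient
  decides.\<close>

lemma bessel_fps_wronskian:
  "bessel_fps * bessel_fps_neg
     - fps_X\<^sup>2 * (bessel_fps * fps_deriv bessel_fps_neg - bessel_fps_neg * fps_deriv bessel_fps) = 1"
  (is "?W = 1")
proof -
  have ode: "fps_X * (fps_X * fps_deriv (fps_deriv bessel_fps)) = 
     - (2 * fps_X * fps_deriv bessel_fps) - fps_deriv bessel_fps - fps_const (1/4) * bessel_fps"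
    "fps_X * (fps_X * fps_deriv (fps_deriv bessel_fps_neg)) = 
     - (2 * fps_X * fps_deriv bessel_fps_neg) + fps_deriv bessel_fps_neg - fps_const (1/4) * bessel_fps_neg"
    using bessel_fps_ode bessel_fps_neg_ode by (simp_all add: power2_eq_square algebra_simps eq_neg_iff_add_eq_0)
  have "fps_deriv ?W = 
     fps_deriv bessel_fps * bessel_fps_neg + bessel_fps * fps_deriv bessel_fps_neg
     - 2 * fps_X * (bessel_fps * fps_deriv bessel_fps_neg - bessel_fps_neg * fps_deriv bessel_fps)
     - (bessel_fps * (fps_X * (fps_X * fps_deriv (fps_deriv bessel_fps_neg)))
        - bessel_fps_neg * (fps_X * (fps_X * fps_deriv (fps_deriv bessel_fps))))"
    by (simp add: fps_deriv_power power2_eq_square) (simp add: algebra_simps)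
  also have "\<dots> = 0"
    unfolding ode by (simp add: algebra_simps)
  finally have "fps_deriv ?W = 0" .
  then have "?W = fps_const (?W $ 0)"
    by (simp only: fps_deriv_eq_0_iff)
  also have "?W $ 0 = 1"
    by (simp add: bessel_fps_def bessel_fps_neg_def)
  finally show ?thesis by simp
qed

text \<open>Squaring the Wronskian identity eliminates the single factors p and q of y: (p q' - q
  p')^2 = (y')^2 - 4 y p' q', and p' q' is expressed by y'' once p'' and q'' are replaced by means
  of their equations.\<close>

lemma product_fps_riccati:
  "product_fps\<^sup>2 - 1 = fps_X^4 * (2 * product_fps * fps_deriv (fps_deriv product_fps) - (fps_deriv product_fps)\<^sup>2)
     + 4 * fps_X^3 * product_fps * fps_deriv product_fps + fps_X\<^sup>2 * product_fps\<^sup>2"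
proof -
  define p where "p = bessel_fps"
  define q where "q = bessel_fps_neg"
  define x where "x = (fps_X :: real fps)"
  define p1 where "p1 = fps_deriv p"
  define q1 where "q1 = fps_deriv q"
  define p2 where "p2 = fps_deriv p1"
  define q2 where "q2 = fps_deriv q1"
  define c where "c = fps_const (1/4 :: real)"
  have c: "4 * c = 1" by (simp add: c_def numeral_fps_const flip: fps_const_1_eq_1)
  have ode: "x\<^sup>2 * p2 = - (2 * x * p1) - p1 - c * p" "x\<^sup>2 * q2 = - (2 * x * q1) + q1 - c * q"
    using bessel_fps_ode bessel_fps_neg_ode unfolding p_def q_def p1_def q1_def p2_def q2_def x_def c_def
    by (simp_all add: algebra_simps eq_neg_iff_add_eq_0)
  have W: "p * q - x\<^sup>2 * (p * q1 - q * p1) = 1"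
    using bessel_fps_wronskian unfolding p_def q_def p1_def q1_def x_def .
  have d: "fps_deriv product_fps = p1 * q + p * q1"
    "fps_deriv (p1 * q + p * q1) = p2 * q + 2 * p1 * q1 + p * q2"
    by (simp_all add: product_fps_def p_def q_def p1_def q1_def p2_def q2_def algebra_simps)
  have "x^4 * (2 * (p*q) * (p2 * q + 2 * p1 * q1 + p * q2) - (p1 * q + p * q1)\<^sup>2)
     + 4 * x^3 * (p*q) * (p1 * q + p * q1) + x\<^sup>2 * (p*q)\<^sup>2 
    = 2 * x\<^sup>2 * p * q * ((x\<^sup>2 * p2) * q + p * (x\<^sup>2 * q2)) + 4 * x^4 * p * q * p1 * q1 - x^4 * (p1 * q + p * q1)\<^sup>2
     + 4 * x^3 * (p*q) * (p1 * q + p * q1) + x\<^sup>2 * (p*q)\<^sup>2 "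
    by algebra
  also have "\<dots> = (p*q)\<^sup>2 - (p * q - x\<^sup>2 * (p * q1 - q * p1))\<^sup>2"
    unfolding ode using c by algebra
  finally show ?thesis
    unfolding W d unfolding product_fps_def p_def[symmetric] q_def[symmetric] x_def[symmetric] by simp
qed

lemma product_fps_nonzero: "product_fps $ 0 = 1" "product_fps \<noteq> 0"
proof -
  show *: "product_fps $ 0 = 1" by (simp add: product_fps_def bessel_fps_def bessel_fps_neg_def)
  show "product_fps \<noteq> 0" using * by auto
qed

text \<open>Differentiating the quadratic relation gives 2 y times the claimed linear relation, and
  2 y can be cancelled since formal power series over the reals form an integral domain. The result
  is the third-order equation of the symmetric square of Bessel's equation.\<close>

lemma product_fps_ode:
  "fps_deriv product_fps = fps_X^4 * fps_deriv (fps_deriv (fps_deriv product_fps))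
     + 6 * fps_X^3 * fps_deriv (fps_deriv product_fps) + 7 * fps_X\<^sup>2 * fps_deriv product_fps
     + fps_X * product_fps"
proof -
  define y where "y = product_fps"
  define y1 where "y1 = fps_deriv y"
  define y2 where "y2 = fps_deriv y1"
  define y3 where "y3 = fps_deriv y2"
  define x where "x = (fps_X :: real fps)"
  have dx: "fps_deriv x = 1" by (simp add: x_def)
  have "fps_deriv (y * y - 1) = fps_deriv (x*x*x*x * (2 * y * y2 - y1 * y1)
     + 4 * x*x*x * y * y1 + x*x * y * y)"
    using arg_cong[OF product_fps_riccati, of fps_deriv]
    unfolding y_def y1_def y2_def x_def power2_eq_square power3_eq_cube power4_eq_xxxx by (simp add: mult.assoc)
  then have "2 * y * (y1 - (x^4 * y3 + 6 * x^3 * y2 + 7 * x\<^sup>2 * y1 + x * y)) = 0"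
    unfolding fps_deriv_mult fps_deriv_sub fps_deriv_add dx y1_def[symmetric] y2_def[symmetric] y3_def[symmetric]
      fps_deriv_1 fps_deriv_numeral by algebra
  moreover have "2 * y \<noteq> 0" using product_fps_nonzero by (simp add: y_def)
  ultimately show ?thesis
    unfolding y_def y1_def y2_def y3_def x_def by simp
qed

text \<open>Coefficients of x^(j+1) are compared in the third-order equation; the cube arises from j
  (j - 1) (j - 2) + 6 j (j - 1) + 7 j + 1 = (j + 1)^3.\<close>

lemma product_fps_rec: "real (j + 2) * product_fps $ (j + 2) = real (j + 1) ^ 3 * product_fps $ j"
  and product_fps_1: "product_fps $ 1 = 0"
proof -
  have "fps_deriv product_fps $ (j + 1) = (fps_X^4 * fps_deriv (fps_deriv (fps_deriv product_fps))
     + 6 * (fps_X^3 * fps_deriv (fps_deriv product_fps)) + 7 * (fps_X\<^sup>2 * fps_deriv product_fps)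
     + fps_X * product_fps) $ (j + 1)"
    using product_fps_ode by (simp add: mult.assoc)
  also have "\<dots> = real j * (real j - 1) * (real j - 2) * product_fps $ j
    + 6 * real j * (real j - 1) * product_fps $ j + 7 * real j * product_fps $ j + product_fps $ j"
  proof -
    \<comment> \<open>For j < 3 some shifted terms are absent from the series; exactly there the
      polynomial factors vanish, so one formula covers all cases.\<close>
    consider "j = 0" | "j = 1" | "j = 2" | i where "j = i + 3"
      by (metis add.commute add_2_eq_Suc' le_Suc_ex less_2_cases not_less_eq_eq numeral_3_eq_3 numeral_2_eq_2 not_le One_nat_def)
    then show ?thesis
      by cases (auto simp: numeral_fps_const fps_X_power_mult_nth algebra_simps eval_nat_numeral)
  qed
  finally show "real (j + 2) * product_fps $ (j + 2) = real (j + 1) ^ 3 * product_fps $ j"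
    by (simp add: power3_eq_cube algebra_simps)
  have "fps_deriv product_fps $ 0 = 0"
    by (subst product_fps_ode) simp
  then show "product_fps $ 1 = 0" by simp
qed

lemma product_fps_odd: "odd j \<Longrightarrow> product_fps $ j = 0"
proof (induction j rule: less_induct)
  case (less j)
  show ?case
  proof (cases "j = 1")
    case False
    then obtain i where i: "j = i + 2"
      using less.prems by (metis add.commute add_2_eq_Suc' dvd_0_right not0_implies_Suc One_nat_def)
    then show ?thesis using less product_fps_rec[of i] by simp
  qed (use product_fps_1 in simp)
qed

lemma product_fps_even_pos: "product_fps $ (2 * k) > 0"
proof (induction k)
  case (Suc k)
  have "real (2 * k + 2) * product_fps $ (2 * Suc k) > 0"
    using Suc product_fps_rec[of "2 * k"] by (simp add: zero_less_mult_iff)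
  then show ?case by (simp add: zero_less_mult_iff)
qed (simp add: product_fps_nonzero)

text \<open>The product is the double factorial (2 k - 1)!!. From k to k + 1 the recursion
  contributes 2 (2 k + 1)^3 / (k + 1): the part 2 (2 k + 1) / (k + 1) is the growth of the central
  binomial coefficient, the remaining (2 k + 1)^2 that of the squared double factorial.\<close>

lemma product_fps_even_eq:
  "product_fps $ (2 * k) * 4 ^ k = of_nat ((2 * k choose k) * (\<Prod>j<k. 2 * j + 1)\<^sup>2)"
proof (induction k)
  case (Suc k)
  have "Suc k * ((2 * Suc k) choose Suc k) = 2 * (2 * k + 1) * ((2 * k) choose k)"
  proof -
    have "Suc k * ((2 * Suc k) choose Suc k) = (2 * k + 2) * ((2 * k + 1) choose k)"
      using Suc_times_binomial_eq[of "2 * k + 1" k] by (simp add: mult.commute)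
    moreover have "(k + 1) * ((2 * k + 1) choose k) = (2 * k + 1) * ((2 * k) choose k)"
      using binomial_absorb_comp[of "2 * k + 1" k] by simp
    ultimately show ?thesis by simp
  qed
  then have b: "real (Suc k) * real ((2 * Suc k) choose Suc k) = 2 * (2 * real k + 1) * real ((2 * k) choose k)"
    by (metis (mono_tags) of_nat_mult of_nat_add of_nat_numeral of_nat_1)
  have "real (Suc k) * (product_fps $ (2 * Suc k) * 4 ^ Suc k)
      = 2 * (2 * real k + 1) ^ 3 * (product_fps $ (2 * k) * 4 ^ k)"
  proof -
    have "real (Suc k) * (product_fps $ (2 * Suc k) * 4 ^ Suc k)
        = 2 * 4 ^ k * (real (2 * k + 2) * product_fps $ (2 * k + 2))"
      by (simp add: algebra_simps)
    then show ?thesis unfolding product_fps_rec[of "2 * k"] by (simp add: mult_ac add_ac)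
  qed
  also have "\<dots> = (2 * (2 * real k + 1) * real ((2 * k) choose k)) * ((2 * real k + 1) * (\<Prod>j<k. 2 * real j + 1))\<^sup>2"
    unfolding Suc by (simp add: power3_eq_cube power2_eq_square algebra_simps)
  also have "\<dots> = real (Suc k) * of_nat ((2 * Suc k choose Suc k) * (\<Prod>j<Suc k. 2 * j + 1)\<^sup>2)"
    unfolding b[symmetric] by (simp add: algebra_simps del: binomial_Suc_Suc)
  finally show ?case
    by (metis mult_cancel_left of_nat_0_eq_iff nat.distinct(1))
qed (simp add: product_fps_nonzero)

section \<open>Integrality, parity and positivity of the coefficients of powers\<close>

lemma fps_scaled_Ints_power:
  fixes F :: "real fps"
  assumes "\<And>j. F $ j * c ^ j \<in> \<int>"
  shows "(F ^ m) $ j * c ^ j \<in> \<int>"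
proof (induction m arbitrary: j)
  case (Suc m)
  have "(F ^ Suc m) $ j * c ^ j = (\<Sum>i=0..j. (F $ i * c ^ i) * ((F ^ m) $ (j - i) * c ^ (j - i)))"
    by (simp add: fps_mult_nth sum_distrib_right) (intro sum.cong, auto simp flip: power_add)
  then show ?case using Ints_mult[OF assms Suc.IH] by (auto intro!: Ints_sum simp del: power_Suc)
qed (auto simp: fps_one_nth)

lemma product_fps_scaled_Ints: "product_fps $ j * 2 ^ j \<in> \<int>"
proof (cases "even j")
  case True
  then obtain k where "j = 2 * k" by blast
  then have "product_fps $ j * 2 ^ j = of_nat ((2 * k choose k) * (\<Prod>j<k. 2 * j + 1)\<^sup>2)"
    using product_fps_even_eq[of k] by (simp only: power_mult) simp
  then show ?thesis by (metis Ints_of_nat)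
qed (simp add: product_fps_odd)

lemma product_fps_power_odd: "odd j \<Longrightarrow> (product_fps ^ m) $ j = 0"
proof (induction m arbitrary: j)
  case (Suc m)
  have "product_fps $ i * (product_fps ^ m) $ (j - i) = 0" if "i \<le> j" for i
    using Suc that product_fps_odd[of i] by (cases "even i") auto
  then show ?case by (auto simp: fps_mult_nth intro!: sum.neutral)
qed (auto simp: fps_one_nth odd_pos)

lemma product_fps_power_nonneg: "(product_fps ^ m) $ j \<ge> 0"
proof (induction m arbitrary: j)
  case (Suc m)
  have "product_fps $ i \<ge> 0" for i
    using product_fps_even_pos[of "i div 2"] product_fps_odd[of i] by (cases "even i") auto
  with Suc show ?case by (simp add: fps_mult_nth sum_nonneg)
qed (auto simp: fps_one_nth)

lemma product_fps_power_even_pos: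
  assumes "m > 0" shows "(product_fps ^ m) $ (2 * k) > 0"
proof -
  obtain l where m: "m = Suc l" using assms by (metis Suc_pred)
  have nn: "product_fps $ i \<ge> 0" for i
    using product_fps_even_pos[of "i div 2"] product_fps_odd[of i] by (cases "even i") auto
  have "0 < product_fps $ (2 * k) * (product_fps ^ l) $ 0"
    by (simp add: product_fps_even_pos fps_nth_power_0 product_fps_nonzero)
  also have "\<dots> \<le> (\<Sum>i=0..2*k. product_fps $ i * (product_fps ^ l) $ (2 * k - i))"
    using member_le_sum[of "2*k" "{0..2*k}" "\<lambda>i. product_fps $ i * (product_fps ^ l) $ (2 * k - i)"]
    by (simp add: nn product_fps_power_nonneg)
  finally show ?thesis by (simp add: m fps_mult_nth)
qed

text \<open>There is real cancellation here, since y has the coefficient 1/2 at x^2. The recursion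
  for g involves r = (y')^2, whose coefficients are not integral on sight; they are solved from r g
  = h^2, without division because g has constant term 1.\<close>

lemma product_fps_square_Ints: "(product_fps\<^sup>2) $ n \<in> \<int>"
proof -
  define y where "y = product_fps"
  define g where "g = y\<^sup>2"
  define h where "h = y * fps_deriv y"
  define r where "r = (fps_deriv y)\<^sup>2"
  have g0: "g $ 0 = 1" by (simp add: g_def y_def product_fps_nonzero fps_nth_power_0)
  have rg: "r * g = h\<^sup>2" by (simp add: r_def g_def h_def power_mult_distrib mult.commute)
  have g1: "fps_deriv g = 2 * h" by (simp add: g_def h_def fps_deriv_power mult.assoc)
  have g2: "fps_deriv (fps_deriv g) = 2 * (r + y * fps_deriv (fps_deriv y))"
    unfolding g1 by (simp add: h_def r_def power2_eq_square)
  have "g - 1 = fps_X^4 * (2 * (y * fps_deriv (fps_deriv y)) - r) + 4 * fps_X^3 * h + fps_X\<^sup>2 * g"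
    using product_fps_riccati unfolding g_def r_def h_def y_def by (simp add: mult.assoc)
  then have "g - 1 = fps_X^4 * (fps_deriv (fps_deriv g) - 3 * r) + 2 * fps_X^3 * fps_deriv g + fps_X\<^sup>2 * g"
    unfolding g2 unfolding g1 by (simp add: algebra_simps)
  then have g: "g = 1 + fps_X^4 * fps_deriv (fps_deriv g) - 3 * (fps_X^4 * r) + 2 * (fps_X^3 * fps_deriv g) + fps_X\<^sup>2 * g"
    by (simp add: algebra_simps)
  have "g $ n \<in> \<int>"
  proof (induction n rule: less_induct)
    case (less n)
    \<comment> \<open>The 1/2 in h = g' / 2 is harmless because g is even: for even i the
      coefficient of g at i + 1 vanishes, for odd i the factor i + 1 is even.\<close>
    have h: "h $ i \<in> \<int>" if "i + 1 < n" for i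
    proof (cases "even i")
      case True
      then have "g $ (i + 1) = 0"
        using product_fps_power_odd[of "i + 1" 2] by (simp add: g_def y_def)
      then show ?thesis using arg_cong[OF g1, of "\<lambda>f. f $ i"] by (simp add: numeral_fps_const)
    next
      case False
      then obtain k where k: "i + 1 = 2 * k" by (metis even_plus_one_iff evenE)
      have "2 * h $ i = real (2 * k) * g $ (i + 1)"
        using arg_cong[OF g1, of "\<lambda>f. f $ i"] k by (simp add: numeral_fps_const flip: of_nat_Suc)
      then have "h $ i = real k * g $ (i + 1)" by simp
      then show ?thesis using less[OF that] by simp
    qed
    \<comment> \<open>The coefficient of r at i involves g up to index i + 1, so the bound keeps
      this inner recursion within the outer induction hypothesis. It is used for i = n - 4.\<close>
    have r: "r $ i \<in> \<int>" if "i + 1 < n" for i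
      using that
    proof (induction i rule: less_induct)
      case (less i)
      have "(h * h) $ i = r $ i * g $ 0 + (\<Sum>l=0..<i. r $ l * g $ (i - l))"
        unfolding power2_eq_square[symmetric] rg[symmetric] fps_mult_nth
        by (subst sum.last_plus) simp_all
      then have "r $ i = (\<Sum>l=0..i. h $ l * h $ (i - l)) - (\<Sum>l=0..<i. r $ l * g $ (i - l))"
        by (simp add: g0 fps_mult_nth)
      also have "\<dots> \<in> \<int>"
        using less h less.prems \<open>\<And>y. y < n \<Longrightarrow> g $ y \<in> \<int>\<close> by (intro Ints_diff Ints_sum Ints_mult) auto
      finally show ?case .
    qed
    have "g $ n = (1 + fps_X^4 * fps_deriv (fps_deriv g) - 3 * (fps_X^4 * r)
        + 2 * (fps_X^3 * fps_deriv g) + fps_X\<^sup>2 * g) $ n"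
      using arg_cong[OF g, of "\<lambda>f. f $ n"] .
    also have "\<dots> = (if n = 0 then 1 else 0)
       + (if n < 4 then 0 else (real (n - 4) + 1) * (real (n - 4) + 2) * g $ (n - 2))
       - 3 * (if n < 4 then 0 else r $ (n - 4)) + 2 * (if n < 3 then 0 else (real (n - 3) + 1) * g $ (n - 2))
       + (if n < 2 then 0 else g $ (n - 2))"
    proof (cases "n < 4")
      case False
      then obtain i where "n = i + 4" by (metis add.commute le_Suc_ex not_less)
      then show ?thesis
        by (simp add: numeral_fps_const fps_X_power_mult_nth eval_nat_numeral algebra_simps)
    next
      case True
      then consider "n = 0" | "n = 1" | "n = 2" | "n = 3" by linarith
      then show ?thesis
        by cases (simp_all add: numeral_fps_const fps_X_power_mult_nth)
    qed
    also have "\<dots> \<in> \<int>"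
      using less[of "n - 2"] r[of "n - 4"] by auto
    finally show ?case .
  qed
  then show ?thesis by (simp add: g_def y_def)
qed

section \<open>Laplace transforms\<close>

lemma set_integrable_congD:
  assumes "set_integrable M A f" "\<And>x. x \<in> A \<Longrightarrow> f x = g x"
  shows "set_integrable M A g"
proof -
  have "set_integrable M A f = set_integrable M A g"
    by (rule set_integrable_cong[OF refl refl]) (rule assms(2))
  with assms(1) show ?thesis by simp
qed

lemma set_integrable_complex_of_real:
  "set_integrable M A u \<Longrightarrow> set_integrable M A (\<lambda>x. complex_of_real (u x))"
  using complex_of_real_integrable_eq[of M "\<lambda>x. indicator A x *\<^sub>R u x"]
  unfolding set_integrable_def by (simp add: scaleR_conv_of_real)

lemma set_borel_measurable_continuous_on_open:
  fixes f :: "real \<Rightarrow> 'a::real_normed_vector"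
  assumes "open S" "continuous_on S f"
  shows "set_borel_measurable lborel S f"
  unfolding set_borel_measurable_def
  using borel_measurable_continuous_on_indicator[of S f] assms by (simp add: measurable_lborel2)

lemma set_integrable_powr_exp:
  assumes "a > -1" "c > 0"
  shows "set_integrable lborel {0<..} (\<lambda>t::real. t powr a * exp (- c * t))"
proof -
  have "(\<lambda>t. complex_of_real t powr (of_real (a + 1) - 1) / of_real (exp (c * t))) absolutely_integrable_on {0<..}"
    by (rule absolutely_integrable_Gamma_integral) (use assms in auto)
  also have "?this \<longleftrightarrow> (\<lambda>t. complex_of_real (t powr a * exp (- c * t))) absolutely_integrable_on {0<..}"
    by (rule set_integrable_cong) (auto simp: powr_of_real exp_minus field_simps)
  finally have "set_integrable lebesgue {0<..} (\<lambda>t. norm (complex_of_real (t powr a * exp (- c * t))))"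
    by (rule set_integrable_norm)
  then have "set_integrable lebesgue {0<..} (\<lambda>t. t powr a * exp (- c * t))"
    by (simp add: norm_mult)
  moreover have "set_borel_measurable lborel {0<..} (\<lambda>t::real. t powr a * exp (- c * t))"
    by (rule set_borel_measurable_continuous_on_open) (auto intro!: continuous_intros)
  ultimately show ?thesis
    unfolding set_integrable_def set_borel_measurable_def by (simp add: integrable_completion)
qed

lemma set_integral_powr_exp:
  fixes a c :: real
  assumes "a > -1" "c > 0"
  shows "(LBINT t:{0<..}. t powr a * exp (- c * t)) = Gamma (a + 1) * c powr (- (a + 1))"
proof -
  have "((\<lambda>t. t powr (a + 1 - 1) / exp t) has_integral Gamma (a + 1)) {0..}"
    using Gamma_integral_real[of "a + 1"] assms by simp
  also have "?this \<longleftrightarrow> ((\<lambda>t. t powr (a + 1 - 1) / exp t) has_integral Gamma (a + 1)) {0<..}"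
    by (rule has_integral_spike_set_eq) (auto intro: negligible_subset[of "{0::real}"])
  finally have "((\<lambda>t. t powr (a + 1 - 1) / exp t) has_integral Gamma (a + 1)) {0<..}" .
  then have G: "((\<lambda>t. t powr a * exp (- 1 * t)) has_integral Gamma (a + 1)) {0<..}"
    by (simp add: exp_minus field_simps)
  have 1: "(LBINT t:{0<..}. t powr a * exp (- 1 * t)) = Gamma (a + 1)"
    using set_borel_integral_eq_integral(2)[OF set_integrable_powr_exp[of a 1]] G assms
    by (simp add: integral_unique)
  have "Gamma (a + 1) = c * (LBINT x. indicator {0<..} (c * x) *\<^sub>R ((c * x) powr a * exp (- (c * x))))"
    using assms unfolding 1[symmetric] set_lebesgue_integral_def
    by (subst lborel_integral_real_affine[where c = c and t = 0]) auto
  also have "\<dots> = c * (LBINT x. c powr a *  (indicator {0<..} x *\<^sub>R (x powr a * exp (- c * x))))"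
    using assms
    by (intro arg_cong[of _ _ "\<lambda>x. c * x"] Bochner_Integration.integral_cong)
       (auto simp: indicator_def powr_mult zero_less_mult_iff)
  also have "\<dots> = c powr (a + 1) * (LBINT t:{0<..}. t powr a * exp (- c * t))"
    using assms by (simp add: set_lebesgue_integral_def powr_add)
  finally have "Gamma (a + 1) = c powr (a + 1) * (LBINT t:{0<..}. t powr a * exp (- c * t))" .
  then show ?thesis using assms by (subst powr_minus) simp
qed

lemma laplace_set_integrable:
  fixes k :: "real \<Rightarrow> complex"
  assumes k: "set_borel_measurable lborel {0<..} k" and a: "a > -1"
    and bound: "\<And>t. t > 0 \<Longrightarrow> norm (k t) \<le> C * t powr a" and s: "Re s > 0"
  shows "set_integrable lborel {0<..} (\<lambda>t. exp (- s * of_real t) * k t)"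
proof (rule set_integrable_bound)
  show "set_integrable lborel {0<..} (\<lambda>t. C * (t powr a * exp (- Re s * t)))"
    using set_integrable_powr_exp[OF a s] by simp
  have "(\<lambda>t. exp (- s * of_real t) * (indicator {0<..} t *\<^sub>R k t)) \<in> borel_measurable lborel"
    using k unfolding set_borel_measurable_def by measurable
  then show "set_borel_measurable lborel {0<..} (\<lambda>t. exp (- s * of_real t) * k t)"
    unfolding set_borel_measurable_def by (simp add: mult.commute mult.left_commute scaleR_conv_of_real)
  show "AE t in lborel. t \<in> {0<..} \<longrightarrow> norm (exp (- s * of_real t) * k t)
      \<le> norm (C * (t powr a * exp (- Re s * t)))"
  proof (intro AE_I2 impI)
    fix t :: real assume t: "t \<in> {0<..}"
    have "norm (exp (- s * of_real t) * k t) \<le> exp (- Re s * t) * (C * t powr a)"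
      using bound[of t] t by (simp add: norm_mult)
    then show "norm (exp (- s * of_real t) * k t) \<le> norm (C * (t powr a * exp (- Re s * t)))"
      by (simp add: mult_ac)
  qed
qed

lemma laplace_bound:
  fixes k :: "real \<Rightarrow> complex"
  assumes k: "set_borel_measurable lborel {0<..} k" and a: "a > -1"
    and bound: "\<And>t. t > 0 \<Longrightarrow> norm (k t) \<le> C * t powr a" and s: "Re s > 0"
  shows "norm (LBINT t:{0<..}. exp (- s * of_real t) * k t) \<le> C * (Gamma (a + 1) * Re s powr (- (a + 1)))"
proof -
  have "norm (LBINT t:{0<..}. exp (- s * of_real t) * k t) \<le> (LBINT t:{0<..}. norm (exp (- s * of_real t) * k t))"
    by (rule set_integral_norm_bound[OF laplace_set_integrable[OF assms]])
  also have "\<dots> \<le> (LBINT t:{0<..}. C * (t powr a * exp (- Re s * t)))"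
  proof (rule set_integral_mono)
    show "set_integrable lborel {0<..} (\<lambda>t. norm (exp (- s * of_real t) * k t))"
      by (rule set_integrable_norm[OF laplace_set_integrable[OF assms]])
    show "set_integrable lborel {0<..} (\<lambda>t. C * (t powr a * exp (- Re s * t)))"
      using set_integrable_powr_exp[OF a s] by simp
    fix t :: real assume t: "t \<in> {0<..}"
    show "norm (exp (- s * of_real t) * k t) \<le> C * (t powr a * exp (- Re s * t))"
      using bound[of t] t by (simp add: norm_mult mult_ac)
  qed
  also have "\<dots> = C * (Gamma (a + 1) * Re s powr (- (a + 1)))"
    using set_integral_powr_exp[OF a s] by simp
  finally show ?thesis .
qed

text \<open>Dominated convergence for the difference quotients. By the mean value inequality on the
  convex half plane Re >= c they are at most t exp (- c t), so C t^(a+1) exp (- c t) is a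
  majorant.\<close>

lemma laplace_holomorphic:
  fixes k :: "real \<Rightarrow> complex"
  assumes k: "set_borel_measurable lborel {0<..} k" and a: "a > -1"
    and bound: "\<And>t. t > 0 \<Longrightarrow> norm (k t) \<le> C * t powr a"
  shows "(\<lambda>s. LBINT t:{0<..}. exp (- s * of_real t) * k t) holomorphic_on {s. Re s > 0}"
proof -
  define F where "F = (\<lambda>s. LBINT t:{0<..}. exp (- s * of_real t) * k t)"
  have "(F has_field_derivative (LBINT t:{0<..}. - of_real t * exp (- s * of_real t) * k t)) (at s)"
    (is "(_ has_field_derivative ?D) _") if s: "Re s > 0" for s
  proof -
    \<comment> \<open>Any value strictly between 0 and Re s works: the decay exp (- c t) is then
      uniform near s and absorbs the factor t of the derivative.\<close>
    define c where "c = Re s / 2"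
    have c: "c > 0" "Re s > c" using s by (auto simp: c_def)
    have lip: "norm ((exp (- w * of_real t) - exp (- s * of_real t)) / (w - s)) \<le> t * exp (- c * t)"
      if "Re w \<ge> c" "w \<noteq> s" "t > 0" for w t
    proof -
      have "norm (exp (- w * of_real t) - exp (- s * of_real t)) \<le> (t * exp (- c * t)) * norm (w - s)"
      proof (rule field_differentiable_bound[OF convex_halfspace_Re_ge])
        fix z assume "z \<in> {z. c \<le> Re z}"
        then show "norm (- of_real t * exp (- z * of_real t)) \<le> t * exp (- c * t)"
          using that by (simp add: norm_mult)
        show "((\<lambda>w. exp (- w * of_real t)) has_field_derivative - of_real t * exp (- z * of_real t))
            (at z within {z. c \<le> Re z})"
          by (auto intro!: derivative_eq_intros)
      qed (use that c in auto)
      then show ?thesis using that by (simp add: norm_divide divide_simps)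
    qed
    have "((\<lambda>w. (F w - F s) / (w - s)) \<longlongrightarrow> ?D) (at s)"
      unfolding tendsto_at_iff_sequentially
    proof (intro allI impI)
      fix X assume X: "\<forall>i. X i \<in> UNIV - {s}" "X \<longlonglongrightarrow> s"
      have "(\<lambda>i. Re (X i)) \<longlonglongrightarrow> Re s" using X by (intro tendsto_intros)
      then have "eventually (\<lambda>i. Re (X i) > c) sequentially" using c order_tendstoD(1) by blast
      then obtain N where N: "\<And>i. i \<ge> N \<Longrightarrow> Re (X i) > c" by (auto simp: eventually_sequentially)
      define Y where "Y = (\<lambda>i. X (i + N))"
      have Y: "Re (Y i) > c" "Y i \<noteq> s" for i using X N[of "i + N"] by (auto simp: Y_def)
      have Ylim: "Y \<longlonglongrightarrow> s" unfolding Y_def using X(2) by (rule LIMSEQ_ignore_initial_segment)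
      have eq: "(F (Y i) - F s) / (Y i - s) =
          (LBINT t:{0<..}. (exp (- Y i * of_real t) - exp (- s * of_real t)) / (Y i - s) * k t)" for i
      proof -
        have "F (Y i) - F s = (LBINT t:{0<..}. exp (- Y i * of_real t) * k t - exp (- s * of_real t) * k t)"
          unfolding F_def using Y[of i] c
          by (intro set_integral_diff(2)[symmetric] laplace_set_integrable[OF k a bound]) auto
        moreover have "(exp (- Y i * of_real t) - exp (- s * of_real t)) / (Y i - s) * k t
            = (exp (- Y i * of_real t) * k t - exp (- s * of_real t) * k t) / (Y i - s)" for t
          by (simp add: left_diff_distrib)
        ultimately show ?thesis by (simp only: set_integral_divide_zero)
      qed
      have "(\<lambda>i. LBINT t:{0<..}. (exp (- Y i * of_real t) - exp (- s * of_real t)) / (Y i - s) * k t) \<longlonglongrightarrow> ?D"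
        unfolding set_lebesgue_integral_def
      proof (rule integral_dominated_convergence)
        show "integrable lborel (\<lambda>t. indicator {0<..} t *\<^sub>R (C * (t powr (a + 1) * exp (- c * t))))"
          using set_integrable_powr_exp[of "a + 1" c] a c unfolding set_integrable_def[symmetric] by simp
        have m: "(\<lambda>t. h t * (indicator {0<..} t *\<^sub>R k t)) \<in> borel_measurable lborel"
          if "h \<in> borel_measurable borel" for h
          using k that unfolding set_borel_measurable_def by measurable
        show "(\<lambda>t. indicator {0<..} t *\<^sub>R (- of_real t * exp (- s * of_real t) * k t)) \<in> borel_measurable lborel"
          using m[of "\<lambda>t. - of_real t * exp (- s * of_real t)"] by (simp add: mult_ac scaleR_conv_of_real)
        show "(\<lambda>t. indicator {0<..} t *\<^sub>R ((exp (- Y i * of_real t) - exp (- s * of_real t)) / (Y i - s) * k t))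
            \<in> borel_measurable lborel" for i
          using m[of "\<lambda>t. (exp (- Y i * of_real t) - exp (- s * of_real t)) / (Y i - s)"]
          by (simp add: mult_ac scaleR_conv_of_real)
        show "AE t in lborel. (\<lambda>i. indicator {0<..} t *\<^sub>R ((exp (- Y i * of_real t) - exp (- s * of_real t)) / (Y i - s) * k t))
            \<longlonglongrightarrow> indicator {0<..} t *\<^sub>R (- of_real t * exp (- s * of_real t) * k t)"
        proof (intro AE_I2 tendsto_scaleR tendsto_mult tendsto_const)
          fix t :: real
          have "((\<lambda>w. exp (- w * of_real t)) has_field_derivative - of_real t * exp (- s * of_real t)) (at s)"
            by (auto intro!: derivative_eq_intros)
          then have "((\<lambda>w. (exp (- w * of_real t) - exp (- s * of_real t)) / (w - s)) \<longlongrightarrow> - of_real t * exp (- s * of_real t)) (at s)"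
            by (simp add: has_field_derivative_iff)
          then show "(\<lambda>i. (exp (- Y i * of_real t) - exp (- s * of_real t)) / (Y i - s)) \<longlonglongrightarrow> - of_real t * exp (- s * of_real t)"
            unfolding tendsto_at_iff_sequentially using Y Ylim by (auto simp: o_def)
        qed
        show "AE t in lborel. norm (indicator {0<..} t *\<^sub>R ((exp (- Y i * of_real t) - exp (- s * of_real t)) / (Y i - s) * k t))
            \<le> indicator {0<..} t *\<^sub>R (C * (t powr (a + 1) * exp (- c * t)))" for i
        proof (intro AE_I2)
          fix t :: real
          show "norm (indicator {0<..} t *\<^sub>R ((exp (- Y i * of_real t) - exp (- s * of_real t)) / (Y i - s) * k t))
            \<le> indicator {0<..} t *\<^sub>R (C * (t powr (a + 1) * exp (- c * t)))"
          proof (cases "t > 0")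
            case True
            have "norm ((exp (- Y i * of_real t) - exp (- s * of_real t)) / (Y i - s) * k t)
                \<le> (t * exp (- c * t)) * (C * t powr a)"
              unfolding norm_mult using lip[of "Y i" t] Y[of i] bound[of t] True
              by (intro mult_mono) auto
            then show ?thesis using True by (simp add: powr_add mult_ac)
          qed simp
        qed
      qed
      then have "(\<lambda>i. (F (Y i) - F s) / (Y i - s)) \<longlonglongrightarrow> ?D" by (simp only: eq)
      then have "(\<lambda>i. (F (X i) - F s) / (X i - s)) \<longlonglongrightarrow> ?D"
        unfolding Y_def by (rule LIMSEQ_offset)
      then show "((\<lambda>w. (F w - F s) / (w - s)) \<circ> X) \<longlonglongrightarrow> ?D" by (simp add: o_def)
    qed
    then show ?thesis by (simp add: has_field_derivative_iff)
  qed
  then show ?thesis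
    unfolding F_def by (subst holomorphic_on_open) (auto simp: open_halfspace_Re_gt)
qed

text \<open>Identity theorem: both sides are holomorphic in the right half plane and agree on the
  positive reals, where the formula is the rescaled Gamma integral.\<close>

lemma laplace_powr:
  assumes a: "a > -1" and s: "Re s > 0"
  shows "(LBINT t:{0<..}. exp (- s * of_real t) * of_real (t powr a)) 
    = of_real (Gamma (a + 1)) * s powr (- of_real (a + 1))"
proof -
  define F where "F = (\<lambda>s. LBINT t:{0<..}. exp (- s * complex_of_real t) * of_real (t powr a))"
  define H where "H = (\<lambda>s. F s - of_real (Gamma (a + 1)) * s powr (- of_real (a + 1)))"
  have "H s = 0"
  proof (rule analytic_continuation[of H "{s. Re s > 0}" "of_real ` {0<..}" 1 s])
    have "F holomorphic_on {s. Re s > 0}"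
      unfolding F_def
      by (rule laplace_holomorphic[of _ a 1])
         (use a in \<open>auto intro!: set_borel_measurable_continuous_on_open continuous_intros\<close>)
    then show "H holomorphic_on {s. Re s > 0}"
      unfolding H_def by (auto intro!: holomorphic_intros simp: complex_nonpos_Reals_iff)
    show "1 islimpt complex_of_real ` {0<..}"
      unfolding islimpt_approachable
    proof (intro allI impI)
      fix e :: real assume "e > 0"
      then show "\<exists>x'\<in>complex_of_real ` {0<..}. x' \<noteq> 1 \<and> dist x' 1 < e"
        by (intro bexI[of _ "of_real (1 + e / 2)"] imageI) (auto simp: dist_norm)
    qed
    fix z assume "z \<in> complex_of_real ` {0<..}"
    then obtain x where x: "z = of_real x" "x > 0" by auto
    have "F z = (LBINT t:{0<..}. complex_of_real (t powr a * exp (- x * t)))"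
      unfolding F_def x(1) by (simp add: exp_of_real[symmetric] mult.commute)
    also have "\<dots> = of_real (LBINT t:{0<..}. t powr a * exp (- x * t))"
      by (rule set_integral_complex_of_real)
    also have "\<dots> = of_real (Gamma (a + 1)) * z powr (- of_real (a + 1))"
      using set_integral_powr_exp[OF a x(2)] powr_of_real[of x "- (a + 1)"] x by simp
    finally show "H z = 0" by (simp add: H_def)
  qed (use s in \<open>auto simp: open_halfspace_Re_gt convex_connected convex_halfspace_Re_gt\<close>)
  then show ?thesis by (simp add: H_def F_def)
qed

section \<open>Bessel functions as Laplace integrals\<close>

lemma half_le_cosh: "u / 2 \<le> cosh (u::real)"
proof -
  have "u \<le> exp u + exp (- u)"
    using exp_ge_add_one_self[of u] exp_ge_zero[of "-u"] by linarith
  then show ?thesis by (simp add: cosh_def)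
qed

lemma bessel_K0_integrable:
  fixes t :: real
  assumes "t > 0"
  shows "set_integrable lborel {0<..} (\<lambda>u. exp (- t * cosh u))"
proof (rule set_integrable_bound)
  show "set_integrable lborel {0<..} (\<lambda>u::real. u powr 0 * exp (- (t / 2) * u))"
    by (rule set_integrable_powr_exp) (use assms in auto)
  show "set_borel_measurable lborel {0<..} (\<lambda>u. exp (- t * cosh u))"
    by (rule set_borel_measurable_continuous_on_open) (auto intro!: continuous_intros)
  show "AE u in lborel. u \<in> {0<..} \<longrightarrow> norm (exp (- t * cosh u)) \<le> norm (u powr 0 * exp (- (t / 2) * u))"
  proof (intro AE_I2 impI)
    fix u :: real assume "u \<in> {0<..}"
    moreover have "u / 2 \<le> cosh u"
      by (rule half_le_cosh)
    ultimately show "norm (exp (- t * cosh u)) \<le> norm (u powr 0 * exp (- (t / 2) * u))"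
      using assms mult_left_mono[of "u / 2" "cosh u" t] by simp
  qed
qed

lemma bessel_K0_eq: "bessel_K0 t = (LBINT u:{0<..}. exp (- t * cosh u))"
  unfolding bessel_K0_def by (rule set_integral_discrete_difference[of "{0}"]) auto

text \<open>The substitution x = (cosh u + b) / 2 is carried out once for both representations of
  K0: b = 1 leads to the range beyond the branch point 1, b = - 1 to the whole half line.\<close>

lemma K0_substitution:
  fixes f :: "real \<Rightarrow> real"
  assumes t: "t > 0" and contf: "\<And>x. x > (1 + b) / 2 \<Longrightarrow> isCont f x"
    and f: "\<And>u. u > 0 \<Longrightarrow> f ((cosh u + b) / 2) * (sinh u / 2) = exp (- t * b) * exp (- t * cosh u)"
    and nn: "\<And>x. x > (1 + b) / 2 \<Longrightarrow> f x \<ge> 0"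
  shows "set_integrable lborel {(1 + b) / 2<..} f"
    and "(LBINT x:{(1 + b) / 2<..}. f x) = exp (- t * b) * bessel_K0 t"
proof -
  have ei: "einterval 0 \<infinity> = {0<..}" by (auto simp: einterval_def zero_ereal_def)
  have f': "exp (- t * b) * exp (- t * cosh u) = f ((cosh u + b) / 2) * (sinh u / 2)" if "u \<in> {0<..}" for u
    using f that by simp
  have int: "set_integrable lborel (einterval 0 \<infinity>) (\<lambda>u. f ((cosh u + b) / 2) * (sinh u / 2))"
  proof -
    have "set_integrable lborel {0<..} (\<lambda>u. exp (- t * b) * exp (- t * cosh u))"
      using bessel_K0_integrable[OF t] by simp
    also have "?this \<longleftrightarrow> ?thesis"
      unfolding ei by (rule set_integrable_cong[OF refl refl f'])
    finally show ?thesis .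
  qed
  have A: "((ereal \<circ> (\<lambda>u. (cosh u + b) / 2) \<circ> real_of_ereal) \<longlongrightarrow> ereal ((1 + b) / 2)) (at_right 0)"
  proof -
    have "((\<lambda>u. (cosh u + b) / 2) \<longlongrightarrow> (cosh 0 + b) / 2) (at_right (0::real))"
      by (intro tendsto_intros) simp_all
    then show ?thesis by (simp add: ereal_tendsto_simps zero_ereal_def)
  qed
  have B: "((ereal \<circ> (\<lambda>u. (cosh u + b) / 2) \<circ> real_of_ereal) \<longlongrightarrow> \<infinity>) (at_left \<infinity>)"
  proof -
    have "filterlim (\<lambda>u. (cosh u + b) / 2) at_top (at_top :: real filter)"
    proof (rule filterlim_at_top_mono)
      show "filterlim (\<lambda>u::real. b / 2 + 1 / 4 * u) at_top at_top"
        by (rule filterlim_tendsto_add_at_top[OF tendsto_const filterlim_tendsto_pos_mult_at_top[OF tendsto_const]])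
           (auto intro: filterlim_ident)
      have "b / 2 + 1 / 4 * u \<le> (cosh u + b) / 2" for u :: real
        using half_le_cosh[of u] by simp
      then show "eventually (\<lambda>u::real. b / 2 + 1 / 4 * u \<le> (cosh u + b) / 2) at_top" by simp
    qed
    then show ?thesis by (simp add: ereal_tendsto_simps)
  qed
  have gt: "cosh u > 1" if "u > 0" for u :: real
    using cosh_real_strict_mono[of 0 u] that by simp
  note subst = interval_integral_substitution_nonneg
    [of 0 \<infinity> "\<lambda>u. (cosh u + b) / 2" "\<lambda>u. sinh u / 2" f, OF _ _ _ _ _ _ A B int]
  have "set_integrable lborel (einterval ((1 + b) / 2) \<infinity>) f \<and>
    (LBINT x=(1 + b) / 2..\<infinity>. f x) = (LBINT u=0..\<infinity>. f ((cosh u + b) / 2) * (sinh u / 2))"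
    by (intro conjI subst; (auto intro!: derivative_eq_intros continuous_intros contf nn simp: zero_ereal_def; fail)?)
       (auto intro!: derivative_eq_intros continuous_intros contf nn gt simp: zero_ereal_def)
  then have *: "set_integrable lborel {(1 + b) / 2<..} f"
    "(LBINT x:{(1 + b) / 2<..}. f x) = (LBINT u:{0<..}. f ((cosh u + b) / 2) * (sinh u / 2))"
    by (simp_all add: interval_integral_to_infinity_eq zero_ereal_def)
  show "set_integrable lborel {(1 + b) / 2<..} f" by (rule *(1))
  have "(LBINT u:{0<..}. f ((cosh u + b) / 2) * (sinh u / 2)) = (LBINT u:{0<..}. exp (- t * b) * exp (- t * cosh u))"
    by (rule set_lebesgue_integral_cong) (simp, intro allI impI f'[symmetric])
  with * show "(LBINT x:{(1 + b) / 2<..}. f x) = exp (- t * b) * bessel_K0 t"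
    by (simp add: bessel_K0_eq)
qed

lemma exp_split: "exp (- 2 * t * ((c + b) / 2)) = exp (- t * b) * exp (- t * (c::real))"
  by (simp flip: exp_add) (simp add: field_simps)

lemma sqrt_sinh: "u > 0 \<Longrightarrow> sqrt ((cosh u + 1) / 2) * sqrt ((cosh u - 1) / 2) = sinh (u::real) / 2"
proof -
  assume "u > 0"
  have "((cosh u + 1) / 2) * ((cosh u - 1) / 2) = (sinh u / 2)\<^sup>2"
    using hyperbolic_pythagoras[of u] by (simp add: power2_eq_square algebra_simps)
  then show ?thesis using \<open>u > 0\<close> by (simp flip: real_sqrt_mult)
qed

text \<open>Up to a constant factor - i this is the part beyond the branch point 1 of the integral
  that will represent exp (- t) (pi I0 - i K0).\<close>

lemma bessel_K0_upper_integral: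
  assumes "t > 0"
  shows "set_integrable lborel {1<..} (\<lambda>x. exp (- 2 * t * x) / (sqrt x * sqrt (x - 1)))"
    and "(LBINT x:{1<..}. exp (- 2 * t * x) / (sqrt x * sqrt (x - 1))) = exp (- t) * bessel_K0 t"
proof -
  have f: "exp (- 2 * t * ((cosh u + 1) / 2)) / (sqrt ((cosh u + 1) / 2) * sqrt ((cosh u + 1) / 2 - 1)) * (sinh u / 2)
      = exp (- t * 1) * exp (- t * cosh u)" if "u > 0" for u
  proof -
    have e: "(cosh u + 1) / 2 - 1 = (cosh u - 1) / 2" by (simp add: field_simps)
    show ?thesis
      unfolding e exp_split using that sqrt_sinh[OF that] by simp
  qed
  have cont: "isCont (\<lambda>x. exp (- 2 * t * x) / (sqrt x * sqrt (x - 1))) x" if "x > 1" for x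
    using that by (auto intro!: continuous_intros)
  have nn: "exp (- 2 * t * x) / (sqrt x * sqrt (x - 1)) \<ge> 0" if "x > 1" for x
    using that by simp
  show "set_integrable lborel {1<..} (\<lambda>x. exp (- 2 * t * x) / (sqrt x * sqrt (x - 1)))"
    "(LBINT x:{1<..}. exp (- 2 * t * x) / (sqrt x * sqrt (x - 1))) = exp (- t) * bessel_K0 t"
    using K0_substitution[OF assms _ f] cont nn by simp_all
qed

lemma bessel_K0_lower_integral:
  assumes "t > 0"
  shows "set_integrable lborel {0<..} (\<lambda>x. exp (- 2 * t * x) / (sqrt x * sqrt (1 + x)))"
    and "(LBINT x:{0<..}. exp (- 2 * t * x) / (sqrt x * sqrt (1 + x))) = exp t * bessel_K0 t"
proof -
  have f: "exp (- 2 * t * ((cosh u + - 1) / 2)) / (sqrt ((cosh u + - 1) / 2) * sqrt (1 + (cosh u + - 1) / 2)) * (sinh u / 2)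
      = exp (- t * - 1) * exp (- t * cosh u)" if "u > 0" for u
  proof -
    have e: "1 + (cosh u + - 1) / 2 = (cosh u + 1) / 2"
      by (simp add: field_simps)
    show ?thesis
      unfolding e exp_split using that sqrt_sinh[OF that] by (simp add: mult.commute)
  qed
  have cont: "isCont (\<lambda>x. exp (- 2 * t * x) / (sqrt x * sqrt (1 + x))) x" if "x > 0" for x
    using that by (auto intro!: continuous_intros)
  have nn: "exp (- 2 * t * x) / (sqrt x * sqrt (1 + x)) \<ge> 0" if "x > 0" for x
    using that by simp
  show "set_integrable lborel {0<..} (\<lambda>x. exp (- 2 * t * x) / (sqrt x * sqrt (1 + x)))"
    "(LBINT x:{0<..}. exp (- 2 * t * x) / (sqrt x * sqrt (1 + x))) = exp t * bessel_K0 t"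
    using K0_substitution[OF assms _ f] cont nn by simp_all
qed

text \<open>The part of the same integral between the branch points 0 and 1, by the substitution x =
  (1 - cos u) / 2.\<close>

lemma bessel_I0_integral:
  shows "set_integrable lborel {0<..<1} (\<lambda>x. exp (- 2 * t * x) / (sqrt x * sqrt (1 - x)))"
    and "(LBINT x:{0<..<1}. exp (- 2 * t * x) / (sqrt x * sqrt (1 - x))) = exp (- t) * (pi * bessel_I0 t)"
proof -
  define f where "f = (\<lambda>x. exp (- 2 * t * x) / (sqrt x * sqrt (1 - x)))"
  have bounds: "0 < (1 - cos u) / 2" "(1 - cos u) / 2 < 1" "sin u > 0" if "0 < u" "u < pi" for u :: real
    using cos_monotone_0_pi[of 0 u] cos_monotone_0_pi[of u pi] sin_gt_zero[of u] that by auto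
  have f: "f ((1 - cos u) / 2) * (sin u / 2) = exp (- t) * exp (t * cos u)" if "0 < u" "u < pi" for u
  proof -
    have "((1 - cos u) / 2) * (1 - (1 - cos u) / 2) = (1 - (cos u)\<^sup>2) / 4"
      by (simp add: field_simps power2_eq_square)
    also have "\<dots> = (sin u / 2)\<^sup>2"
      by (simp add: cos_squared_eq power_divide)
    finally have "((1 - cos u) / 2) * (1 - (1 - cos u) / 2) = (sin u / 2)\<^sup>2" .
    then have "sqrt ((1 - cos u) / 2) * sqrt (1 - (1 - cos u) / 2) = sin u / 2"
      using bounds[OF that] by (simp flip: real_sqrt_mult)
    moreover have "exp (- 2 * t * ((1 - cos u) / 2)) = exp (- t) * exp (t * cos u)"
      by (simp flip: exp_add) (simp add: field_simps)
    ultimately show ?thesis using bounds[OF that] by (simp add: f_def)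
  qed
  have f': "exp (- t) * exp (t * cos u) = f ((1 - cos u) / 2) * (sin u / 2)" if "u \<in> einterval 0 pi" for u
    using f[of u] that by (simp add: einterval_def zero_ereal_def)
  have int: "set_integrable lborel (einterval 0 pi) (\<lambda>u. f ((1 - cos u) / 2) * (sin u / 2))"
  proof -
    have "set_integrable lborel {0..pi} (\<lambda>u. exp (- t) * exp (t * cos u))"
      by (rule borel_integrable_atLeastAtMost') (auto intro!: continuous_intros)
    then have "set_integrable lborel (einterval 0 pi) (\<lambda>u. exp (- t) * exp (t * cos u))"
      by (rule set_integrable_subset) (auto simp: einterval_def zero_ereal_def)
    also have "?this \<longleftrightarrow> ?thesis"
      by (rule set_integrable_cong[OF refl refl f'])
    finally show ?thesis .
  qed
  have A: "((ereal \<circ> (\<lambda>u. (1 - cos u) / 2) \<circ> real_of_ereal) \<longlongrightarrow> 0) (at_right 0)"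
  proof -
    have "((\<lambda>u. (1 - cos u) / 2) \<longlongrightarrow> (1 - cos 0) / 2) (at_right (0::real))"
      by (intro tendsto_intros) simp_all
    then show ?thesis by (simp add: ereal_tendsto_simps zero_ereal_def)
  qed
  have B: "((ereal \<circ> (\<lambda>u. (1 - cos u) / 2) \<circ> real_of_ereal) \<longlongrightarrow> 1) (at_left (ereal pi))"
  proof -
    have "((\<lambda>u. (1 - cos u) / 2) \<longlongrightarrow> (1 - cos pi) / 2) (at_left pi)"
      by (intro tendsto_intros) simp_all
    then show ?thesis by (simp add: ereal_tendsto_simps one_ereal_def)
  qed
  have cont: "isCont f x" if "0 < x" "x < 1" for x
    unfolding f_def using that by (auto intro!: continuous_intros)
  have nn: "f x \<ge> 0" if "0 < x" "x < 1" for x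
    using that by (simp add: f_def)
  note subst = interval_integral_substitution_nonneg
    [of 0 pi "\<lambda>u. (1 - cos u) / 2" "\<lambda>u. sin u / 2" f, OF _ _ _ _ _ _ A B int]
  have "set_integrable lborel (einterval 0 1) f \<and>
    (LBINT x=0..1. f x) = (LBINT u=0..pi. f ((1 - cos u) / 2) * (sin u / 2))"
    by (intro conjI subst)
       (auto intro!: derivative_eq_intros continuous_intros cont nn bounds sin_ge_zero simp: zero_ereal_def)
  moreover have "einterval 0 1 = {0<..<1}" by (auto simp: einterval_def zero_ereal_def one_ereal_def)
  moreover have "(LBINT u=0..pi. f ((1 - cos u) / 2) * (sin u / 2)) = (LBINT u=0..pi. exp (- t) * exp (t * cos u))"
    by (rule interval_integral_cong) (subst f', simp_all add: zero_ereal_def)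
  moreover have "\<dots> = exp (- t) * (pi * bessel_I0 t)"
    using interval_integral_Icc[of 0 pi "\<lambda>u. exp (t * cos u)"] by (simp add: bessel_I0_def zero_ereal_def)
  ultimately show "set_integrable lborel {0<..<1} (\<lambda>x. exp (- 2 * t * x) / (sqrt x * sqrt (1 - x)))"
    "(LBINT x:{0<..<1}. exp (- 2 * t * x) / (sqrt x * sqrt (1 - x))) = exp (- t) * (pi * bessel_I0 t)"
    by (simp_all add: f_def interval_lebesgue_integral_def)
qed

section \<open>Integrals along rotated rays\<close>

text \<open>A product of two principal roots instead of the root of a product: below the real axis
  each factor stays off its cut, whereas v (1 + v) is a negative real on the line Re v = -
  1/2.\<close>

definition kern :: "complex \<Rightarrow> complex \<Rightarrow> complex" where
  "kern \<sigma> v = 1 / (csqrt v * csqrt (1 + \<sigma> * v))"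

text \<open>
  On the ray \<open>d = 1\<close> and for \<open>z = t > 0\<close> this is \<open>exp t * K0(t)\<close> for \<open>\<sigma> = 1\<close> and
  \<open>exp (- t) * (\<pi> I0(t) - \<i> K0(t))\<close> for \<open>\<sigma> = -1\<close>. Rays in the open lower half plane avoid
  the branch points of the kernel and serve complex \<open>z\<close> as long as \<open>Re (z * d) > 0\<close>.
\<close>

definition rayint :: "complex \<Rightarrow> complex \<Rightarrow> complex \<Rightarrow> complex" where
  "rayint \<sigma> d z = (LBINT t:{0<..}. exp (- (2 * z * d) * of_real t) * (d * kern \<sigma> (d * of_real t)))"

section \<open>Kernel bounds in the lower half plane and independence of the ray\<close>

lemma norm_kern: "norm (kern \<sigma> v) = 1 / (sqrt (norm v) * sqrt (norm (1 + \<sigma> * v)))"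
  by (simp add: kern_def norm_divide norm_mult)

text \<open>Multiplying 1 + \<sigma> v by the conjugate of v only adds a real number to that
  conjugate, so the imaginary part is - Im v for either sign. One estimate thus handles both branch
  points.\<close>

lemma norm_one_plus_ge:
  assumes "\<sigma> \<in> {1, -1}"
  shows "\<bar>Im v\<bar> \<le> norm v * norm (1 + \<sigma> * v)"
proof -
  have "\<bar>Im v\<bar> = \<bar>Im ((1 + \<sigma> * v) * cnj v)\<bar>"
    using assms by (auto simp: algebra_simps)
  also have "\<dots> \<le> norm ((1 + \<sigma> * v) * cnj v)" by (rule abs_Im_le_cmod)
  finally show ?thesis by (simp add: norm_mult mult.commute)
qed

lemma norm_kern_le:
  assumes "\<sigma> \<in> {1, -1}" "Im v < 0"
  shows "norm (kern \<sigma> v) \<le> 1 / sqrt (- Im v)"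
proof -
  have "sqrt (- Im v) \<le> sqrt (norm v * norm (1 + \<sigma> * v))"
    using norm_one_plus_ge[OF assms(1), of v] assms(2) by (intro real_sqrt_le_mono) simp
  then have le: "sqrt (- Im v) \<le> sqrt (norm v) * sqrt (norm (1 + \<sigma> * v))"
    by (simp add: real_sqrt_mult)
  have pos: "sqrt (- Im v) > 0" using assms(2) by simp
  show ?thesis
    unfolding norm_kern using le pos less_le_trans[OF pos le] by (intro divide_left_mono) auto
qed

lemma kern_holomorphic:
  assumes "\<sigma> \<in> {1, -1}"
  shows "kern \<sigma> holomorphic_on {v. Im v < 0}"
proof -
  have "csqrt v * csqrt (1 + \<sigma> * v) \<noteq> 0" if "Im v < 0" for v
  proof -
    have "1 + \<sigma> * v \<noteq> 0" using assms that by (auto simp: complex_eq_iff)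
    then show ?thesis using that by auto
  qed
  moreover have "v \<notin> \<real>\<^sub>\<le>\<^sub>0" "1 + \<sigma> * v \<notin> \<real>\<^sub>\<le>\<^sub>0" if "Im v < 0" for v
    using assms that by (auto simp: complex_nonpos_Reals_iff)
  ultimately show ?thesis
    unfolding kern_def[abs_def]
    by (intro holomorphic_intros) auto
qed

lemma kern_ray_bound:
  assumes "\<sigma> \<in> {1, -1}" "Im d < 0" "t > 0"
  shows "norm (d * kern \<sigma> (d * of_real t)) \<le> (norm d / sqrt (- Im d)) * t powr (- 1 / 2)"
proof -
  have "norm (d * kern \<sigma> (d * of_real t)) \<le> norm d * (1 / sqrt (- Im (d * of_real t)))"
    unfolding norm_mult[of d]
    by (rule mult_left_mono[OF norm_kern_le]) (use assms in \<open>auto simp: mult_neg_pos\<close>)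
  also have "\<dots> = (norm d / sqrt (- Im d)) * t powr (- 1 / 2)"
  proof -
    have "sqrt (- Im (d * of_real t)) = sqrt (- Im d) * sqrt t"
      unfolding real_sqrt_mult[symmetric] by simp
    moreover have "t powr (- 1 / 2) = 1 / sqrt t"
      using assms(3) powr_minus[of t "1 / 2"] by (simp add: powr_half_sqrt inverse_eq_divide)
    ultimately show ?thesis by simp
  qed
  finally show ?thesis .
qed

lemma kern_ray_measurable:
  assumes "\<sigma> \<in> {1, -1}" "Im d < 0"
  shows "set_borel_measurable lborel {0<..} (\<lambda>t. d * kern \<sigma> (d * of_real t))"
proof (rule set_borel_measurable_continuous_on_open)
  have "continuous_on {v. Im v < 0} (kern \<sigma>)"
    using kern_holomorphic[OF assms(1)] by (rule holomorphic_on_imp_continuous_on)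
  then have "continuous_on {0<..} (kern \<sigma> \<circ> (\<lambda>t. d * of_real t))"
    by (rule continuous_on_compose2[of _ "kern \<sigma>", unfolded o_def[symmetric]])
       (use assms in \<open>auto intro!: continuous_intros simp: mult_neg_pos\<close>)
  then show "continuous_on {0<..} (\<lambda>t. d * kern \<sigma> (d * of_real t))"
    by (auto intro!: continuous_intros simp: o_def)
qed simp

lemma rayint_integrable:
  assumes "\<sigma> \<in> {1, -1}" "Im d < 0" "Re (z * d) > 0"
  shows "set_integrable lborel {0<..} (\<lambda>t. exp (- (2 * z * d) * of_real t) * (d * kern \<sigma> (d * of_real t)))"
  by (rule laplace_set_integrable[OF kern_ray_measurable _ kern_ray_bound])
     (use assms in \<open>auto simp: algebra_simps\<close>)

lemma rayint_holomorphic: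
  assumes "\<sigma> \<in> {1, -1}" "Im d < 0"
  shows "rayint \<sigma> d holomorphic_on {z. Re (z * d) > 0}"
proof -
  have "(\<lambda>s. LBINT t:{0<..}. exp (- s * of_real t) * (d * kern \<sigma> (d * of_real t))) holomorphic_on {s. Re s > 0}"
    by (rule laplace_holomorphic[OF kern_ray_measurable _ kern_ray_bound]) (use assms in auto)
  then have "(\<lambda>s. LBINT t:{0<..}. exp (- s * of_real t) * (d * kern \<sigma> (d * of_real t))) \<circ> (\<lambda>z. 2 * z * d)
     holomorphic_on {z. Re (z * d) > 0}"
    by (intro holomorphic_on_compose_gen[where t = "{s. Re s > 0}"])
       (auto intro!: holomorphic_intros simp: algebra_simps)
  then show ?thesis by (simp add: rayint_def[abs_def] o_def)
qed

text \<open>Both ends of the ray are singular for the primitive, so the integral is exhausted by the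
  intervals from 1 / (n + 1) to n + 1.\<close>

lemma rayint_tendsto:
  assumes "\<sigma> \<in> {1, -1}" "Im d < 0" "Re (z * d) > 0"
    and F: "\<And>v. Im v < 0 \<Longrightarrow> (F has_field_derivative kern \<sigma> v * exp (- 2 * z * v)) (at v)"
  shows "(\<lambda>n. F (d * of_real (real (Suc n))) - F (d * of_real (1 / real (Suc n)))) \<longlonglongrightarrow> rayint \<sigma> d z"
proof -
  define f where "f = (\<lambda>t. exp (- (2 * z * d) * of_real t) * (d * kern \<sigma> (d * of_real t)))"
  define A where "A = (\<lambda>n. {1 / real (Suc n)..real (Suc n)})"
  have U: "(\<Union>n. A n) = {0<..}"
  proof (intro equalityI subsetI)
    fix t :: real assume "t \<in> {0<..}"
    then have t: "t > 0" by simp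
    obtain n where n: "real n > max t (1 / t)" using reals_Archimedean2 by blast
    have "1 / t \<le> real (Suc n)" using n by simp
    then have "1 / real (Suc n) \<le> t" using t by (simp add: divide_le_eq mult.commute)
    then have "t \<in> A n" using n by (simp add: A_def)
    then show "t \<in> (\<Union>n. A n)" by blast
  next
    fix t assume "t \<in> (\<Union>n. A n)"
    then obtain n where "1 / real (Suc n) \<le> t" by (auto simp: A_def)
    moreover have "1 / real (Suc n) > 0" by simp
    ultimately show "t \<in> {0<..}" unfolding greaterThan_iff by linarith
  qed
  have inc: "incseq A"
  proof (intro incseq_SucI)
    fix n
    have "1 / real (Suc (Suc n)) \<le> 1 / real (Suc n)" by (intro frac_le) auto
    then show "A n \<subseteq> A (Suc n)" unfolding A_def atLeastatMost_subset_iff by simp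
  qed
  have "set_integrable lborel (\<Union>n. A n) f"
    unfolding U f_def using rayint_integrable assms by blast
  then have "(\<lambda>n. LBINT t:A n. f t) \<longlonglongrightarrow> (LBINT t:(\<Union>n. A n). f t)"
    by (intro set_integral_cont_up inc) (auto simp: A_def)
  moreover have "(LBINT t:A n. f t) = F (d * of_real (real (Suc n))) - F (d * of_real (1 / real (Suc n)))" for n
    unfolding set_lebesgue_integral_def A_def
  proof (rule integral_FTC_atLeastAtMost)
    have "1 / real (Suc n) \<le> 1" by simp
    then show "1 / real (Suc n) \<le> real (Suc n)" by linarith
    have pos: "t > 0" if "1 / real (Suc n) \<le> t" for t
    proof -
      have "1 / real (Suc n) > 0" by simp
      then show ?thesis using that by linarith
    qed
    fix t assume "1 / real (Suc n) \<le> t"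
    then have t: "t > 0" by (rule pos)
    let ?I = "{1 / real (Suc n)..real (Suc n)}"
    have "Im (d * of_real t) < 0" using t assms by (simp add: mult_neg_pos)
    then have D2: "(F has_field_derivative kern \<sigma> (d * of_real t) * exp (- 2 * z * (d * of_real t)))
        (at (d * of_real t) within (\<lambda>t. d * of_real t) ` ?I)"
      by (rule has_field_derivative_at_within[OF F])
    have D1: "((\<lambda>t. d * of_real t) has_vector_derivative d * 1) (at t within ?I)"
      using has_vector_derivative_mult_right[OF bounded_linear.has_vector_derivative[OF bounded_linear_of_real has_vector_derivative_id], of d]
      by simp
    have "((F \<circ> (\<lambda>t. d * of_real t)) has_vector_derivative
        d * 1 * (kern \<sigma> (d * of_real t) * exp (- 2 * z * (d * of_real t)))) (at t within ?I)"
      by (rule field_vector_diff_chain_within[OF D1 D2])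
    then show "((\<lambda>t. F (d * of_real t)) has_vector_derivative f t) (at t within {1 / real (Suc n)..real (Suc n)})"
      by (simp add: o_def f_def mult_ac)
  next
    have k: "continuous_on {v. Im v < 0} (kern \<sigma>)"
      using kern_holomorphic[OF assms(1)] by (rule holomorphic_on_imp_continuous_on)
    have "Im (d * of_real t) < 0" if "1 / real (Suc n) \<le> t" for t
    proof -
      have "1 / real (Suc n) > 0" by simp
      then have "t > 0" using that by linarith
      then show ?thesis using assms by (simp add: mult_neg_pos)
    qed
    then have "continuous_on {1 / real (Suc n)..real (Suc n)} (\<lambda>t. kern \<sigma> (d * of_real t))"
      by (intro continuous_on_compose2[OF k]) (auto intro!: continuous_intros)
    then show "continuous_on {1 / real (Suc n)..real (Suc n)} f"
      unfolding f_def by (intro continuous_intros)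
  qed
  ultimately show ?thesis by (simp add: U rayint_def f_def)
qed

text \<open>One primitive F serves both rays, so only the change of F along the chord from d1 r to
  d2 r matters. The chord has length of order r and the integrand there is of order exp (- 2 c r) /
  sqrt r, so the change vanishes for r tending to 0 and to infinity.\<close>

lemma rayint_rotate:
  assumes \<sigma>: "\<sigma> \<in> {1, -1}" and d1: "Im d1 < 0" "Re (z * d1) > 0" and d2: "Im d2 < 0" "Re (z * d2) > 0"
  shows "rayint \<sigma> d1 z = rayint \<sigma> d2 z"
proof -
  define f where "f = (\<lambda>v. kern \<sigma> v * exp (- 2 * z * v))"
  have "f holomorphic_on {v. Im v < 0}"
    unfolding f_def by (intro holomorphic_intros kern_holomorphic \<sigma>)
  then obtain F where F: "\<And>v. v \<in> {v. Im v < 0} \<Longrightarrow> (F has_field_derivative f v) (at v within {v. Im v < 0})"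
    using holomorphic_convex_primitive'[OF convex_halfspace_Im_lt open_halfspace_Im_lt] by blast
  have F: "(F has_field_derivative kern \<sigma> v * exp (- 2 * z * v)) (at v)" if "Im v < 0" for v
    using F[of v] that at_within_open[of v "{v. Im v < 0}"] by (simp add: open_halfspace_Im_lt f_def)
  define s where "s = min (- Im d1) (- Im d2)"
  define c where "c = min (Re (z * d1)) (Re (z * d2))"
  have sc: "s > 0" "c > 0" using d1 d2 by (auto simp: s_def c_def)
  define K where "K = norm (d1 - d2) / sqrt s"
  have chord: "norm (F (d1 * of_real r) - F (d2 * of_real r)) \<le> K * (exp (- 2 * c * r) * sqrt r)" if "r > 0" for r
  proof -
    let ?S = "closed_segment (d1 * of_real r) (d2 * of_real r)"
    have S: "Im v \<le> - (s * r)" "Re (z * v) \<ge> c * r" if "v \<in> ?S" for v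
    proof -
      \<comment> \<open>Both conditions define convex half planes, so along a chord they need
        checking at its two end points only.\<close>
      have "convex ({v. Im v \<le> - (s * r)} \<inter> {v. Re (z * v) \<ge> c * r})"
      proof (rule convex_Int)
        have "{v. Re (z * v) \<ge> c * r} = {v. inner (cnj z) v \<ge> c * r}"
          by (simp add: inner_complex_def)
        then show "convex {v. Re (z * v) \<ge> c * r}" by (simp add: convex_halfspace_ge)
      qed (rule convex_halfspace_Im_le)
      moreover have "d1 * of_real r \<in> {v. Im v \<le> - (s * r)} \<inter> {v. Re (z * v) \<ge> c * r}"
      proof -
        have "s \<le> - Im d1" "c \<le> Re (z * d1)" by (simp_all add: s_def c_def)
        then have "s * r \<le> - Im d1 * r" "c * r \<le> Re (z * d1) * r"
          using \<open>r > 0\<close> mult_right_mono[of s "- Im d1" r] mult_right_mono[of c "Re (z * d1)" r] by auto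
        then show ?thesis by (simp add: algebra_simps)
      qed
      moreover have "d2 * of_real r \<in> {v. Im v \<le> - (s * r)} \<inter> {v. Re (z * v) \<ge> c * r}"
      proof -
        have "s \<le> - Im d2" "c \<le> Re (z * d2)" by (simp_all add: s_def c_def)
        then have "s * r \<le> - Im d2 * r" "c * r \<le> Re (z * d2) * r"
          using \<open>r > 0\<close> mult_right_mono[of s "- Im d2" r] mult_right_mono[of c "Re (z * d2)" r] by auto
        then show ?thesis by (simp add: algebra_simps)
      qed
      ultimately have "?S \<subseteq> {v. Im v \<le> - (s * r)} \<inter> {v. Re (z * v) \<ge> c * r}"
        by (intro closed_segment_subset)
      then show "Im v \<le> - (s * r)" "Re (z * v) \<ge> c * r" using that by auto
    qed
    have sr: "s * r > 0" using sc \<open>r > 0\<close> by simp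
    have "norm (F (d1 * of_real r) - F (d2 * of_real r))
       \<le> (1 / sqrt (s * r) * exp (- 2 * c * r)) * norm (d1 * of_real r - d2 * of_real r)"
    proof (rule field_differentiable_bound[OF convex_closed_segment])
      fix v assume v: "v \<in> ?S"
      then have v0: "Im v < 0" using S(1)[OF v] sr by linarith
      show "(F has_field_derivative kern \<sigma> v * exp (- 2 * z * v)) (at v within ?S)"
        by (rule has_field_derivative_at_within[OF F[OF v0]])
      have "norm (kern \<sigma> v) \<le> 1 / sqrt (- Im v)"
        by (rule norm_kern_le[OF \<sigma> v0])
      also have "\<dots> \<le> 1 / sqrt (s * r)"
        using S(1)[OF v] sr by (intro divide_left_mono real_sqrt_le_mono) auto
      finally have "norm (kern \<sigma> v) \<le> 1 / sqrt (s * r)" .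
      moreover have "norm (exp (- 2 * z * v)) \<le> exp (- 2 * c * r)"
        using S(2)[OF v] by simp
      ultimately show "norm (kern \<sigma> v * exp (- 2 * z * v)) \<le> 1 / sqrt (s * r) * exp (- 2 * c * r)"
        unfolding norm_mult by (intro mult_mono) (use sr in auto)
    qed (rule ends_in_segment)+
    also have "norm (d1 * of_real r - d2 * of_real r) = norm (d1 - d2) * r"
      using \<open>r > 0\<close> by (simp add: norm_mult flip: left_diff_distrib)
    also have "(1 / sqrt (s * r) * exp (- 2 * c * r)) * (norm (d1 - d2) * r) = K * (exp (- 2 * c * r) * sqrt r)"
      using \<open>r > 0\<close> sc by (simp add: K_def real_sqrt_mult field_simps)
    finally show ?thesis .
  qed
  have lim: "(\<lambda>n. 1 / real (Suc n)) \<longlonglongrightarrow> 0"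
    by (rule LIMSEQ_Suc[OF lim_1_over_n])
  have K: "K \<ge> 0" using sc by (simp add: K_def)
  have lim0: "(\<lambda>n. F (d1 * of_real (1 / real (Suc n))) - F (d2 * of_real (1 / real (Suc n)))) \<longlonglongrightarrow> 0"
  proof (rule Lim_null_comparison)
    show "(\<lambda>n. K * sqrt (1 / real (Suc n))) \<longlonglongrightarrow> 0"
      using tendsto_mult_left[OF tendsto_real_sqrt[OF lim], of K] by simp
    show "eventually (\<lambda>n. norm (F (d1 * of_real (1 / real (Suc n))) - F (d2 * of_real (1 / real (Suc n))))
        \<le> K * sqrt (1 / real (Suc n))) sequentially"
    proof (intro always_eventually allI)
      fix n
      have "exp (- 2 * c * (1 / real (Suc n))) * sqrt (1 / real (Suc n)) \<le> 1 * sqrt (1 / real (Suc n))"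
        using sc by (intro mult_right_mono) auto
      then show "norm (F (d1 * of_real (1 / real (Suc n))) - F (d2 * of_real (1 / real (Suc n))))
        \<le> K * sqrt (1 / real (Suc n))"
        using order_trans[OF chord[of "1 / real (Suc n)"] mult_left_mono[OF _ K]] by simp
    qed
  qed
  have lim1: "(\<lambda>n. F (d1 * of_real (real (Suc n))) - F (d2 * of_real (real (Suc n)))) \<longlonglongrightarrow> 0"
  proof (rule Lim_null_comparison)
    show "(\<lambda>n. K * (1 / (2 * c)) * sqrt (1 / real (Suc n))) \<longlonglongrightarrow> 0"
      using tendsto_mult_left[OF tendsto_real_sqrt[OF lim], of "K * (1 / (2 * c))"] by simp
    show "eventually (\<lambda>n. norm (F (d1 * of_real (real (Suc n))) - F (d2 * of_real (real (Suc n))))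
        \<le> K * (1 / (2 * c)) * sqrt (1 / real (Suc n))) sequentially"
    proof (intro always_eventually allI)
      fix n
      define r where "r = real (Suc n)"
      have r: "r > 0" by (simp add: r_def)
      \<comment> \<open>This crude lower bound for the exponential already outweighs the factor sqrt
        r of the chord estimate.\<close>
      have "2 * c * r \<le> exp (2 * c * r)" using exp_ge_add_one_self[of "2 * c * r"] by linarith
      then have "exp (- 2 * c * r) \<le> 1 / (2 * c * r)"
        using sc r by (simp add: exp_minus field_simps)
      then have "exp (- 2 * c * r) * sqrt r \<le> 1 / (2 * c * r) * sqrt r"
        using r by (intro mult_right_mono) auto
      also have "\<dots> = 1 / (2 * c) * sqrt (1 / r)"
        using sc r by (simp add: real_sqrt_divide field_simps)
      finally have "K * (exp (- 2 * c * r) * sqrt r) \<le> K * (1 / (2 * c) * sqrt (1 / r))"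
        using K by (rule mult_left_mono)
      then show "norm (F (d1 * of_real (real (Suc n))) - F (d2 * of_real (real (Suc n))))
        \<le> K * (1 / (2 * c)) * sqrt (1 / real (Suc n))"
        using chord[OF r] unfolding r_def by simp
    qed
  qed
  have "(\<lambda>n. (F (d1 * of_real (real (Suc n))) - F (d1 * of_real (1 / real (Suc n))))
      - (F (d2 * of_real (real (Suc n))) - F (d2 * of_real (1 / real (Suc n))))) \<longlonglongrightarrow> rayint \<sigma> d1 z - rayint \<sigma> d2 z"
    by (intro tendsto_diff rayint_tendsto F assms)
  moreover have "(\<lambda>n. (F (d1 * of_real (real (Suc n))) - F (d1 * of_real (1 / real (Suc n))))
      - (F (d2 * of_real (real (Suc n))) - F (d2 * of_real (1 / real (Suc n))))) \<longlonglongrightarrow> 0 - 0"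
    using tendsto_diff[OF lim1 lim0] by (simp add: algebra_simps)
  ultimately have "rayint \<sigma> d1 z - rayint \<sigma> d2 z = 0 - 0" by (rule LIMSEQ_unique)
  then show ?thesis by simp
qed

section \<open>Continuation of the Bessel product\<close>

text \<open>On its cut the principal root is continuous from above, since its values there lie on
  the upper imaginary axis. This is the limit needed for csqrt (1 - v) when v approaches the real
  axis from below.\<close>

lemma csqrt_tendsto_upper:
  assumes X: "X \<longlonglongrightarrow> x" and Im: "\<And>n. Im (X n) \<ge> 0"
  shows "(\<lambda>n. csqrt (X n)) \<longlonglongrightarrow> csqrt x"
proof -
  have eq: "csqrt z = Complex (sqrt ((cmod z + Re z) / 2)) (sqrt ((cmod z - Re z) / 2))" if "Im z \<ge> 0" for z
    using that by (auto simp: complex_eq_iff)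
  have "Im x \<ge> 0"
    using tendsto_lowerbound[OF tendsto_Im[OF X], of 0] Im by simp
  then show ?thesis
    using Im by (simp add: eq) (intro tendsto_intros X, simp_all)
qed

lemma csqrt_of_real_pos: "x \<ge> 0 \<Longrightarrow> csqrt (of_real x) = of_real (sqrt x)"
  using csqrt_of_real_nonneg[of "of_real x"] by simp

text \<open>Tilting the ray with the real part of d kept at 1 only increases the distances from the
  branch points 0 and - \<sigma>, so the kernel on the real axis is a common majorant.\<close>

lemma norm_kern_tilt:
  assumes \<sigma>: "\<sigma> \<in> {1, -1 :: real}" and d: "Re d = 1" and t: "t > 0" "1 + \<sigma> * t \<noteq> 0"
  shows "norm (kern (of_real \<sigma>) (d * of_real t)) \<le> 1 / (sqrt t * sqrt \<bar>1 + \<sigma> * t\<bar>)"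
proof -
  have "sqrt t \<le> sqrt (norm (d * of_real t))"
    using complex_Re_le_cmod[of "d * of_real t"] d by simp
  moreover have "sqrt \<bar>1 + \<sigma> * t\<bar> \<le> sqrt (norm (1 + of_real \<sigma> * (d * of_real t)))"
    using abs_Re_le_cmod[of "1 + of_real \<sigma> * (d * of_real t)"] d by simp
  ultimately have le: "sqrt t * sqrt \<bar>1 + \<sigma> * t\<bar> \<le> sqrt (norm (d * of_real t)) * sqrt (norm (1 + of_real \<sigma> * (d * of_real t)))"
    using t by (intro mult_mono) auto
  have pos: "sqrt t * sqrt \<bar>1 + \<sigma> * t\<bar> > 0" using t by simp
  show ?thesis
    unfolding norm_kern using le pos less_le_trans[OF pos le] by (intro divide_left_mono) auto
qed

text \<open>The direction 1 is a boundary case outside the reach of \<open>rayint_rotate\<close>: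
  for \<sigma> = - 1 the branch point 1 lies on the ray. The directions 1 - i / (n + 1) all give the
  same value, and dominated convergence with majorant \<open>int\<close> carries it over to the
  limit.\<close>

lemma rayint_real_axis:
  fixes \<sigma> :: real
  assumes \<sigma>: "\<sigma> \<in> {1, -1}" and t: "t > 0"
    and int: "set_integrable lborel {0<..} (\<lambda>x. exp (- 2 * t * x) / (sqrt x * sqrt \<bar>1 + \<sigma> * x\<bar>))"
    and d: "Im d < 0" "Re d > 0"
  shows "rayint (of_real \<sigma>) d (of_real t) = rayint (of_real \<sigma>) 1 (of_real t)"
proof -
  define D where "D = (\<lambda>n. Complex 1 (- 1 / real (Suc n)))"
  define k where "k = (\<lambda>d x. indicator {0<..} x *\<^sub>R (exp (- (2 * of_real t * d) * of_real x) * (d * kern (of_real \<sigma>) (d * of_real x))))"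
  have \<sigma>': "complex_of_real \<sigma> \<in> {1, -1}" using \<sigma> by auto
  have D: "Im (D n) < 0" "Re (D n) = 1" "norm (D n) \<le> 2" for n
  proof -
    have "1 / real (Suc n) \<le> 1" by simp
    then have "\<bar>Re (D n)\<bar> + \<bar>Im (D n)\<bar> \<le> 2" unfolding D_def by simp
    then show "norm (D n) \<le> 2" using cmod_le[of "D n"] by linarith
  qed (simp_all add: D_def)
  have Dlim: "D \<longlonglongrightarrow> 1"
  proof -
    have "(\<lambda>n. Complex 1 (- (1 / real (Suc n)))) \<longlonglongrightarrow> Complex 1 (- 0)"
      by (intro tendsto_Complex tendsto_const tendsto_minus LIMSEQ_Suc[OF lim_1_over_n])
    then show ?thesis by (simp add: D_def complex_eq_iff one_complex.code)
  qed
  have meas: "k (D n) \<in> borel_measurable lborel" for n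
    using rayint_integrable[OF \<sigma>' D(1)[of n], of "of_real t"] D(2)[of n] t
    unfolding set_integrable_def k_def by auto
  have lim: "(\<lambda>n. k (D n) x) \<longlonglongrightarrow> k 1 x" if x: "1 + \<sigma> * x \<noteq> 0" for x
  proof (cases "x > 0")
    case True
    have Dx: "(\<lambda>n. D n * of_real x) \<longlonglongrightarrow> 1 * of_real x"
      by (intro tendsto_intros Dlim)
    have c1: "(\<lambda>n. csqrt (D n * of_real x)) \<longlonglongrightarrow> csqrt (1 * of_real x)"
      by (rule isCont_tendsto_compose[OF _ Dx]) (use True in \<open>auto intro!: continuous_at_csqrt simp: complex_nonpos_Reals_iff\<close>)
    have Dx': "(\<lambda>n. 1 + of_real \<sigma> * (D n * of_real x)) \<longlonglongrightarrow> 1 + of_real \<sigma> * (1 * of_real x)"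
      by (intro tendsto_intros Dx)
    have c2: "(\<lambda>n. csqrt (1 + of_real \<sigma> * (D n * of_real x))) \<longlonglongrightarrow> csqrt (1 + of_real \<sigma> * (1 * of_real x))"
    proof (cases "\<sigma> = 1")
      case True
      show ?thesis
        by (rule isCont_tendsto_compose[OF _ Dx'])
           (use True \<open>x > 0\<close> in \<open>auto intro!: continuous_at_csqrt simp: complex_nonpos_Reals_iff\<close>)
    next
      case False
      then have "\<sigma> = -1" using \<sigma> by simp
      then show ?thesis
        using \<open>x > 0\<close> D(1) by (intro csqrt_tendsto_upper Dx') (simp add: mult_le_0_iff less_imp_le)
    qed
    have "1 + complex_of_real \<sigma> * (1 * of_real x) \<noteq> 0"
      using x by (metis mult_1 of_real_1 of_real_add of_real_eq_0_iff of_real_mult)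
    then have "csqrt (1 * of_real x) * csqrt (1 + of_real \<sigma> * (1 * of_real x)) \<noteq> 0"
      using True by simp
    then show ?thesis
      unfolding k_def kern_def by (intro tendsto_intros c1 c2 Dlim)
  qed (simp add: k_def)
  have ae: "AE x in lborel. 1 + \<sigma> * x \<noteq> 0"
    by (rule AE_I[of _ _ "{-1, 1}"]) (use \<sigma> in \<open>auto intro!: emeasure_lborel_countable\<close>)
  have "(\<lambda>n. integral\<^sup>L lborel (k (D n))) \<longlonglongrightarrow> integral\<^sup>L lborel (k 1)"
  proof (rule integral_dominated_convergence)
    show "integrable lborel (\<lambda>x. 2 * (indicator {0<..} x *\<^sub>R (exp (- 2 * t * x) / (sqrt x * sqrt \<bar>1 + \<sigma> * x\<bar>))))"
      using int unfolding set_integrable_def by (intro integrable_mult_right) auto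
    show "AE x in lborel. norm (k (D n) x) \<le> 2 * (indicator {0<..} x *\<^sub>R (exp (- 2 * t * x) / (sqrt x * sqrt \<bar>1 + \<sigma> * x\<bar>)))" for n
      using ae
    proof eventually_elim
      case (elim x)
      show ?case
      proof (cases "x > 0")
        case True
        have "norm (k (D n) x) = norm (D n) * (exp (- 2 * t * x) * norm (kern (of_real \<sigma>) (D n * of_real x)))"
          using True D(2)[of n] by (simp add: k_def norm_mult)
        also have "\<dots> \<le> 2 * (exp (- 2 * t * x) * (1 / (sqrt x * sqrt \<bar>1 + \<sigma> * x\<bar>)))"
          using D norm_kern_tilt[OF \<sigma> D(2) True elim] by (intro mult_mono) auto
        finally show ?thesis using True by simp
      qed (simp add: k_def)
    qed
    show "AE x in lborel. (\<lambda>n. k (D n) x) \<longlonglongrightarrow> k 1 x"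
      using ae by eventually_elim (rule lim)
    show "k 1 \<in> borel_measurable lborel"
    proof (rule borel_measurable_LIMSEQ_metric)
      show "(\<lambda>x. if 1 + \<sigma> * x = 0 then 0 else k (D n) x) \<in> borel_measurable lborel" for n
        using meas[of n] by measurable
      fix x
      show "(\<lambda>n. if 1 + \<sigma> * x = 0 then 0 else k (D n) x) \<longlonglongrightarrow> k 1 x"
      \<comment> \<open>At the branch point the kernel is 1 / 0 = 0, which agrees with the modified
        sequence. Convergence thus holds at every point, as the measurability of the limit
        requires.\<close>
      proof (cases "1 + \<sigma> * x = 0")
        case True
        then have "1 + complex_of_real \<sigma> * of_real x = 0"
          by (metis of_real_0 of_real_1 of_real_add of_real_mult)
        then show ?thesis using True by (simp add: k_def kern_def)
      qed (use lim in simp)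
    qed
  qed (rule meas)
  moreover have "integral\<^sup>L lborel (k (D n)) = rayint (of_real \<sigma>) d (of_real t)" for n
  proof -
    have "integral\<^sup>L lborel (k (D n)) = rayint (of_real \<sigma>) (D n) (of_real t)"
      by (simp add: rayint_def k_def set_lebesgue_integral_def)
    also have "\<dots> = rayint (of_real \<sigma>) d (of_real t)"
      by (rule rayint_rotate[OF \<sigma>']) (use D[of n] d t in auto)
    finally show ?thesis .
  qed
  ultimately show ?thesis
    by (simp add: LIMSEQ_const_iff rayint_def k_def set_lebesgue_integral_def)
qed

text \<open>The direction \<open>1 - \<i>\<close> is admissible for all \<open>z \<noteq> 0\<close> of the closed first quadrant at once.\<close>

definition besselprod :: "complex \<Rightarrow> complex" where
  "besselprod z = rayint 1 (1 - \<i>) z * rayint (-1) (1 - \<i>) z"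

text \<open>The factors exp t and exp (- t) of the two ray integrals cancel. The second integral is
  split at the branch point: the interval from 0 to 1 yields pi I0, the rest yields K0 with the
  coefficient 1 / i = - i.\<close>

lemma besselprod_real:
  assumes t: "t > 0"
  shows "besselprod (of_real t) = of_real (bessel_K0 t) * (of_real (pi * bessel_I0 t) - \<i> * of_real (bessel_K0 t))"
proof -
  define f where "f = (\<lambda>x. exp (- 2 * t * x) / (sqrt x * sqrt (1 + x)))"
  define g where "g = (\<lambda>x. exp (- 2 * t * x) / (sqrt x * sqrt (1 - x)))"
  define h where "h = (\<lambda>x. exp (- 2 * t * x) / (sqrt x * sqrt (x - 1)))"
  note f = bessel_K0_lower_integral[OF t, folded f_def]
  note g = bessel_I0_integral[of t, folded g_def]
  note h = bessel_K0_upper_integral[OF t, folded h_def]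
  have split: "{0<..} = insert 1 ({0<..<1} \<union> {1::real<..})" by auto
  have A: "rayint 1 (1 - \<i>) (of_real t) = of_real (exp t * bessel_K0 t)"
  proof -
    have "rayint (of_real 1) (1 - \<i>) (of_real t) = rayint (of_real 1) 1 (of_real t)"
    proof (rule rayint_real_axis)
      show "set_integrable lborel {0<..} (\<lambda>x. exp (- 2 * t * x) / (sqrt x * sqrt \<bar>1 + 1 * x\<bar>))"
        using f(1) by (rule set_integrable_congD) (auto simp: f_def)
    qed (use t in auto)
    also have "\<dots> = (LBINT x:{0<..}. complex_of_real (f x))"
      unfolding rayint_def
    proof (rule set_lebesgue_integral_cong)
      show "\<forall>x. x \<in> {0<..} \<longrightarrow> exp (- (2 * of_real t * 1) * of_real x) * (1 * kern (of_real 1) (1 * of_real x)) = complex_of_real (f x)"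
      proof (intro allI impI)
        fix x :: real assume "x \<in> {0<..}"
        then have "csqrt (1 + of_real x) = of_real (sqrt (1 + x))" "csqrt (of_real x) = of_real (sqrt x)"
          using csqrt_of_real_pos[of "1 + x"] csqrt_of_real_pos[of x] by simp_all
        then show "exp (- (2 * of_real t * 1) * of_real x) * (1 * kern (of_real 1) (1 * of_real x)) = complex_of_real (f x)"
          by (simp add: f_def kern_def exp_of_real[symmetric])
      qed
    qed simp
    also have "\<dots> = of_real (exp t * bessel_K0 t)"
      using f(2) by (simp add: set_integral_complex_of_real)
    finally show ?thesis by simp
  qed
  have B: "rayint (-1) (1 - \<i>) (of_real t) = of_real (exp (- t)) * (of_real (pi * bessel_I0 t) - \<i> * of_real (bessel_K0 t))"
  proof -
    have "rayint (of_real (-1)) (1 - \<i>) (of_real t) = rayint (of_real (-1)) 1 (of_real t)"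
    proof (rule rayint_real_axis)
      have "set_integrable lborel ({0<..<1} \<union> {1<..}) (\<lambda>x. exp (- 2 * t * x) / (sqrt x * sqrt \<bar>1 + -1 * x\<bar>))"
      proof (rule set_integrable_Un)
        show "set_integrable lborel {0<..<1} (\<lambda>x. exp (- 2 * t * x) / (sqrt x * sqrt \<bar>1 + -1 * x\<bar>))"
          using g(1) by (rule set_integrable_congD) (auto simp: g_def)
        show "set_integrable lborel {1<..} (\<lambda>x. exp (- 2 * t * x) / (sqrt x * sqrt \<bar>1 + -1 * x\<bar>))"
          using h(1) by (rule set_integrable_congD) (auto simp: h_def)
      qed auto
      then show "set_integrable lborel {0<..} (\<lambda>x. exp (- 2 * t * x) / (sqrt x * sqrt \<bar>1 + -1 * x\<bar>))"
        unfolding set_integrable_def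
        by (subst integrable_discrete_difference[where X = "{1}"
              and g = "\<lambda>x. indicator ({0<..<1} \<union> {1<..}) x *\<^sub>R (exp (- 2 * t * x) / (sqrt x * sqrt \<bar>1 + -1 * x\<bar>))"])
           (auto simp: indicator_def)
    qed (use t in auto)
    also have "\<dots> = (LBINT x:{0<..<1} \<union> {1<..}. exp (- (2 * of_real t * 1) * of_real x) * (1 * kern (of_real (-1)) (1 * of_real x)))"
      unfolding rayint_def by (rule set_integral_discrete_difference[of "{1}"]) auto
    also have "\<dots> = (LBINT x:{0<..<1} \<union> {1<..}. (if x < 1 then complex_of_real (g x) else - \<i> * of_real (h x)))"
    proof (rule set_lebesgue_integral_cong)
      show "\<forall>x. x \<in> {0<..<1} \<union> {1<..} \<longrightarrow> exp (- (2 * of_real t * 1) * of_real x) * (1 * kern (of_real (-1)) (1 * of_real x))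
        = (if x < 1 then complex_of_real (g x) else - \<i> * of_real (h x))"
      proof (intro allI impI)
        fix x :: real assume x: "x \<in> {0<..<1} \<union> {1<..}"
        have 1: "csqrt (of_real x) = of_real (sqrt x)"
          using csqrt_of_real_pos[of x] x by auto
        show "exp (- (2 * of_real t * 1) * of_real x) * (1 * kern (of_real (-1)) (1 * of_real x))
        = (if x < 1 then complex_of_real (g x) else - \<i> * of_real (h x))"
        proof (cases "x < 1")
          case True
          then have "csqrt (1 - of_real x) = of_real (sqrt (1 - x))"
            using csqrt_of_real_pos[of "1 - x"] by simp
          with 1 True show ?thesis by (simp add: g_def kern_def exp_of_real[symmetric])
        next
          case False
          \<comment> \<open>The principal root of the negative number 1 - x lies on the upper
            imaginary axis; this fixes the sign of the K0 term.\<close>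
          then have "csqrt (1 - of_real x) = \<i> * of_real (sqrt (x - 1))"
            using csqrt_of_real_nonpos[of "1 - of_real x"] by simp
          with 1 False show ?thesis by (simp add: h_def kern_def exp_of_real[symmetric] divide_inverse mult_ac)
        qed
      qed
    qed simp
    also have "\<dots> = (LBINT x:{0<..<1}. (if x < 1 then complex_of_real (g x) else - \<i> * of_real (h x)))
         + (LBINT x:{1<..}. (if x < 1 then complex_of_real (g x) else - \<i> * of_real (h x)))"
    proof (rule set_integral_Un)
      show "set_integrable lborel {0<..<1} (\<lambda>x. if x < 1 then complex_of_real (g x) else - \<i> * of_real (h x))"
        using set_integrable_complex_of_real[OF g(1)] by (rule set_integrable_congD) auto
      have "set_integrable lborel {1<..} (\<lambda>x. - \<i> * complex_of_real (h x))"
        using set_integrable_complex_of_real[OF h(1)] by (intro set_integrable_mult_right) auto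
      then show "set_integrable lborel {1<..} (\<lambda>x. if x < 1 then complex_of_real (g x) else - \<i> * of_real (h x))"
        by (rule set_integrable_congD) auto
    qed auto
    also have "\<dots> = (LBINT x:{0<..<1}. complex_of_real (g x)) + (LBINT x:{1<..}. - \<i> * of_real (h x))"
      by (intro arg_cong2[of _ _ _ _ "(+)"] set_lebesgue_integral_cong) auto
    also have "\<dots> = of_real (exp (- t)) * (of_real (pi * bessel_I0 t) - \<i> * of_real (bessel_K0 t))"
      unfolding set_integral_mult_right set_integral_complex_of_real g(2) h(2)
      by (simp add: algebra_simps)
    finally show ?thesis by simp
  qed
  show ?thesis
    unfolding besselprod_def A B by (simp add: exp_minus field_simps)
qed

lemma csqrt_cnj: "Im z \<noteq> 0 \<or> Re z \<ge> 0 \<Longrightarrow> csqrt (cnj z) = cnj (csqrt z)"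
  by (auto simp: complex_eq_iff sgn_if cmod_eq_Re)

text \<open>In the direction - i the exponent is real for z = i y, and the roots are taken of the
  conjugate numbers 1 - i x and 1 + i x. Up to a common prefactor the two integrals are therefore X
  and its conjugate; the prefactor has square - i, so the product is - i |X|^2.\<close>

lemma besselprod_imaginary:
  assumes y: "y > 0"
  shows "Re (besselprod (\<i> * of_real y)) = 0"
proof -
  have r: "rayint \<sigma> (1 - \<i>) (\<i> * of_real y) = rayint \<sigma> (- \<i>) (\<i> * of_real y)" if "\<sigma> \<in> {1, -1}" for \<sigma>
    by (rule rayint_rotate[OF that]) (use y in auto)
  define k where "k = (\<lambda>x::real. 1 / (of_real (sqrt x) * csqrt (1 - \<i> * of_real x)))"
  have e: "2 * (\<i> * complex_of_real y) * - \<i> = 2 * of_real y" by (simp add: complex_eq_iff)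
  define X where "X = (LBINT x:{0<..}. exp (- (2 * of_real y) * complex_of_real x) * k x)"
  have csi: "csqrt (- \<i> * of_real x) = csqrt (- \<i>) * of_real (sqrt x)" if "x > 0" for x
  proof (rule csqrt_unique)
    show "(csqrt (- \<i>) * of_real (sqrt x))\<^sup>2 = - \<i> * of_real x"
      using that by (simp add: power_mult_distrib flip: of_real_power)
    show "0 < Re (csqrt (- \<i>) * of_real (sqrt x)) \<or> Re (csqrt (- \<i>) * of_real (sqrt x)) = 0 \<and> 0 \<le> Im (csqrt (- \<i>) * of_real (sqrt x))"
      using that by simp
  qed
  have A: "rayint 1 (- \<i>) (\<i> * of_real y) = (- \<i> / csqrt (- \<i>)) * X"
  proof -
    have "rayint 1 (- \<i>) (\<i> * of_real y) = (LBINT x:{0<..}. (- \<i> / csqrt (- \<i>)) * (exp (- (2 * of_real y) * complex_of_real x) * k x))"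
      unfolding rayint_def e
      by (rule set_lebesgue_integral_cong) (use csi in \<open>auto simp: k_def kern_def mult_ac\<close>)
    then show ?thesis unfolding X_def by (simp only: set_integral_mult_right)
  qed
  have B: "rayint (-1) (- \<i>) (\<i> * of_real y) = (- \<i> / csqrt (- \<i>)) * cnj X"
  proof -
    have "rayint (-1) (- \<i>) (\<i> * of_real y) = (LBINT x:{0<..}. (- \<i> / csqrt (- \<i>)) * cnj (exp (- (2 * of_real y) * complex_of_real x) * k x))"
      unfolding rayint_def e
    proof (rule set_lebesgue_integral_cong)
      have "cnj (csqrt (1 - \<i> * of_real x)) = csqrt (1 + \<i> * of_real x)" if "x > 0" for x
        using that by (subst csqrt_cnj[symmetric]) auto
      then show "\<forall>x. x \<in> {0<..} \<longrightarrow> exp (- (2 * of_real y) * complex_of_real x) * (- \<i> * kern (- 1) (- \<i> * of_real x))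
         = (- \<i> / csqrt (- \<i>)) * cnj (exp (- (2 * of_real y) * complex_of_real x) * k x)"
        using csi by (auto simp: k_def kern_def exp_cnj mult_ac)
    qed simp
    also have "\<dots> = (- \<i> / csqrt (- \<i>)) * (LBINT x:{0<..}. cnj (exp (- (2 * of_real y) * complex_of_real x) * k x))"
      by (rule set_integral_mult_right)
    also have "(LBINT x:{0<..}. cnj (exp (- (2 * of_real y) * complex_of_real x) * k x)) = cnj X"
      unfolding X_def set_lebesgue_integral_def Bochner_Integration.integral_cnj[symmetric] by simp
    finally show ?thesis .
  qed
  have "besselprod (\<i> * of_real y) = (- \<i> / csqrt (- \<i>))\<^sup>2 * (X * cnj X)"
    unfolding besselprod_def using r[of 1] r[of "-1"] A B by (simp add: power2_eq_square mult_ac)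
  also have "(- \<i> / csqrt (- \<i>))\<^sup>2 = - \<i>"
    by (simp add: power_divide)
  finally show ?thesis by (simp add: complex_mult_cnj)
qed

section \<open>Asymptotic expansions in the first quadrant\<close>

text \<open>A Poincare expansion in x = 1 / (2 z), with no convergence of F implied. The constant is
  uniform in the closed quadrant outside the unit disc, because the estimate is used along chords
  joining the two axes.\<close>

definition has_asymp :: "(complex \<Rightarrow> complex) \<Rightarrow> real fps \<Rightarrow> bool" where
  "has_asymp h F \<longleftrightarrow> (\<forall>N. \<exists>C. \<forall>z. Re z \<ge> 0 \<and> Im z \<ge> 0 \<and> norm z \<ge> 1 \<longrightarrow>
     norm (h z - (\<Sum>j<N. of_real (fps_nth F j) / (2 * z) ^ j)) \<le> C / norm z ^ N)"

lemma has_asympE: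
  assumes "has_asymp h F"
  obtains C where "C \<ge> 0" "\<And>z. Re z \<ge> 0 \<Longrightarrow> Im z \<ge> 0 \<Longrightarrow> norm z \<ge> 1 \<Longrightarrow>
     norm (h z - (\<Sum>j<N. of_real (fps_nth F j) / (2 * z) ^ j)) \<le> C / norm z ^ N"
proof -
  from assms obtain C where C: "\<And>z. Re z \<ge> 0 \<Longrightarrow> Im z \<ge> 0 \<Longrightarrow> norm z \<ge> 1 \<Longrightarrow>
     norm (h z - (\<Sum>j<N. of_real (fps_nth F j) / (2 * z) ^ j)) \<le> C / norm z ^ N"
    unfolding has_asymp_def by blast
  show ?thesis
  proof (rule that[of "\<bar>C\<bar>"])
    fix z :: complex assume z: "Re z \<ge> 0" "Im z \<ge> 0" "norm z \<ge> 1"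
    have "C / norm z ^ N \<le> \<bar>C\<bar> / norm z ^ N" by (intro divide_right_mono) auto
    with C[OF z] show "norm (h z - (\<Sum>j<N. of_real (fps_nth F j) / (2 * z) ^ j)) \<le> \<bar>C\<bar> / norm z ^ N"
      by linarith
  qed simp
qed

lemma has_asymp_1: "has_asymp (\<lambda>_. 1) 1"
  unfolding has_asymp_def
proof
  fix N
  have eq: "1 - (\<Sum>j<N. of_real (fps_nth 1 j) / (2 * z) ^ j) = (if N = 0 then 1 else 0)" for z :: complex
  proof -
    have "(\<Sum>j<N. of_real (fps_nth 1 j) / (2 * z) ^ j) = (\<Sum>j<N. if j = 0 then 1 else 0)"
      by (intro sum.cong) (auto simp: fps_one_nth)
    then show ?thesis by simp
  qed
  show "\<exists>C. \<forall>z. 0 \<le> Re z \<and> 0 \<le> Im z \<and> 1 \<le> cmod z \<longrightarrow>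
       cmod (1 - (\<Sum>j<N. of_real (fps_nth 1 j) / (2 * z) ^ j)) \<le> C / cmod z ^ N"
    unfolding eq by (intro exI[of _ 1]) auto
qed

text \<open>The expansion of k with N = 0 supplies the bound E for k itself. The product of the
  truncations has surplus terms with i + j >= N; they are collected in R and are O(|z|^(-N)) because
  |z| >= 1.\<close>

lemma has_asymp_mult:
  assumes h: "has_asymp h F" and k: "has_asymp k G"
  shows "has_asymp (\<lambda>z. h z * k z) (F * G)"
  unfolding has_asymp_def
proof
  fix N
  obtain C where C: "C \<ge> 0" "\<And>z. Re z \<ge> 0 \<Longrightarrow> Im z \<ge> 0 \<Longrightarrow> norm z \<ge> 1 \<Longrightarrow>
     norm (h z - (\<Sum>j<N. of_real (fps_nth F j) / (2 * z) ^ j)) \<le> C / norm z ^ N"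
    using has_asympE[OF h] by metis
  obtain D where D: "D \<ge> 0" "\<And>z. Re z \<ge> 0 \<Longrightarrow> Im z \<ge> 0 \<Longrightarrow> norm z \<ge> 1 \<Longrightarrow>
     norm (k z - (\<Sum>j<N. of_real (fps_nth G j) / (2 * z) ^ j)) \<le> D / norm z ^ N"
    using has_asympE[OF k] by metis
  obtain E where E: "E \<ge> 0" "\<And>z. Re z \<ge> 0 \<Longrightarrow> Im z \<ge> 0 \<Longrightarrow> norm z \<ge> 1 \<Longrightarrow>
     norm (k z - (\<Sum>j<0. of_real (fps_nth G j) / (2 * z) ^ j)) \<le> E / norm z ^ 0"
    using has_asympE[OF k] by metis
  define P where "P = (\<Sum>j<N. \<bar>fps_nth F j\<bar>)"
  define R where "R = (\<Sum>(i,j)\<in>{..<N}\<times>{..<N} - {(i,j). i + j < N}. \<bar>fps_nth F i\<bar> * \<bar>fps_nth G j\<bar>)"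
  show "\<exists>C. \<forall>z. 0 \<le> Re z \<and> 0 \<le> Im z \<and> 1 \<le> cmod z \<longrightarrow>
       cmod (h z * k z - (\<Sum>j<N. of_real (fps_nth (F * G) j) / (2 * z) ^ j)) \<le> C / cmod z ^ N"
  proof (intro exI[of _ "P * D + C * E + R"] allI impI)
    fix z assume z: "0 \<le> Re z \<and> 0 \<le> Im z \<and> 1 \<le> cmod z"
    define a where "a = (\<lambda>j. complex_of_real (fps_nth F j) / (2 * z) ^ j)"
    define b where "b = (\<lambda>j. complex_of_real (fps_nth G j) / (2 * z) ^ j)"
    have le: "1 / norm (2 * z) ^ j \<le> 1 / norm z ^ i" if "i \<le> j" for i j
    proof -
      have "norm z ^ i \<le> norm z ^ j" using z that by (intro power_increasing) auto
      also have "\<dots> \<le> norm (2 * z) ^ j" by (intro power_mono) (auto simp: norm_mult)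
      finally show ?thesis using z by (intro divide_left_mono mult_pos_pos zero_less_power) auto
    qed
    have a: "norm (\<Sum>j<N. a j) \<le> P"
      unfolding P_def
    proof (rule sum_norm_le)
      fix j
      show "norm (a j) \<le> \<bar>fps_nth F j\<bar>"
        using mult_left_mono[OF le[of 0 j], of "\<bar>fps_nth F j\<bar>"] by (simp add: a_def norm_divide norm_mult norm_power power_mult_distrib)
    qed
    have tri: "(\<Sum>j<N. of_real (fps_nth (F * G) j) / (2 * z) ^ j) = (\<Sum>(i,j)\<in>{(i,j). i + j < N}. a i * b j)"
    proof -
      have ab: "of_real (fps_nth F i * fps_nth G (n - i)) / (2 * z) ^ n = a i * b (n - i)" if "i \<le> n" for i n
      proof -
        have "(2 * z) ^ n = (2 * z) ^ i * (2 * z) ^ (n - i)"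
          using that by (simp only: power_add[symmetric] le_add_diff_inverse)
        then show ?thesis by (simp only: a_def b_def of_real_mult times_divide_times_eq)
      qed
      have "of_real (fps_nth (F * G) n) / (2 * z) ^ n = (\<Sum>i\<le>n. a i * b (n - i))" for n
        using ab by (simp add: fps_mult_nth atLeast0AtMost sum_divide_distrib del: of_real_mult)
      then show ?thesis by (simp add: sum.triangle_reindex)
    qed
    have sq: "(\<Sum>j<N. a j) * (\<Sum>j<N. b j) = (\<Sum>(i,j)\<in>{..<N}\<times>{..<N}. a i * b j)"
      by (simp add: sum_product sum.cartesian_product)
    have sub: "{(i,j). i + j < N} \<subseteq> {..<N}\<times>{..<N}" by auto
    have "norm ((\<Sum>j<N. a j) * (\<Sum>j<N. b j) - (\<Sum>j<N. of_real (fps_nth (F * G) j) / (2 * z) ^ j))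
       = norm (\<Sum>(i,j)\<in>{..<N}\<times>{..<N} - {(i,j). i + j < N}. a i * b j)"
      unfolding sq tri by (subst sum_diff[OF _ sub]) auto
    also have "\<dots> \<le> (\<Sum>(i,j)\<in>{..<N}\<times>{..<N} - {(i,j). i + j < N}. \<bar>fps_nth F i\<bar> * \<bar>fps_nth G j\<bar> / norm z ^ N)"
    proof (rule sum_norm_le)
      fix p assume "p \<in> {..<N}\<times>{..<N} - {(i,j). i + j < N}"
      then obtain i j where p: "p = (i, j)" "\<not> i + j < N" by auto
      then have "\<bar>fps_nth F i\<bar> * \<bar>fps_nth G j\<bar> * (1 / norm (2 * z) ^ (i + j)) \<le> \<bar>fps_nth F i\<bar> * \<bar>fps_nth G j\<bar> * (1 / norm z ^ N)"
        by (intro mult_left_mono le) auto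
      then show "norm (case p of (i, j) \<Rightarrow> a i * b j)
          \<le> (case p of (i, j) \<Rightarrow> \<bar>fps_nth F i\<bar> * \<bar>fps_nth G j\<bar> / norm z ^ N)"
        by (simp add: p(1) a_def b_def norm_mult norm_divide norm_power power_add power_mult_distrib)
    qed
    also have "\<dots> = R / norm z ^ N"
      unfolding R_def sum_divide_distrib by (intro sum.cong) auto
    finally have 1: "norm ((\<Sum>j<N. a j) * (\<Sum>j<N. b j) - (\<Sum>j<N. of_real (fps_nth (F * G) j) / (2 * z) ^ j)) \<le> R / norm z ^ N" .
    have "h z * k z - (\<Sum>j<N. of_real (fps_nth (F * G) j) / (2 * z) ^ j)
      = (\<Sum>j<N. a j) * (k z - (\<Sum>j<N. b j)) + (h z - (\<Sum>j<N. a j)) * k z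
        + ((\<Sum>j<N. a j) * (\<Sum>j<N. b j) - (\<Sum>j<N. of_real (fps_nth (F * G) j) / (2 * z) ^ j))"
      by (simp add: algebra_simps)
    also have "norm \<dots> \<le> norm ((\<Sum>j<N. a j) * (k z - (\<Sum>j<N. b j))) + norm ((h z - (\<Sum>j<N. a j)) * k z)
        + norm ((\<Sum>j<N. a j) * (\<Sum>j<N. b j) - (\<Sum>j<N. of_real (fps_nth (F * G) j) / (2 * z) ^ j))"
      by (intro norm_triangle_le add_mono) auto
    also have "\<dots> \<le> P * (D / norm z ^ N) + C / norm z ^ N * E + R / norm z ^ N"
      unfolding norm_mult using C D E z a 1 unfolding a_def b_def
      by (intro add_mono mult_mono) (auto simp: P_def sum_nonneg)
    also have "\<dots> = (P * D + C * E + R) / norm z ^ N"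
      by (simp add: add_divide_distrib)
    finally show "cmod (h z * k z - (\<Sum>j<N. of_real (fps_nth (F * G) j) / (2 * z) ^ j)) \<le> (P * D + C * E + R) / cmod z ^ N" .
  qed
qed

lemma has_asymp_power: "has_asymp h F \<Longrightarrow> has_asymp (\<lambda>z. h z ^ m) (F ^ m)"
  by (induction m) (auto intro: has_asymp_1 has_asymp_mult)

text \<open>The bound has to hold along a whole ray, far outside the disc of convergence. For |x| <=
  1/2 it is the tail of the binomial series; for larger x the function and all terms of the sum are
  bounded by multiples of (2 |x|)^N, the hypothesis keeping x away from the singularity - 1.\<close>

lemma inverse_sqrt_expansion:
  obtains C where "C \<ge> 0" "\<And>x::complex. norm (1 + x) \<ge> 1 / 2 \<Longrightarrow>
     norm (1 / csqrt (1 + x) - (\<Sum>j<N. ((- 1 / 2) gchoose j) * x ^ j)) \<le> C * norm x ^ N"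
proof -
  define b where "b = (\<lambda>j. (- 1 / 2 :: complex) gchoose j)"
  have sums: "(\<lambda>n. b n * x ^ n) sums (1 / csqrt (1 + x))" if "norm x < 1" for x
  proof -
    have "(1 + x) powr (- 1 / 2) = 1 / csqrt (1 + x)"
      using powr_minus[of "1 + x" "1 / 2"] by (simp add: csqrt_conv_powr inverse_eq_divide)
    then show ?thesis using gen_binomial_complex[OF that, of "- 1 / 2"] by (simp add: b_def)
  qed
  define S where "S = (\<Sum>n. norm (b (n + N)) * (1 / 2) ^ n)"
  have sum0: "summable (\<lambda>n. norm (b n * (1 / 2) ^ n))"
    \<comment> \<open>Convergence at any radius between 1/2 and 1 yields absolute convergence at
      1/2; 3/4 is one such radius.\<close>
    by (rule powser_insidea[where x = "3 / 4"]) (use sums[of "3 / 4"] in \<open>auto simp: sums_iff\<close>)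
  have "summable (\<lambda>n. 2 ^ N * norm (b (n + N) * (1 / 2) ^ (n + N)))"
    by (intro summable_mult) (use sum0 in \<open>simp only: summable_iff_shift[of "\<lambda>n. norm (b n * (1 / 2) ^ n)"]\<close>)
  then have sumS: "summable (\<lambda>n. norm (b (n + N)) * (1 / 2) ^ n)"
    by (simp add: norm_mult norm_power power_add norm_divide power_one_over field_simps)
  define T where "T = (\<Sum>j<N. norm (b j))"
  show ?thesis
  proof (rule that[of "S + 2 ^ N * (2 + T)"])
    have S: "S \<ge> 0" unfolding S_def by (intro suminf_nonneg sumS) auto
    have T: "T \<ge> 0" unfolding T_def by (intro sum_nonneg) auto
    then show "S + 2 ^ N * (2 + T) \<ge> 0" using S by simp
    fix x :: complex assume x: "norm (1 + x) \<ge> 1 / 2"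
    show "norm (1 / csqrt (1 + x) - (\<Sum>j<N. ((- 1 / 2) gchoose j) * x ^ j)) \<le> (S + 2 ^ N * (2 + T)) * norm x ^ N"
    proof (cases "norm x \<le> 1 / 2")
      case True
      have sm: "(\<lambda>n. b n * x ^ n) sums (1 / csqrt (1 + x))" using True by (intro sums) auto
      have sn: "summable (\<lambda>n. norm (b (n + N) * x ^ n))"
      proof (rule summable_comparison_test'[OF sumS])
        fix n :: nat
        show "norm (norm (b (n + N) * x ^ n)) \<le> norm (b (n + N)) * (1 / 2) ^ n"
          using True by (auto simp: norm_mult norm_power intro!: mult_left_mono power_mono)
      qed
      have "1 / csqrt (1 + x) - (\<Sum>j<N. b j * x ^ j) = (\<Sum>n. b (n + N) * x ^ (n + N))"
        using suminf_minus_initial_segment[OF sums_summable[OF sm], of N] sm by (simp add: sums_iff)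
      also have "\<dots> = x ^ N * (\<Sum>n. b (n + N) * x ^ n)"
        by (subst suminf_mult[OF summable_norm_cancel[OF sn], symmetric]) (simp add: power_add mult_ac)
      also have "norm \<dots> = norm x ^ N * norm (\<Sum>n. b (n + N) * x ^ n)" by (simp add: norm_mult norm_power)
      also have "\<dots> \<le> norm x ^ N * S"
      proof (rule mult_left_mono)
        have "norm (\<Sum>n. b (n + N) * x ^ n) \<le> (\<Sum>n. norm (b (n + N) * x ^ n))"
          by (rule summable_norm[OF sn])
        also have "\<dots> \<le> S"
          unfolding S_def using True
          by (intro suminf_le sn sumS) (auto simp: norm_mult norm_power intro!: mult_left_mono power_mono)
        finally show "norm (\<Sum>n. b (n + N) * x ^ n) \<le> S" .
      qed simp
      also have "\<dots> \<le> (S + 2 ^ N * (2 + T)) * norm x ^ N"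
      proof -
        have "S \<le> S + 2 ^ N * (2 + T)" using T by simp
        then show ?thesis by (simp only: mult.commute[of "norm x ^ N"] mult_right_mono[OF _ zero_le_power] norm_ge_zero)
      qed
      finally show ?thesis by (simp add: b_def)
    next
      case False
      then have x1: "1 \<le> 2 * norm x" by simp
      have "sqrt (1 / 4) \<le> sqrt (norm (1 + x))" using x by (intro real_sqrt_le_mono) auto
      then have "1 / 2 \<le> sqrt (norm (1 + x))" by (simp add: real_sqrt_divide)
      then have "norm (1 / csqrt (1 + x)) \<le> 1 / (1 / 2)"
        unfolding norm_divide norm_csqrt norm_one by (intro divide_left_mono) auto
      also have "\<dots> \<le> 2 * (2 * norm x) ^ N" using one_le_power[OF x1, of N] by simp
      finally have 1: "norm (1 / csqrt (1 + x)) \<le> 2 * (2 * norm x) ^ N" .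
      have "norm (\<Sum>j<N. b j * x ^ j) \<le> (\<Sum>j<N. norm (b j) * (2 * norm x) ^ N)"
      proof (rule sum_norm_le)
        fix j assume j: "j \<in> {..<N}"
        have "norm x ^ j \<le> (2 * norm x) ^ j" by (intro power_mono) auto
        also have "\<dots> \<le> (2 * norm x) ^ N" using x1 j by (intro power_increasing) auto
        finally show "norm (b j * x ^ j) \<le> norm (b j) * (2 * norm x) ^ N"
          by (auto simp: norm_mult norm_power intro: mult_left_mono)
      qed
      also have "\<dots> = T * (2 * norm x) ^ N" by (simp add: T_def sum_distrib_right)
      finally have 2: "norm (\<Sum>j<N. b j * x ^ j) \<le> T * (2 * norm x) ^ N" .
      have "norm (1 / csqrt (1 + x) - (\<Sum>j<N. b j * x ^ j)) \<le> (2 + T) * (2 * norm x) ^ N"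
        using norm_triangle_ineq4[of "1 / csqrt (1 + x)" "\<Sum>j<N. b j * x ^ j"] 1 2 by (simp add: distrib_right)
      also have "\<dots> \<le> (S + 2 ^ N * (2 + T)) * norm x ^ N"
      proof -
        have "(2 + T) * (2 * norm x) ^ N = (2 ^ N * (2 + T)) * norm x ^ N"
          by (simp add: power_mult_distrib)
        also have "\<dots> \<le> (S + 2 ^ N * (2 + T)) * norm x ^ N"
          using S by (intro mult_right_mono) auto
        finally show ?thesis .
      qed
      finally show ?thesis by (simp add: b_def)
    qed
  qed
qed

text \<open>The binomial coefficient comes from expanding (1 + v)^(-1/2), the Gamma value from the
  Laplace transform of t^(j - 1/2); each supplies one of the two Pochhammer symbols.\<close>

lemma bessel_coefficient:
  "of_real ((- 1) ^ j * (pochhammer (1 / 2) j)\<^sup>2 / fact j) * complex_of_real (sqrt pi)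
     = ((- 1 / 2) gchoose j) * of_real (Gamma (real j + 1 / 2))"
proof -
  have "Gamma (real j + 1 / 2) = pochhammer (1 / 2) j * sqrt pi"
  proof -
    have "(1 / 2 :: real) \<notin> \<int>\<^sub>\<le>\<^sub>0" by (auto dest: nonpos_Ints_nonpos)
    then show ?thesis
      using pochhammer_Gamma[of "1 / 2 :: real" j] by (simp add: Gamma_one_half_real add.commute)
  qed
  moreover have "((- 1 / 2 :: complex) gchoose j) = of_real ((- 1) ^ j * pochhammer (1 / 2) j / fact j)"
    by (simp add: gbinomial_pochhammer pochhammer_of_real[symmetric])
  ultimately show ?thesis by (simp add: power2_eq_square)
qed

text \<open>A square root of \<open>\<pi> / (2 z)\<close>, with the branch that occurs in the ray integrals.\<close>

definition amplitude :: "complex \<Rightarrow> complex" where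
  "amplitude z = (1 - \<i>) / csqrt (1 - \<i>) * of_real (sqrt pi) * (2 * z * (1 - \<i>)) powr (- 1 / 2)"

text \<open>The product of the two ray integrals involves the amplitude only through this square,
  which is rational in z, so no branch survives.\<close>

lemma amplitude_square:
  assumes "z \<noteq> 0"
  shows "(amplitude z)\<^sup>2 = of_real pi / (2 * z)"
proof -
  have "((2 * z * (1 - \<i>)) powr (- 1 / 2))\<^sup>2 = (2 * z * (1 - \<i>)) powr (- 1)"
    unfolding power2_eq_square powr_add[symmetric] by simp
  also have "\<dots> = 1 / (2 * z * (1 - \<i>))"
    using assms by (subst powr_minus) (simp add: complex_eq_iff inverse_eq_divide)
  finally have 1: "((2 * z * (1 - \<i>)) powr (- 1 / 2))\<^sup>2 = 1 / (2 * z * (1 - \<i>))" .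
  have i: "1 - \<i> \<noteq> 0" by (simp add: complex_eq_iff)
  have "(amplitude z)\<^sup>2 = (1 - \<i>)\<^sup>2 / (csqrt (1 - \<i>))\<^sup>2 * (of_real (sqrt pi))\<^sup>2 * (1 / (2 * z * (1 - \<i>)))"
    unfolding amplitude_def power_mult_distrib power_divide 1 ..
  also have "\<dots> = (1 - \<i>) * of_real pi * (1 / (2 * z * (1 - \<i>)))"
    using i by (simp add: power2_eq_square[of "1 - \<i>"] flip: of_real_power)
  also have "\<dots> = of_real pi / (2 * z)" using i assms by simp
  finally show ?thesis .
qed

lemma norm_amplitude:
  assumes "z \<noteq> 0"
  shows "norm (amplitude z) = sqrt (pi / 2) / sqrt (norm z)"
proof -
  have "(norm (amplitude z))\<^sup>2 = pi / (2 * norm z)"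
    using amplitude_square[OF assms] by (metis norm_power norm_divide norm_of_real norm_mult norm_numeral abs_of_pos pi_gt_zero)
  then have "norm (amplitude z) = sqrt (pi / (2 * norm z))"
    by (metis norm_ge_zero real_sqrt_unique)
  then show ?thesis by (simp add: real_sqrt_divide real_sqrt_mult)
qed

section \<open>Expansion and growth of the Bessel product\<close>

lemma one_minus_i_facts: "Im (1 - \<i>) < 0" "norm (1 - \<i>) = sqrt 2" "1 - \<i> \<noteq> 0"
  by (simp_all add: complex_eq_iff cmod_def)

text \<open>The reason for the direction 1 - i: the real part of z (1 - i) is Re z + Im z, so the
  exponential decays at a rate proportional to |z|, uniformly up to both axes.\<close>

lemma quadrant_norm_le:
  assumes "Re z \<ge> 0" "Im z \<ge> 0"
  shows "2 * norm z \<le> Re (2 * z * (1 - \<i>))"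
  using cmod_le[of z] assms by simp

lemma norm_one_plus_ray:
  assumes "\<sigma> \<in> {1, -1}" "t > 0"
  shows "norm (1 + \<sigma> * ((1 - \<i>) * of_real t)) \<ge> t" "norm (1 + \<sigma> * ((1 - \<i>) * of_real t)) \<ge> 1 / 2"
proof -
  show 1: "norm (1 + \<sigma> * ((1 - \<i>) * of_real t)) \<ge> t"
    using abs_Im_le_cmod[of "1 + \<sigma> * ((1 - \<i>) * of_real t)"] assms by auto
  show "norm (1 + \<sigma> * ((1 - \<i>) * of_real t)) \<ge> 1 / 2"
  proof (cases "t \<ge> 1 / 2")
    case False
    then show ?thesis
      using abs_Re_le_cmod[of "1 + \<sigma> * ((1 - \<i>) * of_real t)"] assms by auto
  qed (use 1 in linarith)
qed

lemma kern_ray: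
  assumes "t > 0"
  shows "(1 - \<i>) * kern \<sigma> ((1 - \<i>) * of_real t)
    = (1 - \<i>) / csqrt (1 - \<i>) * of_real (t powr (- 1 / 2)) * (1 / csqrt (1 + \<sigma> * ((1 - \<i>) * of_real t)))"
proof -
  have "csqrt ((1 - \<i>) * of_real t) = csqrt (1 - \<i>) * of_real (sqrt t)"
  proof (rule csqrt_unique)
    show "(csqrt (1 - \<i>) * of_real (sqrt t))\<^sup>2 = (1 - \<i>) * of_real t"
      using assms by (simp add: power_mult_distrib flip: of_real_power)
    have "Re (csqrt (1 - \<i>)) > 0"
      using csqrt_principal[of "1 - \<i>"] by (auto simp: add_pos_pos cmod_def)
    then show "0 < Re (csqrt (1 - \<i>) * of_real (sqrt t)) \<or>
       Re (csqrt (1 - \<i>) * of_real (sqrt t)) = 0 \<and> 0 \<le> Im (csqrt (1 - \<i>) * of_real (sqrt t))"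
      using assms by simp
  qed
  moreover have "t powr (- 1 / 2) = 1 / sqrt t"
    using assms powr_minus[of t "1 / 2"] by (simp add: powr_half_sqrt inverse_eq_divide)
  ultimately show ?thesis by (simp add: kern_def)
qed

text \<open>Watson's lemma with a uniform constant. The terms t^(j - 1/2) of the kernel are
  transformed exactly; the remainder, of order t^(N - 1/2), is transformed into something of order
  |z|^(-N - 1/2), and division by the amplitude, of order |z|^(-1/2), leaves |z|^(-N). The values
  \<sigma> = 1 and \<sigma> = - 1 give \<open>bessel_fps\<close> and
  \<open>bessel_fps_neg\<close>.\<close>

lemma rayint_asymp:
  assumes \<sigma>: "\<sigma> \<in> {1, -1 :: real}"
  shows "has_asymp (\<lambda>z. rayint (of_real \<sigma>) (1 - \<i>) z / amplitude z)
     (Abs_fps (\<lambda>j. (- \<sigma>) ^ j * (pochhammer (1 / 2) j)\<^sup>2 / fact j))"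
  unfolding has_asymp_def
proof
  fix N
  have \<sigma>': "complex_of_real \<sigma> \<in> {1, -1}" using \<sigma> by auto
  define w where "w = 1 - \<i>"
  define \<kappa> where "\<kappa> = w / csqrt w"
  define b where "b = (\<lambda>j. (- 1 / 2 :: complex) gchoose j)"
  define k where "k = (\<lambda>t. w * kern (of_real \<sigma>) (w * of_real t))"
  define r where "r = (\<lambda>n t. k t - (\<Sum>j<n. \<kappa> * b j * (of_real \<sigma> * w) ^ j * of_real (t powr (real j - 1 / 2))))"
  have w0: "w \<noteq> 0" "Im w < 0" "norm w = sqrt 2" using one_minus_i_facts by (simp_all add: w_def)
  have r_eq: "r n t = \<kappa> * of_real (t powr (- 1 / 2)) *
      (1 / csqrt (1 + of_real \<sigma> * (w * of_real t)) - (\<Sum>j<n. b j * (of_real \<sigma> * (w * of_real t)) ^ j))"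
    if "t > 0" for n t
  proof -
    have "of_real (t powr (real j - 1 / 2)) = complex_of_real (t powr (- 1 / 2)) * of_real t ^ j" for j
      using that powr_add[of t "- 1 / 2" "real j"] by (simp add: powr_realpow)
    moreover have "k t = \<kappa> * of_real (t powr (- 1 / 2)) * (1 / csqrt (1 + of_real \<sigma> * (w * of_real t)))"
      unfolding k_def \<kappa>_def w_def by (rule kern_ray[OF that])
    ultimately show ?thesis
      unfolding r_def
      by (simp add: right_diff_distrib sum_distrib_left power_mult_distrib mult_ac)
  qed
  obtain Cr where Cr: "\<And>n. Cr n \<ge> 0" "\<And>n t. t > 0 \<Longrightarrow> norm (r n t) \<le> Cr n * t powr (real n - 1 / 2)"
  proof -
    have "\<exists>C\<ge>0. \<forall>t>0. norm (r n t) \<le> C * t powr (real n - 1 / 2)" for n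
    proof -
      obtain C where C: "C \<ge> 0" "\<And>x::complex. norm (1 + x) \<ge> 1 / 2 \<Longrightarrow>
         norm (1 / csqrt (1 + x) - (\<Sum>j<n. ((- 1 / 2) gchoose j) * x ^ j)) \<le> C * norm x ^ n"
        using inverse_sqrt_expansion by blast
      show ?thesis
      proof (intro exI[of _ "norm \<kappa> * (C * sqrt 2 ^ n)"] conjI allI impI)
        fix t :: real assume t: "t > 0"
        have "norm (r n t) = norm \<kappa> * t powr (- 1 / 2) *
           norm (1 / csqrt (1 + of_real \<sigma> * (w * of_real t)) - (\<Sum>j<n. b j * (of_real \<sigma> * (w * of_real t)) ^ j))"
          unfolding r_eq[OF t] norm_mult by simp
        also have "\<dots> \<le> norm \<kappa> * t powr (- 1 / 2) * (C * norm (of_real \<sigma> * (w * of_real t)) ^ n)"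
          unfolding b_def
          by (intro mult_left_mono C(2)) (use norm_one_plus_ray(2)[OF \<sigma>' t] in \<open>auto simp: w_def\<close>)
        also have "norm (of_real \<sigma> * (w * of_real t)) = sqrt 2 * t"
          using t w0 \<sigma> by (auto simp: norm_mult)
        also have "norm \<kappa> * t powr (- 1 / 2) * (C * (sqrt 2 * t) ^ n) = norm \<kappa> * (C * sqrt 2 ^ n) * t powr (real n - 1 / 2)"
          using t powr_add[of t "- 1 / 2" "real n"] by (simp add: powr_realpow power_mult_distrib)
        finally show "norm (r n t) \<le> norm \<kappa> * (C * sqrt 2 ^ n) * t powr (real n - 1 / 2)" .
      qed (use C in auto)
    qed
    then show ?thesis using that by metis
  qed
  have rmeas: "set_borel_measurable lborel {0<..} (r n)" for n
  proof -
    have "set_borel_measurable lborel {0<..} (\<lambda>t. \<Sum>j<n. \<kappa> * b j * (of_real \<sigma> * w) ^ j * of_real (t powr (real j - 1 / 2)))"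
      by (rule set_borel_measurable_continuous_on_open) (auto intro!: continuous_intros)
    moreover have "set_borel_measurable lborel {0<..} k"
      unfolding k_def by (rule kern_ray_measurable[OF \<sigma>' w0(2)])
    ultimately show ?thesis
      unfolding r_def set_borel_measurable_def scaleR_diff_right by (rule borel_measurable_diff[rotated])
  qed
  \<comment> \<open>The terms are peeled off one at a time; every intermediate remainder
    \<open>r n\<close> has an integrable majorant of its own.\<close>
  have main: "(LBINT t:{0<..}. exp (- s * of_real t) * r n t) = (LBINT t:{0<..}. exp (- s * of_real t) * k t)
     - (\<Sum>j<n. \<kappa> * b j * (of_real \<sigma> * w) ^ j * (of_real (Gamma (real j + 1 / 2)) * s powr (- of_real (real j + 1 / 2))))"
    if s: "Re s > 0" for s n
  proof (induction n)
    case 0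
    then show ?case by (simp add: r_def)
  next
    case (Suc n)
    define c where "c = \<kappa> * b n * (of_real \<sigma> * w) ^ n"
    have eq: "exp (- s * of_real t) * r (Suc n) t
       = exp (- s * of_real t) * r n t - c * (exp (- s * of_real t) * of_real (t powr (real n - 1 / 2)))" for t
      by (simp add: r_def c_def algebra_simps)
    have i1: "set_integrable lborel {0<..} (\<lambda>t. exp (- s * of_real t) * r n t)"
      by (rule laplace_set_integrable[OF rmeas _ Cr(2) s]) auto
    have i2: "set_integrable lborel {0<..} (\<lambda>t. c * (exp (- s * of_real t) * of_real (t powr (real n - 1 / 2))))"
      by (intro set_integrable_mult_right impI laplace_set_integrable[where a = "real n - 1 / 2" and C = 1] s set_borel_measurable_continuous_on_open)
         (auto intro!: continuous_intros)
    have "(LBINT t:{0<..}. exp (- s * of_real t) * r (Suc n) t) = (LBINT t:{0<..}. exp (- s * of_real t) * r n t)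
       - (LBINT t:{0<..}. c * (exp (- s * of_real t) * of_real (t powr (real n - 1 / 2))))"
      unfolding eq by (rule set_integral_diff(2)[OF i1 i2])
    also have "(LBINT t:{0<..}. c * (exp (- s * of_real t) * of_real (t powr (real n - 1 / 2))))
       = c * (LBINT t:{0<..}. exp (- s * of_real t) * of_real (t powr (real n - 1 / 2)))"
      by (rule set_integral_mult_right)
    also have "(LBINT t:{0<..}. exp (- s * of_real t) * of_real (t powr (real n - 1 / 2)))
       = of_real (Gamma (real n + 1 / 2)) * s powr (- of_real (real n + 1 / 2))"
    proof -
      have e: "real n - 1 / 2 + 1 = real n + 1 / 2" by simp
      show ?thesis by (rule laplace_powr[OF _ s, of "real n - 1 / 2", unfolded e]) simp
    qed
    finally show ?case using Suc by (simp add: c_def)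
  qed
  \<comment> \<open>The last factor is the constant in 1 / |A|, whose sqrt |z| cancels the half
    power left by the Laplace bound.\<close>
  define K where "K = Cr N * Gamma (real N + 1 / 2) * sqrt 2 / sqrt pi"
  show "\<exists>C. \<forall>z. 0 \<le> Re z \<and> 0 \<le> Im z \<and> 1 \<le> cmod z \<longrightarrow>
       cmod (rayint (of_real \<sigma>) (1 - \<i>) z / amplitude z -
          (\<Sum>j<N. of_real (fps_nth (Abs_fps (\<lambda>j. (- \<sigma>) ^ j * (pochhammer (1 / 2) j)\<^sup>2 / fact j)) j) / (2 * z) ^ j))
       \<le> C / cmod z ^ N"
  proof (intro exI[of _ K] allI impI)
    fix z assume z: "0 \<le> Re z \<and> 0 \<le> Im z \<and> 1 \<le> cmod z"
    define s where "s = 2 * z * w"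
    have z0: "z \<noteq> 0" using z by auto
    have Res: "Re s \<ge> 2 * norm z" using quadrant_norm_le[of z] z by (simp add: s_def w_def)
    then have s: "Re s > 0" using z by linarith
    have s0: "s \<noteq> 0" using s by auto
    define A where "A = amplitude z"
    have A: "A = \<kappa> * of_real (sqrt pi) * s powr (- 1 / 2)"
      by (simp add: A_def amplitude_def \<kappa>_def s_def w_def)
    have nA: "norm A = sqrt (pi / 2) / sqrt (norm z)" unfolding A_def by (rule norm_amplitude[OF z0])
    then have A0: "A \<noteq> 0" using z0 by auto
    have coeff: "\<kappa> * b j * (of_real \<sigma> * w) ^ j * (of_real (Gamma (real j + 1 / 2)) * s powr (- of_real (real j + 1 / 2)))
       = A * (of_real ((- \<sigma>) ^ j * (pochhammer (1 / 2) j)\<^sup>2 / fact j) / (2 * z) ^ j)" for j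
    proof -
      have "s powr (- of_real (real j + 1 / 2)) = s powr (- 1 / 2) * s powr (- of_nat j)"
      proof -
        have e: "- complex_of_real (real j + 1 / 2) = - 1 / 2 + - of_nat j" by simp
        show ?thesis unfolding e by (rule powr_add)
      qed
      also have "s powr (- of_nat j) = 1 / s ^ j"
        using s0 by (simp add: powr_minus powr_nat inverse_eq_divide)
      finally have p: "s powr (- of_real (real j + 1 / 2)) = s powr (- 1 / 2) / s ^ j" by simp
      have q: "(of_real \<sigma> * w) ^ j / s ^ j = of_real \<sigma> ^ j / (2 * z) ^ j"
        using w0(1) by (simp add: s_def power_mult_distrib)
      have "\<kappa> * b j * (of_real \<sigma> * w) ^ j * (of_real (Gamma (real j + 1 / 2)) * s powr (- of_real (real j + 1 / 2)))
         = \<kappa> * s powr (- 1 / 2) * (b j * of_real (Gamma (real j + 1 / 2))) * ((of_real \<sigma> * w) ^ j / s ^ j)"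
        unfolding p by simp
      also have "\<dots> = \<kappa> * s powr (- 1 / 2) * (of_real ((- 1) ^ j * (pochhammer (1 / 2) j)\<^sup>2 / fact j) * of_real (sqrt pi)) * (of_real \<sigma> ^ j / (2 * z) ^ j)"
        unfolding q b_def bessel_coefficient ..
      also have "\<dots> = A * (of_real ((- \<sigma>) ^ j * (pochhammer (1 / 2) j)\<^sup>2 / fact j) / (2 * z) ^ j)"
        unfolding A power_minus[of \<sigma>] by (simp add: mult_ac)
      finally show ?thesis .
    qed
    have R: "rayint (of_real \<sigma>) (1 - \<i>) z = (LBINT t:{0<..}. exp (- s * of_real t) * k t)"
      by (simp add: rayint_def s_def k_def w_def)
    have "rayint (of_real \<sigma>) (1 - \<i>) z / A - (\<Sum>j<N. of_real ((- \<sigma>) ^ j * (pochhammer (1 / 2) j)\<^sup>2 / fact j) / (2 * z) ^ j)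
       = (LBINT t:{0<..}. exp (- s * of_real t) * r N t) / A"
      unfolding main[OF s] R coeff sum_distrib_left[symmetric] using A0 by (simp add: diff_divide_distrib)
    also have "norm \<dots> \<le> (Cr N * (Gamma (real N + 1 / 2) * Re s powr (- (real N + 1 / 2)))) / norm A"
    proof -
      have e: "real N - 1 / 2 + 1 = real N + 1 / 2" by simp
      show ?thesis
        unfolding norm_divide
        by (intro divide_right_mono laplace_bound[OF rmeas _ Cr(2) s, of N, unfolded e]) auto
    qed
    also have "\<dots> \<le> (Cr N * (Gamma (real N + 1 / 2) * norm z powr (- (real N + 1 / 2)))) / norm A"
    proof -
      have "Re s powr (- (real N + 1 / 2)) \<le> norm z powr (- (real N + 1 / 2))"
        using Res z by (intro powr_mono2') auto
      then show ?thesis using Cr(1)[of N] by (intro divide_right_mono mult_left_mono) (auto simp: Gamma_real_nonneg)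
    qed
    also have "norm z powr (- (real N + 1 / 2)) = 1 / (norm z ^ N * sqrt (norm z))"
      using z0 by (simp only: powr_minus powr_add powr_half_sqrt) (simp add: powr_realpow inverse_eq_divide powr_half_sqrt)
    also have "(Cr N * (Gamma (real N + 1 / 2) * (1 / (norm z ^ N * sqrt (norm z))))) / norm A = K / norm z ^ N"
      unfolding nA K_def using z0 by (simp add: real_sqrt_divide field_simps)
    finally show "cmod (rayint (of_real \<sigma>) (1 - \<i>) z / amplitude z -
          (\<Sum>j<N. of_real (fps_nth (Abs_fps (\<lambda>j. (- \<sigma>) ^ j * (pochhammer (1 / 2) j)\<^sup>2 / fact j)) j) / (2 * z) ^ j))
       \<le> K / cmod z ^ N"
      by (simp add: A_def)
  qed
qed

lemma has_asymp_cong: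
  assumes "\<And>z. z \<noteq> 0 \<Longrightarrow> h z = k z" "has_asymp h F"
  shows "has_asymp k F"
  unfolding has_asymp_def
proof
  fix N
  obtain C where C: "\<And>z. Re z \<ge> 0 \<Longrightarrow> Im z \<ge> 0 \<Longrightarrow> norm z \<ge> 1 \<Longrightarrow>
     norm (h z - (\<Sum>j<N. of_real (fps_nth F j) / (2 * z) ^ j)) \<le> C / norm z ^ N"
    using has_asympE[OF assms(2)] by metis
  have "norm (k z - (\<Sum>j<N. of_real (fps_nth F j) / (2 * z) ^ j)) \<le> C / norm z ^ N"
    if "0 \<le> Re z \<and> 0 \<le> Im z \<and> 1 \<le> cmod z" for z
  proof -
    have "h z = k z" using that by (intro assms(1)) auto
    with C[of z] that show ?thesis by simp
  qed
  then show "\<exists>C. \<forall>z. 0 \<le> Re z \<and> 0 \<le> Im z \<and> 1 \<le> cmod z \<longrightarrow>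
       cmod (k z - (\<Sum>j<N. of_real (fps_nth F j) / (2 * z) ^ j)) \<le> C / cmod z ^ N" by blast
qed

lemma besselprod_asymp: "has_asymp (\<lambda>z. besselprod z * (2 * z) / of_real pi) product_fps"
proof -
  have "has_asymp (\<lambda>z. (rayint (of_real 1) (1 - \<i>) z / amplitude z) * (rayint (of_real (- 1)) (1 - \<i>) z / amplitude z))
     (Abs_fps (\<lambda>j. (- 1) ^ j * (pochhammer (1 / 2) j)\<^sup>2 / fact j) * Abs_fps (\<lambda>j. (- (- 1)) ^ j * (pochhammer (1 / 2) j)\<^sup>2 / fact j))"
    by (intro has_asymp_mult rayint_asymp) auto
  then have "has_asymp (\<lambda>z. besselprod z * (2 * z) / of_real pi)
    (Abs_fps (\<lambda>j. (- 1) ^ j * (pochhammer (1 / 2) j)\<^sup>2 / fact j) * Abs_fps (\<lambda>j. (- (- 1)) ^ j * (pochhammer (1 / 2) j)\<^sup>2 / fact j))"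
  proof (rule has_asymp_cong[rotated])
    fix z :: complex assume that: "z \<noteq> 0"
    show "(rayint (of_real 1) (1 - \<i>) z / amplitude z) * (rayint (of_real (- 1)) (1 - \<i>) z / amplitude z)
     = besselprod z * (2 * z) / of_real pi"
  proof -
    have "(rayint (of_real 1) (1 - \<i>) z / amplitude z) * (rayint (of_real (- 1)) (1 - \<i>) z / amplitude z)
       = besselprod z / (amplitude z)\<^sup>2"
      by (simp add: besselprod_def power2_eq_square)
    then show ?thesis using amplitude_square[OF that] that by simp
  qed
  qed
  then show ?thesis
    by (simp add: product_fps_def bessel_fps_def bessel_fps_neg_def)
qed

text \<open>At the origin the product grows only like powers of a logarithm; an arbitrarily small
  power replaces it. The lower bound t^(1 - e) / 2 interpolates between the bounds 1/2 and t for |1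
  + \<sigma> v|, so the kernel is O(t^(e/2 - 1)), still integrable at 0, and each factor of the
  product gets the exponent - e / 2.\<close>

lemma besselprod_bound:
  assumes e: "0 < e" "e \<le> 1"
  obtains C where "C \<ge> 0" "\<And>z. Re z \<ge> 0 \<Longrightarrow> Im z \<ge> 0 \<Longrightarrow> z \<noteq> 0 \<Longrightarrow> norm (besselprod z) \<le> C * norm z powr (- e)"
proof -
  have "\<exists>C\<ge>0. \<forall>z. Re z \<ge> 0 \<longrightarrow> Im z \<ge> 0 \<longrightarrow> z \<noteq> 0 \<longrightarrow> norm (rayint \<sigma> (1 - \<i>) z) \<le> C * norm z powr (- e / 2)"
    if \<sigma>: "\<sigma> \<in> {1, -1}" for \<sigma>
  proof -
    define M where "M = norm ((1 - \<i>) / csqrt (1 - \<i>)) * sqrt 2"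
    have kb: "norm ((1 - \<i>) * kern \<sigma> ((1 - \<i>) * of_real t)) \<le> M * t powr (e / 2 - 1)" if t: "t > 0" for t
    proof -
      have "t powr (1 - e) / 2 \<le> norm (1 + \<sigma> * ((1 - \<i>) * of_real t))"
      proof (cases "t \<ge> 1")
        case True
        have "t powr (1 - e) \<le> t powr 1" using True e by (intro powr_mono) auto
        then show ?thesis using norm_one_plus_ray(1)[OF \<sigma> t] True by simp
      next
        case False
        have "t powr (1 - e) \<le> 1" using False t e by (intro powr_le1) auto
        then show ?thesis using norm_one_plus_ray(2)[OF \<sigma> t] by linarith
      qed
      then have "sqrt (t powr (1 - e) / 2) \<le> sqrt (norm (1 + \<sigma> * ((1 - \<i>) * of_real t)))"
        by (rule real_sqrt_le_mono)
      then have le: "t powr ((1 - e) / 2) / sqrt 2 \<le> norm (csqrt (1 + \<sigma> * ((1 - \<i>) * of_real t)))"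
        using t by (simp add: real_sqrt_divide powr_half_sqrt[symmetric] powr_powr)
      have pos: "t powr ((1 - e) / 2) / sqrt 2 > 0" using t by simp
      have "norm (1 / csqrt (1 + \<sigma> * ((1 - \<i>) * of_real t))) \<le> 1 / (t powr ((1 - e) / 2) / sqrt 2)"
        unfolding norm_divide norm_one by (rule frac_le[OF zero_le_one order_refl pos le])
      also have "\<dots> = sqrt 2 * t powr (- ((1 - e) / 2))"
        by (simp only: powr_minus) (simp add: field_simps)
      finally have "norm (1 / csqrt (1 + \<sigma> * ((1 - \<i>) * of_real t))) \<le> sqrt 2 * t powr (- ((1 - e) / 2))" .
      then have "norm ((1 - \<i>) * kern \<sigma> ((1 - \<i>) * of_real t))
         \<le> norm ((1 - \<i>) / csqrt (1 - \<i>)) * t powr (- 1 / 2) * (sqrt 2 * t powr (- ((1 - e) / 2)))"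
        unfolding kern_ray[OF t] norm_mult[of _ "1 / _"] norm_mult[of "_ / _"] norm_of_real
        by (intro mult_mono) auto
      also have "\<dots> = M * (t powr (- 1 / 2) * t powr (- ((1 - e) / 2)))"
        by (simp add: M_def)
      also have "t powr (- 1 / 2) * t powr (- ((1 - e) / 2)) = t powr (e / 2 - 1)"
        unfolding powr_add[symmetric] by (simp add: field_simps)
      finally show ?thesis .
    qed
    show ?thesis
    proof (intro exI[of _ "M * Gamma (e / 2)"] conjI allI impI)
      show "M * Gamma (e / 2) \<ge> 0" using e by (simp add: M_def Gamma_real_nonneg)
      fix z assume z: "Re z \<ge> 0" "Im z \<ge> 0" "z \<noteq> 0"
      have Res: "Re (2 * z * (1 - \<i>)) \<ge> 2 * norm z" using quadrant_norm_le z by blast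
      moreover have nz: "norm z > 0" using z by simp
      ultimately have s: "Re (2 * z * (1 - \<i>)) > 0" by linarith
      have "norm (rayint \<sigma> (1 - \<i>) z) \<le> M * (Gamma (e / 2 - 1 + 1) * Re (2 * z * (1 - \<i>)) powr (- (e / 2 - 1 + 1)))"
        unfolding rayint_def
        by (rule laplace_bound[OF kern_ray_measurable[OF \<sigma> one_minus_i_facts(1)] _ kb s]) (use e in auto)
      also have "\<dots> \<le> M * (Gamma (e / 2) * norm z powr (- e / 2))"
      proof -
        have "Re (2 * z * (1 - \<i>)) powr (- e / 2) \<le> norm z powr (- e / 2)"
          using order_trans[OF _ Res, of "norm z"] nz e by (intro powr_mono2') auto
        then show ?thesis using e by (auto simp: M_def Gamma_real_nonneg intro!: mult_left_mono)
      qed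
      finally show "norm (rayint \<sigma> (1 - \<i>) z) \<le> M * Gamma (e / 2) * norm z powr (- e / 2)" by simp
    qed
  qed
  from this[of 1] this[of "-1"] obtain C1 C2 where
    C: "C1 \<ge> 0" "\<And>z. Re z \<ge> 0 \<Longrightarrow> Im z \<ge> 0 \<Longrightarrow> z \<noteq> 0 \<Longrightarrow> norm (rayint 1 (1 - \<i>) z) \<le> C1 * norm z powr (- e / 2)"
    "C2 \<ge> 0" "\<And>z. Re z \<ge> 0 \<Longrightarrow> Im z \<ge> 0 \<Longrightarrow> z \<noteq> 0 \<Longrightarrow> norm (rayint (-1) (1 - \<i>) z) \<le> C2 * norm z powr (- e / 2)"
    by auto
  show ?thesis
  proof (rule that[of "C1 * C2"])
    fix z assume z: "Re z \<ge> 0" "Im z \<ge> 0" "z \<noteq> 0"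
    have "norm (besselprod z) \<le> (C1 * norm z powr (- e / 2)) * (C2 * norm z powr (- e / 2))"
      unfolding besselprod_def norm_mult using C z by (intro mult_mono) auto
    also have "\<dots> = C1 * C2 * (norm z powr (- e / 2) * norm z powr (- e / 2))" by simp
    also have "norm z powr (- e / 2) * norm z powr (- e / 2) = norm z powr (- e)"
      unfolding powr_add[symmetric] by simp
    finally show "norm (besselprod z) \<le> C1 * C2 * norm z powr (- e)" .
  qed (use C in auto)
qed

lemma besselprod_holomorphic: "besselprod holomorphic_on {z. Re z + Im z > 0}"
proof -
  have "{z. Re (z * (1 - \<i>)) > 0} = {z. Re z + Im z > 0}" by auto
  then show ?thesis
    unfolding besselprod_def[abs_def]
    using rayint_holomorphic[of 1 "1 - \<i>"] rayint_holomorphic[of "-1" "1 - \<i>"]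
    by (intro holomorphic_on_mult) auto
qed

section \<open>Rotating the contour by a quarter turn\<close>

lemma segment_quadrant:
  assumes "v \<in> closed_segment (of_real r) (\<i> * of_real r)" "r > 0"
  shows "Re v \<ge> 0" "Im v \<ge> 0" "norm v \<ge> r / 2" "norm v \<le> r"
proof -
  from assms(1) obtain u where u: "0 \<le> u" "u \<le> 1"
    "v = (1 - u) *\<^sub>R of_real r + u *\<^sub>R (\<i> * of_real r)"
    by (auto simp: in_segment)
  then have v: "Re v = (1 - u) * r" "Im v = u * r" by (simp_all add: scaleR_conv_of_real)
  show "Re v \<ge> 0" "Im v \<ge> 0" using u v assms(2) by auto
  have "Re v + Im v = r" by (simp add: v algebra_simps)
  then show "norm v \<ge> r / 2"
    using complex_Re_le_cmod[of v] abs_Im_le_cmod[of v] by linarith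
  show "norm v \<le> r"
    using cmod_le[of v] \<open>Re v + Im v = r\<close> \<open>Re v \<ge> 0\<close> \<open>Im v \<ge> 0\<close> by simp
qed

text \<open>Let F be a primitive of \<Phi> on a half plane containing both positive axes. By
  \<open>imag\<close>, Im F is a constant c on the imaginary axis; by \<open>zero\<close>, F(r) -
  F(i r) vanishes as r tends to 0; by \<open>infty\<close>, the same holds for F - S as r tends to
  infinity. Hence Im F(r) runs from c to c - V. Subtracting T compensates the growth of \<Phi>, and
  \<open>real\<close> keeps T out of the imaginary part on the real axis.\<close>

lemma quadrant_integral:
  assumes hol: "\<Phi> holomorphic_on {z. Re z + Im z > 0}"
    and S: "\<And>z. Re z + Im z > 0 \<Longrightarrow> (S has_field_derivative T z) (at z)"
    and infty: "\<And>z. Re z \<ge> 0 \<Longrightarrow> Im z \<ge> 0 \<Longrightarrow> norm z \<ge> 1 \<Longrightarrow> norm (\<Phi> z - T z) \<le> C / norm z ^ 2"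
    and zero: "\<And>z. Re z \<ge> 0 \<Longrightarrow> Im z \<ge> 0 \<Longrightarrow> z \<noteq> 0 \<Longrightarrow> norm z \<le> 1 \<Longrightarrow> norm (\<Phi> z) \<le> D * norm z powr (- 1 / 2)"
    and imag: "\<And>y. y > 0 \<Longrightarrow> Re (\<Phi> (\<i> * of_real y)) = 0"
    and real: "\<And>t. t > 0 \<Longrightarrow> Im (T (of_real t)) = 0"
    and V: "\<And>r. r > 0 \<Longrightarrow> Im (S (\<i> * of_real r) - S (of_real r)) = V"
  shows "set_integrable lborel {0<..} (\<lambda>t. Im (\<Phi> (of_real t)))"
    and "(LBINT t:{0<..}. Im (\<Phi> (of_real t))) = - V"
proof -
  let ?H = "{z. Re z + Im z > 0}"
  have H: "?H = {z. inner (Complex 1 1) z > 0}" by (auto simp: inner_complex_def)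
  have openH: "open ?H" and convH: "convex ?H"
    unfolding H by (rule open_halfspace_gt convex_halfspace_gt)+
  obtain F where F': "\<And>z. z \<in> ?H \<Longrightarrow> (F has_field_derivative \<Phi> z) (at z within ?H)"
    using holomorphic_convex_primitive'[OF convH openH hol] by blast
  have F: "(F has_field_derivative \<Phi> z) (at z)" if "Re z + Im z > 0" for z
    using F'[of z] that at_within_open[OF _ openH, of z] by simp
  have C: "C \<ge> 0" using order_trans[OF norm_ge_zero infty[of 1]] by simp
  have D: "D \<ge> 0" using order_trans[OF norm_ge_zero zero[of 1]] by simp
  have cont: "continuous_on {0<..} (\<lambda>t. Im (\<Phi> (of_real t)))"
    using holomorphic_on_imp_continuous_on[OF hol]
    by (intro continuous_on_Im continuous_on_compose2[where g = \<Phi> and f = of_real and t = ?H])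
       (auto intro!: continuous_intros)
  show int: "set_integrable lborel {0<..} (\<lambda>t. Im (\<Phi> (of_real t)))"
  proof -
    have "set_integrable lborel {0<..<1} (\<lambda>t. Im (\<Phi> (of_real t)))"
    proof (rule set_integrable_bound)
      have "set_integrable lborel {0<..} (\<lambda>t::real. t powr (- 1 / 2) * exp (- 1 * t))"
        by (rule set_integrable_powr_exp) auto
      then have "set_integrable lborel {0<..<1} (\<lambda>t::real. t powr (- 1 / 2) * exp (- 1 * t))"
        by (rule set_integrable_subset) auto
      \<comment> \<open>The factor exp 1 compensates exp (- t) on the unit interval, so the Gamma
        integrand majorizes D t^(-1/2).\<close>
      then show "set_integrable lborel {0<..<1} (\<lambda>t::real. D * exp 1 * (t powr (- 1 / 2) * exp (- 1 * t)))"
        by simp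
      show "set_borel_measurable lborel {0<..<1} (\<lambda>t. Im (\<Phi> (of_real t)))"
        by (rule set_borel_measurable_continuous_on_open) (auto intro: continuous_on_subset[OF cont])
      show "AE t in lborel. t \<in> {0<..<1} \<longrightarrow> norm (Im (\<Phi> (of_real t))) \<le> norm (D * exp 1 * (t powr (- 1 / 2) * exp (- 1 * t)))"
      proof (intro AE_I2 impI)
        fix t :: real assume t: "t \<in> {0<..<1}"
        have "norm (Im (\<Phi> (of_real t))) \<le> D * t powr (- 1 / 2) * 1"
          using zero[of "of_real t"] abs_Im_le_cmod[of "\<Phi> (of_real t)"] t by simp
        also have "\<dots> \<le> D * t powr (- 1 / 2) * exp (1 - t)"
          using t D by (intro mult_left_mono) auto
        finally show "norm (Im (\<Phi> (of_real t))) \<le> norm (D * exp 1 * (t powr (- 1 / 2) * exp (- 1 * t)))"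
          using D by (simp add: exp_diff exp_minus field_simps)
      qed
    qed
    moreover have "set_integrable lborel {1..} (\<lambda>t. Im (\<Phi> (of_real t)))"
    proof (rule set_integrable_bound)
      have "set_integrable lborel {1..} (\<lambda>t::real. 1 / t ^ 2)"
      proof -
        have "((\<lambda>x::real. 1 / x ^ 2) has_integral 1 / (real (2 - 1) * 1 ^ (2 - 1))) {1..}"
          by (rule has_integral_inverse_power_to_inf) auto
        then have "set_integrable lebesgue {1..} (\<lambda>x::real. 1 / x ^ 2)"
          by (intro nonnegative_absolutely_integrable_1) (auto simp: integrable_on_def)
        moreover have "(\<lambda>x::real. indicator {1..} x *\<^sub>R (1 / x ^ 2)) \<in> borel_measurable lborel"
          by measurable
        ultimately show ?thesis
          unfolding set_integrable_def by (simp add: integrable_completion)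
      qed
      then show "set_integrable lborel {1..} (\<lambda>t::real. C * (1 / t ^ 2))" by (rule set_integrable_mult_right[rotated])
      have "(\<lambda>t. indicator {1..} t *\<^sub>R Im (\<Phi> (complex_of_real t))) \<in> borel_measurable borel"
        by (rule borel_measurable_continuous_on_indicator) (auto intro: continuous_on_subset[OF cont])
      then show "set_borel_measurable lborel {1..} (\<lambda>t. Im (\<Phi> (of_real t)))"
        unfolding set_borel_measurable_def by simp
      show "AE t in lborel. t \<in> {1..} \<longrightarrow> norm (Im (\<Phi> (of_real t))) \<le> norm (C * (1 / t ^ 2))"
      proof (intro AE_I2 impI)
        fix t :: real assume t: "t \<in> {1..}"
        have "norm (Im (\<Phi> (of_real t))) = norm (Im (\<Phi> (of_real t) - T (of_real t)))"
          using real[of t] t by simp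
        also have "\<dots> \<le> norm (\<Phi> (of_real t) - T (of_real t))"
          unfolding real_norm_def by (rule abs_Im_le_cmod)
        also have "\<dots> \<le> C / t ^ 2" using infty[of "of_real t"] t by simp
        finally show "norm (Im (\<Phi> (of_real t))) \<le> norm (C * (1 / t ^ 2))" using C by simp
      qed
    qed
    moreover have "{0<..} = {0<..<1} \<union> {1::real..}" by auto
    ultimately show ?thesis by (simp add: set_integrable_Un)
  qed
  define c where "c = Im (F \<i>)"
  have c: "Im (F (\<i> * of_real y)) = c" if "y > 0" for y
  proof -
    \<comment> \<open>The derivative of Im F along the axis is Im (i \<Phi>(i y)) = Re \<Phi>(i y),
      which \<open>imag\<close> makes zero.\<close>
    have "((\<lambda>y. Im (F (\<i> * of_real y))) has_real_derivative 0) (at y within {0<..})" if "y > 0" for y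
    proof -
      have "((\<lambda>y. \<i> * of_real y) has_vector_derivative \<i>) (at y)"
        using has_vector_derivative_mult_right[OF bounded_linear.has_vector_derivative[OF bounded_linear_of_real has_vector_derivative_id], of \<i>]
        by simp
      moreover have "(F has_field_derivative \<Phi> (\<i> * of_real y)) (at (\<i> * of_real y))"
        by (rule F) (use that in simp)
      ultimately have "((F \<circ> (\<lambda>y. \<i> * of_real y)) has_vector_derivative \<i> * \<Phi> (\<i> * of_real y)) (at y)"
        by (rule field_vector_diff_chain_at)
      then have "((\<lambda>y. Im ((F \<circ> (\<lambda>y. \<i> * of_real y)) y)) has_vector_derivative Im (\<i> * \<Phi> (\<i> * of_real y))) (at y)"
        by (rule bounded_linear.has_vector_derivative[OF bounded_linear_Im])
      then have "((\<lambda>y. Im (F (\<i> * of_real y))) has_vector_derivative 0) (at y)"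
        using imag[OF that] by (simp add: o_def)
      then show ?thesis
        by (simp add: has_real_derivative_iff_has_vector_derivative has_vector_derivative_at_within)
    qed
    then have "\<exists>k. \<forall>y\<in>{0<..}. Im (F (\<i> * of_real y)) = k"
      by (intro has_field_derivative_zero_constant) auto
    then obtain k where "\<forall>y\<in>{0<..}. Im (F (\<i> * of_real y)) = k" by blast
    then show ?thesis using that by (auto simp: c_def dest: bspec[of _ _ 1] bspec[of _ _ y])
  qed
  have lim0: "((\<lambda>r. F (of_real r) - F (\<i> * of_real r)) \<longlongrightarrow> 0) (at_right 0)"
  proof (rule Lim_null_comparison)
    show "((\<lambda>r. 2 * (D * 2) * sqrt r) \<longlongrightarrow> 0) (at_right 0)"
      using tendsto_mult_left[OF tendsto_real_sqrt[OF tendsto_ident_at, of 0 "{0<..}"], of "2 * (D * 2)"] by simp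
    have "norm (F (of_real r) - F (\<i> * of_real r)) \<le> 2 * (D * 2) * sqrt r" if r: "0 < r" "r < 1" for r
    proof -
      have "norm (F (of_real r) - F (\<i> * of_real r)) \<le> (D * (r / 2) powr (- 1 / 2)) * norm (of_real r - \<i> * of_real r)"
      proof (rule field_differentiable_bound[OF convex_closed_segment])
        fix v assume v: "v \<in> closed_segment (of_real r) (\<i> * of_real r)"
        note q = segment_quadrant[OF v r(1)]
        have v0: "v \<noteq> 0" using q(3) r by auto
        then have "Re v + Im v > 0" using q(1,2) by (metis add_nonneg_eq_0_iff complex_eqI less_eq_real_def add_nonneg_nonneg zero_complex.sel)
        then show "(F has_field_derivative \<Phi> v) (at v within closed_segment (of_real r) (\<i> * of_real r))"
          by (rule has_field_derivative_at_within[OF F])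
        have "norm (\<Phi> v) \<le> D * norm v powr (- 1 / 2)" using q r v0 by (intro zero) auto
        also have "\<dots> \<le> D * (r / 2) powr (- 1 / 2)"
          using q r D by (intro mult_left_mono powr_mono2') auto
        finally show "norm (\<Phi> v) \<le> D * (r / 2) powr (- 1 / 2)" .
      qed (rule ends_in_segment)+
      also have "\<dots> \<le> (D * (2 / sqrt r)) * (2 * r)"
      proof (rule mult_mono)
        have "(r / 2) powr (- 1 / 2) = sqrt 2 / sqrt r"
          using r powr_minus[of "r / 2" "1 / 2"] by (simp add: powr_half_sqrt real_sqrt_divide inverse_eq_divide)
        also have "\<dots> \<le> 2 / sqrt r" using r by (intro divide_right_mono) (auto simp: sqrt2_less_2 less_imp_le)
        finally show "D * (r / 2) powr (- 1 / 2) \<le> D * (2 / sqrt r)" using D by (rule mult_left_mono)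
        show "norm (of_real r - \<i> * of_real r) \<le> 2 * r"
          using norm_triangle_ineq4[of "of_real r" "\<i> * of_real r"] r by (simp add: norm_mult)
      qed (use D r in auto)
      also have "\<dots> = 2 * (D * 2) * sqrt r"
        using r by (simp add: field_simps)
      finally show ?thesis .
    qed
    then show "eventually (\<lambda>r. norm (F (of_real r) - F (\<i> * of_real r)) \<le> 2 * (D * 2) * sqrt r) (at_right 0)"
      by (auto simp: eventually_at_right_field intro!: exI[of _ 1])
  qed
  \<comment> \<open>On the chord |v| >= r / 2, so F - S changes by at most (4 C / r^2) (2 r); r >= 2
    keeps the chord out of the open unit disc.\<close>
  have lim1: "((\<lambda>r. (F (of_real r) - S (of_real r)) - (F (\<i> * of_real r) - S (\<i> * of_real r))) \<longlongrightarrow> 0) at_top"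
  proof (rule Lim_null_comparison)
    have "((\<lambda>r::real. 8 * C * inverse r) \<longlongrightarrow> 8 * C * 0) at_top"
      by (intro tendsto_intros tendsto_inverse_0_at_top filterlim_ident)
    then show "((\<lambda>r::real. 8 * C * inverse r) \<longlongrightarrow> 0) at_top" by simp
    have bound: "norm ((F (of_real r) - S (of_real r)) - (F (\<i> * of_real r) - S (\<i> * of_real r))) \<le> 8 * C * inverse r" if r: "2 \<le> r" for r
    proof -
      have r0: "r > 0" using r by simp
      have "norm ((\<lambda>z. F z - S z) (of_real r) - (\<lambda>z. F z - S z) (\<i> * of_real r)) \<le> (C / (r / 2) ^ 2) * norm (of_real r - \<i> * of_real r)"
      proof (rule field_differentiable_bound[OF convex_closed_segment])
        fix v assume v: "v \<in> closed_segment (of_real r) (\<i> * of_real r)"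
        note q = segment_quadrant[OF v r0]
        have v0: "v \<noteq> 0" using q(3) r by auto
        then have "Re v + Im v > 0" using q(1,2) by (metis add_nonneg_eq_0_iff complex_eqI less_eq_real_def add_nonneg_nonneg zero_complex.sel)
        then have "((\<lambda>z. F z - S z) has_field_derivative \<Phi> v - T v) (at v)"
          by (intro DERIV_diff F S)
        then show "((\<lambda>z. F z - S z) has_field_derivative \<Phi> v - T v) (at v within closed_segment (of_real r) (\<i> * of_real r))"
          by (rule has_field_derivative_at_within)
        have "norm (\<Phi> v - T v) \<le> C / norm v ^ 2" using q r by (intro infty) auto
        also have "\<dots> \<le> C / (r / 2) ^ 2"
          using q r C by (intro divide_left_mono power_mono mult_pos_pos zero_less_power) auto
        finally show "norm (\<Phi> v - T v) \<le> C / (r / 2) ^ 2" .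
      qed (rule ends_in_segment)+
      also have "\<dots> \<le> (C / (r / 2) ^ 2) * (2 * r)"
        using norm_triangle_ineq4[of "of_real r" "\<i> * of_real r"] r C by (intro mult_left_mono) (auto simp: norm_mult)
      also have "\<dots> = 8 * C * inverse r"
        using r by (simp add: field_simps power2_eq_square)
      finally show ?thesis by simp
    qed
    show "eventually (\<lambda>r. norm ((F (of_real r) - S (of_real r)) - (F (\<i> * of_real r) - S (\<i> * of_real r))) \<le> 8 * C * inverse r) at_top"
      by (rule eventually_mono[OF eventually_ge_at_top[of 2]]) (rule bound)
  qed
  have ImF: "Im (F (of_real r)) = c + Im (F (of_real r) - F (\<i> * of_real r))" if "r > 0" for r
    using c[OF that] by simp
  have L0: "((\<lambda>r. Im (F (of_real r))) \<longlongrightarrow> c) (at_right 0)"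
  proof (rule Lim_transform_eventually)
    show "((\<lambda>r. c + Im (F (of_real r) - F (\<i> * of_real r))) \<longlongrightarrow> c) (at_right 0)"
      using tendsto_add[OF tendsto_const[of c] tendsto_Im[OF lim0]] by simp
    show "eventually (\<lambda>r. c + Im (F (of_real r) - F (\<i> * of_real r)) = Im (F (of_real r))) (at_right 0)"
      using ImF by (auto simp: eventually_at_right_field intro!: exI[of _ 1])
  qed
  have L1: "((\<lambda>r. Im (F (of_real r))) \<longlongrightarrow> c - V) at_top"
  proof (rule Lim_transform_eventually)
    show "((\<lambda>r. c - V + Im ((F (of_real r) - S (of_real r)) - (F (\<i> * of_real r) - S (\<i> * of_real r)))) \<longlongrightarrow> c - V) at_top"
      using tendsto_add[OF tendsto_const[of "c - V"] tendsto_Im[OF lim1]] by simp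
    show "eventually (\<lambda>r. c - V + Im ((F (of_real r) - S (of_real r)) - (F (\<i> * of_real r) - S (\<i> * of_real r)))
        = Im (F (of_real r))) at_top"
      using eventually_gt_at_top[of "0::real"]
    proof eventually_elim
      case (elim r)
      then show ?case using c[of r] V[of r] by simp
    qed
  qed
  have "(LBINT t=0..\<infinity>. Im (\<Phi> (of_real t))) = (c - V) - c"
  proof (rule interval_integral_FTC_integrable[where F = "\<lambda>r. Im (F (of_real r))"])
    fix t :: real assume "0 < ereal t" "ereal t < \<infinity>"
    then have t: "t > 0" by simp
    have "((\<lambda>y. of_real y) has_vector_derivative (1::complex)) (at t)"
      using bounded_linear.has_vector_derivative[OF bounded_linear_of_real has_vector_derivative_id] by simp
    moreover have "(F has_field_derivative \<Phi> (of_real t)) (at (of_real t))"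
      by (rule F) (use t in simp)
    ultimately have "((F \<circ> of_real) has_vector_derivative 1 * \<Phi> (of_real t)) (at t)"
      by (rule field_vector_diff_chain_at)
    then have "((\<lambda>y. Im ((F \<circ> of_real) y)) has_vector_derivative Im (1 * \<Phi> (of_real t))) (at t)"
      by (rule bounded_linear.has_vector_derivative[OF bounded_linear_Im])
    then show "((\<lambda>r. Im (F (of_real r))) has_vector_derivative Im (\<Phi> (of_real t))) (at t)"
      by (simp add: o_def)
    show "isCont (\<lambda>t. Im (\<Phi> (of_real t))) t"
      using cont t by (simp add: continuous_on_eq_continuous_at)
  next
    have "einterval 0 \<infinity> = {0<..}" by (auto simp: einterval_def zero_ereal_def)
    then show "set_integrable lborel (einterval 0 \<infinity>) (\<lambda>t. Im (\<Phi> (of_real t)))" using int by simp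
  qed (use L0 L1 in \<open>auto simp: ereal_tendsto_simps zero_ereal_def\<close>)
  then show "(LBINT t:{0<..}. Im (\<Phi> (of_real t))) = - V"
    by (simp add: interval_integral_to_infinity_eq zero_ereal_def)
qed

section \<open>Evaluation of the moments\<close>

lemma besselprod_power_bound_zero:
  assumes "m > 0"
  obtains D where "D \<ge> 0" "\<And>z. Re z \<ge> 0 \<Longrightarrow> Im z \<ge> 0 \<Longrightarrow> z \<noteq> 0 \<Longrightarrow> norm z \<le> 1 \<Longrightarrow>
     norm (besselprod z ^ m * z ^ n) \<le> D * norm z powr (- 1 / 2)"
proof -
  \<comment> \<open>Chosen so that the m-th power of |z|^(-e) is |z|^(-1/2).\<close>
  define e where "e = 1 / (2 * real m)"
  have e: "0 < e" "e \<le> 1" using assms by (auto simp: e_def divide_simps)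
  obtain C where C: "C \<ge> 0" "\<And>z. Re z \<ge> 0 \<Longrightarrow> Im z \<ge> 0 \<Longrightarrow> z \<noteq> 0 \<Longrightarrow> norm (besselprod z) \<le> C * norm z powr (- e)"
    using besselprod_bound[OF e] by blast
  show ?thesis
  proof (rule that[of "C ^ m"])
    fix z assume z: "Re z \<ge> 0" "Im z \<ge> 0" "z \<noteq> 0" "norm z \<le> 1"
    have "norm (besselprod z ^ m * z ^ n) \<le> (C * norm z powr (- e)) ^ m * 1"
      unfolding norm_mult norm_power using C z by (intro mult_mono power_mono power_le_one) auto
    also have "\<dots> = C ^ m * norm z powr (- e * real m)"
      using z by (simp add: power_mult_distrib powr_powr flip: powr_realpow)
    also have "- e * real m = - 1 / 2" using assms by (simp add: e_def)
    finally show "norm (besselprod z ^ m * z ^ n) \<le> C ^ m * norm z powr (- 1 / 2)" .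
  qed (use C in auto)
qed

lemma besselprod_power_imaginary:
  assumes "y > 0"
  shows "besselprod (\<i> * of_real y) ^ m * (\<i> * of_real y) ^ n
    = \<i> ^ (m + n) * of_real (Im (besselprod (\<i> * of_real y)) ^ m * y ^ n)"
proof -
  define B where "B = Im (besselprod (\<i> * of_real y))"
  have B: "besselprod (\<i> * of_real y) = \<i> * of_real B"
    using besselprod_imaginary[OF assms] by (simp add: B_def complex_eq_iff)
  show ?thesis
    unfolding B_def[symmetric] unfolding B by (simp add: power_mult_distrib power_add)
qed

lemma besselprod_power_holomorphic: "(\<lambda>z. besselprod z ^ m * z ^ n) holomorphic_on {z. Re z + Im z > 0}"
  by (intro holomorphic_intros besselprod_holomorphic)

text \<open>The expansion of order 0 gives Z = O(1 / |z|), hence Z^m z^n = O(|z|^(-2 k)) with 2 k >=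
  2, and T = S = 0 suffices. As m + n is even, Z^m z^n is real on the imaginary axis; the factor i
  in \<Phi> brings this into the form required by \<open>quadrant_integral\<close>.\<close>

lemma even_integral_zero:
  assumes m: "m = n + 2 * k" "k > 0"
  shows "set_integrable lborel {0<..} (\<lambda>t. Re (besselprod (of_real t) ^ m * of_real t ^ n))"
    and "(LBINT t:{0<..}. Re (besselprod (of_real t) ^ m * of_real t ^ n)) = 0"
proof -
  define \<Phi> where "\<Phi> = (\<lambda>z. \<i> * (besselprod z ^ m * z ^ n))"
  obtain D where D: "D \<ge> 0" "\<And>z. Re z \<ge> 0 \<Longrightarrow> Im z \<ge> 0 \<Longrightarrow> z \<noteq> 0 \<Longrightarrow> norm z \<le> 1 \<Longrightarrow>
     norm (besselprod z ^ m * z ^ n) \<le> D * norm z powr (- 1 / 2)"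
    using besselprod_power_bound_zero[of m n] m by auto
  obtain C where C: "C \<ge> 0" "\<And>z. Re z \<ge> 0 \<Longrightarrow> Im z \<ge> 0 \<Longrightarrow> norm z \<ge> 1 \<Longrightarrow>
     norm (besselprod z * (2 * z) / of_real pi - (\<Sum>j<0. of_real (fps_nth product_fps j) / (2 * z) ^ j)) \<le> C / norm z ^ 0"
    by (rule has_asympE[OF besselprod_asymp, where N = 0]) (rule that)
  have infty: "norm (\<Phi> z - 0) \<le> (pi * C / 2) ^ m / norm z ^ 2" if z: "Re z \<ge> 0" "Im z \<ge> 0" "norm z \<ge> 1" for z
  proof -
    have "norm (besselprod z) * (2 * norm z) / pi \<le> C"
      using C(2)[OF z] by (simp add: norm_mult norm_divide)
    then have "norm (besselprod z) \<le> (pi * C / 2) / norm z"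
    proof -
      have "norm z > 0" using z by linarith
      then show ?thesis using \<open>norm (besselprod z) * (2 * norm z) / pi \<le> C\<close> by (simp add: pos_le_divide_eq field_simps)
    qed
    then have "norm (besselprod z) ^ m \<le> ((pi * C / 2) / norm z) ^ m"
      by (intro power_mono) auto
    then have "norm (besselprod z) ^ m * norm z ^ n \<le> ((pi * C / 2) / norm z) ^ m * norm z ^ n"
      by (intro mult_right_mono) auto
    also have "\<dots> = (pi * C / 2) ^ m / norm z ^ (2 * k)"
      using z by (simp only: m power_divide power_add) (auto simp: field_simps)
    also have "\<dots> \<le> (pi * C / 2) ^ m / norm z ^ 2"
      using z m C by (intro divide_left_mono power_increasing zero_less_power mult_pos_pos) auto
    finally show ?thesis by (simp add: \<Phi>_def norm_mult norm_power)
  qed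
  have imag: "Re (\<Phi> (\<i> * of_real y)) = 0" if "y > 0" for y
  proof -
    have "\<i> ^ (m + n) = of_real ((- 1) ^ (n + k))"
    proof -
      have "m + n = 2 * (n + k)" using m by simp
      then show ?thesis by (simp add: power_mult)
    qed
    then have "\<Phi> (\<i> * of_real y) = \<i> * of_real ((- 1) ^ (n + k) * (Im (besselprod (\<i> * of_real y)) ^ m * y ^ n))"
      unfolding \<Phi>_def besselprod_power_imaginary[OF that] by simp
    then show ?thesis by (simp del: of_real_mult of_real_power)
  qed
  have \<Phi>: "Im (\<Phi> z) = Re (besselprod z ^ m * z ^ n)" for z by (simp add: \<Phi>_def)
  have hol: "\<Phi> holomorphic_on {z. Re z + Im z > 0}"
    unfolding \<Phi>_def by (intro holomorphic_on_mult holomorphic_on_const besselprod_power_holomorphic)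
  have zero: "norm (\<Phi> z) \<le> D * norm z powr (- 1 / 2)"
    if "Re z \<ge> 0" "Im z \<ge> 0" "z \<noteq> 0" "norm z \<le> 1" for z
    using D(2)[OF that] by (simp add: \<Phi>_def norm_mult)
  note Q = quadrant_integral[of \<Phi> "\<lambda>_. 0" "\<lambda>_. 0" "(pi * C / 2) ^ m" D 0, OF hol _ infty zero imag, unfolded \<Phi>]
  show "set_integrable lborel {0<..} (\<lambda>t. Re (besselprod (of_real t) ^ m * of_real t ^ n))"
    by (rule Q(1)) auto
  have "(LBINT t:{0<..}. Re (besselprod (of_real t) ^ m * of_real t ^ n)) = - 0"
    by (rule Q(2)) auto
  then show "(LBINT t:{0<..}. Re (besselprod (of_real t) ^ m * of_real t ^ n)) = 0" by simp
qed

text \<open>Term j of the expansion of Z^m z^n has the exponent e j = n - m - j. Since m + n is odd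
  and c j vanishes for odd j, the primitives z^(e j + 1) / (e j + 1) that occur have even exponents
  and change by real amounts between r and i r. What remains is the term with e j = - 1, that is j =
  n + 1 - m, whose logarithm changes by i pi / 2.\<close>

lemma odd_integral:
  assumes m: "m > 0" and odd: "odd (m + n)"
  shows "set_integrable lborel {0<..} (\<lambda>t. Im (besselprod (of_real t) ^ m * of_real t ^ n))"
    and "(LBINT t:{0<..}. Im (besselprod (of_real t) ^ m * of_real t ^ n))
      = - (if m \<le> n + 1 then (pi / 2) ^ (m + 1) * fps_nth (product_fps ^ m) (n + 1 - m) / 2 ^ (n + 1 - m) else 0)"
proof -
  define \<Phi> where "\<Phi> = (\<lambda>z. besselprod z ^ m * z ^ n)"
  define c where "c = fps_nth (product_fps ^ m)"
  \<comment> \<open>Enough terms to make the remainder O(|z|^(-m - 2)) and to include j = n + 1 - m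
    whenever that index exists.\<close>
  define J where "J = n + 2"
  define e where "e = (\<lambda>j. int n - int m - int j)"
  define T where "T = (\<lambda>z::complex. of_real ((pi / 2) ^ m) * (\<Sum>j<J. of_real (c j / 2 ^ j) * z powi e j))"
  define s where "s = (\<lambda>j (z::complex). if e j = - 1 then Ln z else z powi (e j + 1) / of_int (e j + 1))"
  define S where "S = (\<lambda>z::complex. of_real ((pi / 2) ^ m) * (\<Sum>j<J. of_real (c j / 2 ^ j) * s j z))"
  define V where "V = (if m \<le> n + 1 then (pi / 2) ^ (m + 1) * c (n + 1 - m) / 2 ^ (n + 1 - m) else 0)"
  obtain D where D: "D \<ge> 0" "\<And>z. Re z \<ge> 0 \<Longrightarrow> Im z \<ge> 0 \<Longrightarrow> z \<noteq> 0 \<Longrightarrow> norm z \<le> 1 \<Longrightarrow>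
     norm (\<Phi> z) \<le> D * norm z powr (- 1 / 2)"
    using besselprod_power_bound_zero[of m n] m unfolding \<Phi>_def by auto
  obtain C where C: "C \<ge> 0" "\<And>z. Re z \<ge> 0 \<Longrightarrow> Im z \<ge> 0 \<Longrightarrow> norm z \<ge> 1 \<Longrightarrow>
     norm ((besselprod z * (2 * z) / of_real pi) ^ m - (\<Sum>j<J. of_real (c j) / (2 * z) ^ j)) \<le> C / norm z ^ J"
    by (rule has_asympE[OF has_asymp_power[OF besselprod_asymp, of m], where N = J, folded c_def]) (rule that)
  have infty: "norm (\<Phi> z - T z) \<le> ((pi / 2) ^ m * C) / norm z ^ 2" if z: "Re z \<ge> 0" "Im z \<ge> 0" "norm z \<ge> 1" for z
  proof -
    have z0: "z \<noteq> 0" using z by auto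
    define q where "q = of_real pi / (2 * z)"
    have "\<Phi> z = q ^ m * z ^ n * (besselprod z * (2 * z) / of_real pi) ^ m"
    proof -
      have "q ^ m * (besselprod z * (2 * z) / of_real pi) ^ m = besselprod z ^ m"
        unfolding power_mult_distrib[symmetric] using z0 by (simp add: q_def)
      then show ?thesis unfolding \<Phi>_def by (metis mult.commute mult.left_commute)
    qed
    moreover have "T z = q ^ m * z ^ n * (\<Sum>j<J. of_real (c j) / (2 * z) ^ j)"
    proof -
      have "of_real ((pi / 2) ^ m) * (of_real (c j / 2 ^ j) * z powi e j) = q ^ m * z ^ n * (of_real (c j) / (2 * z) ^ j)" for j
        unfolding e_def q_def using z0 by (simp add: power_int_diff power_divide power_mult_distrib mult_ac)
      then show ?thesis unfolding T_def sum_distrib_left by simp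
    qed
    ultimately have "\<Phi> z - T z = q ^ m * z ^ n * ((besselprod z * (2 * z) / of_real pi) ^ m - (\<Sum>j<J. of_real (c j) / (2 * z) ^ j))"
      by (simp add: right_diff_distrib)
    also have "norm \<dots> \<le> norm (q ^ m * z ^ n) * (C / norm z ^ J)"
      unfolding norm_mult[of "q ^ m * z ^ n"] by (intro mult_left_mono C z) auto
    also have "norm (q ^ m * z ^ n) = (pi / 2) ^ m / norm z ^ m * norm z ^ n"
      by (simp add: q_def norm_mult norm_power norm_divide power_divide power_mult_distrib)
    also have "(pi / 2) ^ m / norm z ^ m * norm z ^ n * (C / norm z ^ J) = ((pi / 2) ^ m * C) / (norm z ^ m * norm z ^ 2)"
      using z0 by (simp add: J_def power_add field_simps power2_eq_square)
    also have "\<dots> \<le> ((pi / 2) ^ m * C) / (1 * norm z ^ 2)"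
      using z C by (intro divide_left_mono mult_right_mono one_le_power mult_pos_pos zero_less_power) auto
    finally show ?thesis by simp
  qed
  have S: "(S has_field_derivative T z) (at z)" if "Re z + Im z > 0" for z
  proof -
    have z: "z \<noteq> 0" "z \<notin> \<real>\<^sub>\<le>\<^sub>0" using that by (auto simp: complex_nonpos_Reals_iff)
    have "(s j has_field_derivative z powi e j) (at z)" for j
    proof (cases "e j = - 1")
      case True
      then show ?thesis
        using has_field_derivative_Ln[OF z(2)] by (simp add: s_def power_int_minus)
    next
      case False
      then have "complex_of_int (e j + 1) \<noteq> 0" by (metis of_int_eq_0_iff add_eq_0_iff2)
      moreover have "((\<lambda>z. z powi (e j + 1) / of_int (e j + 1)) has_field_derivative
         of_int (e j + 1) * z powi (e j + 1 - 1) * 1 / of_int (e j + 1)) (at z)"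
        using z by (intro DERIV_cdivide DERIV_power_int DERIV_ident) auto
      ultimately show ?thesis using False by (simp add: s_def)
    qed
    then show ?thesis
      unfolding S_def T_def by (intro DERIV_cmult DERIV_sum) 
  qed
  have real: "Im (T (of_real t)) = 0" for t
  proof -
    have "T (of_real t) = of_real ((pi / 2) ^ m * (\<Sum>j<J. (c j / 2 ^ j) * t powi e j))"
      unfolding T_def by (simp only: of_real_mult of_real_sum of_real_power_int)
    then show ?thesis by (simp only: Im_complex_of_real)
  qed
  have sV: "Im (of_real (c j / 2 ^ j) * s j (\<i> * of_real r) - of_real (c j / 2 ^ j) * s j (of_real r))
      = (if e j = - 1 then c j / 2 ^ j * (pi / 2) else 0)" if r: "r > 0" for j r
  proof (cases "e j = - 1")
    case True
    have "Ln (\<i> * of_real r) = of_real (ln r) + \<i> * of_real (pi / 2)"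
      using r Ln_times_of_real[of r \<i>] by (simp add: mult.commute Ln_of_real)
    then show ?thesis using True r by (simp add: s_def Ln_of_real)
  next
    case False
    show ?thesis
    proof (cases "odd j")
      case True
      then have "c j = 0" unfolding c_def by (rule product_fps_power_odd)
      then show ?thesis using False by simp
    next
      case even: False
      have "even (e j + 1)" using odd even by (simp add: e_def)
      then obtain l where l: "e j + 1 = 2 * l" by blast
      have "(\<i> * of_real r) powi (2 * l) = of_real ((- (r\<^sup>2)) powi l)"
        unfolding power_int_mult of_real_power_int by (simp add: power_mult_distrib)
      moreover have "of_real r powi (2 * l) = complex_of_real (r powi (2 * l))" by simp
      ultimately have s: "s j (\<i> * of_real r) = of_real ((- (r\<^sup>2)) powi l / of_int (2 * l))"
        "s j (of_real r) = of_real (r powi (2 * l) / of_int (2 * l))"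
        using False unfolding s_def l by simp_all
      show ?thesis
        using False unfolding s
        by (simp only: if_False of_real_mult[symmetric] of_real_diff[symmetric] Im_complex_of_real)
    qed
  qed
  have V: "Im (S (\<i> * of_real r) - S (of_real r)) = V" if r: "r > 0" for r
  proof -
    have "S (\<i> * of_real r) - S (of_real r)
      = of_real ((pi / 2) ^ m) * (\<Sum>j<J. of_real (c j / 2 ^ j) * s j (\<i> * of_real r) - of_real (c j / 2 ^ j) * s j (of_real r))"
      unfolding S_def sum_subtractf by (rule right_diff_distrib[symmetric])
    then have "Im (S (\<i> * of_real r) - S (of_real r)) = (pi / 2) ^ m * (\<Sum>j<J. if e j = - 1 then c j / 2 ^ j * (pi / 2) else 0)"
    proof -
      have imr: "Im (of_real a * w) = a * Im w" for a w by simp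
      show ?thesis unfolding \<open>S (\<i> * of_real r) - S (of_real r) = _\<close> imr Im_sum sV[OF r] ..
    qed
    also have "\<dots> = V"
    proof (cases "m \<le> n + 1")
      case True
      then have "e j = - 1 \<longleftrightarrow> j = n + 1 - m" for j unfolding e_def by linarith
      moreover have "n + 1 - m < J" by (simp add: J_def)
      ultimately show ?thesis using True by (simp add: V_def mult_ac)
    next
      case False
      then have "e j \<noteq> - 1" for j unfolding e_def by linarith
      then show ?thesis using False by (simp add: V_def)
    qed
    finally show ?thesis .
  qed
  have imag: "Re (\<Phi> (\<i> * of_real y)) = 0" if "y > 0" for y
  proof -
    obtain l where "m + n = 2 * l + 1" using odd by (elim oddE)
    then have "\<i> ^ (m + n) = \<i> * of_real ((- 1) ^ l)" by (simp add: power_mult)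
    then have "\<Phi> (\<i> * of_real y) = \<i> * of_real ((- 1) ^ l * (Im (besselprod (\<i> * of_real y)) ^ m * y ^ n))"
      unfolding \<Phi>_def besselprod_power_imaginary[OF that] by simp
    then show ?thesis by (simp del: of_real_mult of_real_power)
  qed
  have hol: "\<Phi> holomorphic_on {z. Re z + Im z > 0}"
    unfolding \<Phi>_def by (rule besselprod_power_holomorphic)
  note Q = quadrant_integral[OF hol S infty D(2) imag real V]
  show "set_integrable lborel {0<..} (\<lambda>t. Im (besselprod (of_real t) ^ m * of_real t ^ n))"
    using Q(1) by (simp add: \<Phi>_def)
  show "(LBINT t:{0<..}. Im (besselprod (of_real t) ^ m * of_real t ^ n))
      = - (if m \<le> n + 1 then (pi / 2) ^ (m + 1) * fps_nth (product_fps ^ m) (n + 1 - m) / 2 ^ (n + 1 - m) else 0)"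
    using Q(2) by (simp add: \<Phi>_def V_def c_def)
qed

section \<open>From the Bessel product back to the stated integrands\<close>

lemma besselprod_power_real:
  assumes "t > 0"
  shows "(of_real (pi * bessel_I0 t) - \<i> * of_real (bessel_K0 t)) ^ m * of_real (bessel_K0 t) ^ m
      = besselprod (of_real t) ^ m"
    and "(of_real (pi * bessel_I0 t) + \<i> * of_real (bessel_K0 t)) ^ m * of_real (bessel_K0 t) ^ m
      = cnj (besselprod (of_real t) ^ m)"
  unfolding besselprod_real[OF assms] power_mult_distrib
  by (simp_all add: mult.commute)

lemma diff_integrand_eq:
  assumes "t > 0"
  shows "diff_integrand m n t = of_real (- 2 * Im (besselprod (of_real t) ^ m * of_real t ^ n))"
proof -
  have "diff_integrand m n t = (cnj (besselprod (of_real t) ^ m) - besselprod (of_real t) ^ m) / \<i> * of_real t ^ n"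
    unfolding diff_integrand_def besselprod_power_real[OF assms, symmetric]
    by (simp add: algebra_simps)
  also have "\<dots> = of_real (- 2 * (Im (besselprod (of_real t) ^ m) * t ^ n))"
  proof -
    have "(cnj w - w) / \<i> * of_real t ^ n = of_real (- 2 * (Im w * t ^ n))" for w
      by (simp add: complex_eq_iff flip: of_real_power)
    then show ?thesis .
  qed
  also have "Im (besselprod (of_real t) ^ m) * t ^ n = Im (besselprod (of_real t) ^ m * of_real t ^ n)"
    by (simp flip: of_real_power)
  finally show ?thesis .
qed

lemma sum_integrand_eq:
  assumes "t > 0"
  shows "sum_integrand m n t = - 2 * \<i> * of_real (Re (besselprod (of_real t) ^ m * of_real t ^ n))"
proof -
  have "sum_integrand m n t = (cnj (besselprod (of_real t) ^ m) + besselprod (of_real t) ^ m) / \<i> * of_real t ^ n"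
    unfolding sum_integrand_def besselprod_power_real[OF assms, symmetric]
    by (simp add: algebra_simps)
  also have "\<dots> = - 2 * \<i> * of_real (Re (besselprod (of_real t) ^ m) * t ^ n)"
  proof -
    have "(cnj w + w) / \<i> * of_real t ^ n = - 2 * \<i> * of_real (Re w * t ^ n)" for w
      by (simp add: complex_eq_iff flip: of_real_power)
    then show ?thesis .
  qed
  also have "Re (besselprod (of_real t) ^ m) * t ^ n = Re (besselprod (of_real t) ^ m * of_real t ^ n)"
    by (simp flip: of_real_power)
  finally show ?thesis .
qed

text \<open>The zero branch m > n + 1 gives the second claim of (a); the branch m <= n + 1 supplies
  the values behind (b).\<close>

lemma diff_integral:
  assumes "m > 0" "odd (m + n)"
  shows "set_integrable lborel {0<..} (diff_integrand m n)"
    and "(LBINT t:{0<..}. diff_integrand m n t) = of_real (if m \<le> n + 1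
      then 2 * (pi / 2) ^ (m + 1) * fps_nth (product_fps ^ m) (n + 1 - m) / 2 ^ (n + 1 - m) else 0)"
proof -
  have "set_integrable lborel {0<..} (\<lambda>t. complex_of_real (- 2 * Im (besselprod (of_real t) ^ m * of_real t ^ n)))"
    by (intro set_integrable_complex_of_real set_integrable_mult_right odd_integral assms)
  then show "set_integrable lborel {0<..} (diff_integrand m n)"
    by (rule set_integrable_congD) (simp add: diff_integrand_eq)
  have "(LBINT t:{0<..}. diff_integrand m n t)
      = (LBINT t:{0<..}. complex_of_real (- 2 * Im (besselprod (of_real t) ^ m * of_real t ^ n)))"
    by (rule set_lebesgue_integral_cong) (auto simp: diff_integrand_eq)
  also have "\<dots> = of_real (- 2 * (LBINT t:{0<..}. Im (besselprod (of_real t) ^ m * of_real t ^ n)))"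
    by (simp only: set_integral_complex_of_real set_integral_mult_right)
  finally show "(LBINT t:{0<..}. diff_integrand m n t) = of_real (if m \<le> n + 1
      then 2 * (pi / 2) ^ (m + 1) * fps_nth (product_fps ^ m) (n + 1 - m) / 2 ^ (n + 1 - m) else 0)"
    unfolding odd_integral(2)[OF assms] by simp
qed

lemma sum_integral:
  assumes "m = n + 2 * k" "k > 0"
  shows "set_integrable lborel {0<..} (sum_integrand m n)"
    and "(LBINT t:{0<..}. sum_integrand m n t) = 0"
proof -
  have "set_integrable lborel {0<..} (\<lambda>t. - 2 * \<i> * complex_of_real (Re (besselprod (of_real t) ^ m * of_real t ^ n)))"
    by (intro set_integrable_mult_right set_integrable_complex_of_real even_integral_zero[OF assms])
  then show "set_integrable lborel {0<..} (sum_integrand m n)"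
    by (rule set_integrable_congD) (simp add: sum_integrand_eq)
  have "(LBINT t:{0<..}. sum_integrand m n t)
      = (LBINT t:{0<..}. - 2 * \<i> * complex_of_real (Re (besselprod (of_real t) ^ m * of_real t ^ n)))"
    by (rule set_lebesgue_integral_cong) (auto simp: sum_integrand_eq)
  also have "\<dots> = - 2 * \<i> * of_real (LBINT t:{0<..}. Re (besselprod (of_real t) ^ m * of_real t ^ n))"
    by (simp only: set_integral_complex_of_real set_integral_mult_right)
  finally show "(LBINT t:{0<..}. sum_integrand m n t) = 0"
    unfolding even_integral_zero(2)[OF assms] by simp
qed

section \<open>The normalized integrals as coefficients of powers of the product series\<close>

lemma product_fps_even_power_Ints: "even m \<Longrightarrow> fps_nth (product_fps ^ m) j \<in> \<int>"
proof (elim evenE)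
  fix l assume "m = 2 * l"
  then show "fps_nth (product_fps ^ m) j \<in> \<int>"
    using fps_scaled_Ints_power[of "product_fps\<^sup>2" 1 l j] product_fps_square_Ints by (simp add: power_mult)
qed

lemma C_integrand_eq: "C_integrand m n t = 2 ^ (2 * n + m - 3) * diff_integrand m (2 * n + m - 3) t"
  unfolding C_integrand_def diff_integrand_def by (simp add: power_mult_distrib)

lemma C_integral:
  assumes "m > 0" "n > 0"
  shows "set_integrable lborel {0<..} (C_integrand m n)"
    and "C_num m n = of_real (2 ^ (2 * (n - 1) * (if even m then 0 else 2)) * fps_nth (product_fps ^ m) (2 * (n - 1)))"
proof -
  define E where "E = 2 * n + m - 3"
  have E: "m \<le> E + 1" "E + 1 - m = 2 * (n - 1)" "E + 2 = (m + 1) + 2 * (n - 1)" and odd: "odd (m + E)"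
  proof -
    \<comment> \<open>Written with successors, the truncated subtraction in
      \<open>2 * n + m - 3\<close> is seen to be an ordinary one.\<close>
    obtain a b where "m = Suc a" "n = Suc b" using assms by (metis Suc_pred)
    then show "m \<le> E + 1" "E + 1 - m = 2 * (n - 1)" "E + 2 = (m + 1) + 2 * (n - 1)" "odd (m + E)"
      by (auto simp: E_def)
  qed
  note d = diff_integral[OF assms(1) odd]
  show "set_integrable lborel {0<..} (C_integrand m n)"
    unfolding C_integrand_eq[abs_def] E_def[symmetric] by (intro set_integrable_mult_right d)
  define c where "c = fps_nth (product_fps ^ m) (2 * (n - 1))"
  have "(LBINT t:{0<..}. C_integrand m n t) = 2 ^ E * of_real (2 * (pi / 2) ^ (m + 1) * c / 2 ^ (2 * (n - 1)))"
    unfolding C_integrand_eq E_def[symmetric] set_integral_mult_right d(2) using E by (simp add: c_def)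
  also have "\<dots> = of_real (pi ^ (m + 1) * c / 2)"
  proof -
    \<comment> \<open>The powers of 2 from (2 t)^E, from (pi / 2)^(m+1) and from the index 2 (n - 1)
      balance up to 1/2, and this 1/2 is cancelled by the summand 1 in the exponent of the
      prefactor.\<close>
    have "(2::real) ^ E * 4 = 2 ^ (m + 1) * 2 ^ (2 * (n - 1))"
      using arg_cong[OF E(3), of "\<lambda>k. (2::real) ^ k"] unfolding power_add[of 2 E] power_add[of 2 "m + 1"] by simp
    then have "(2::real) ^ E * (2 * (pi / 2) ^ (m + 1) * c / 2 ^ (2 * (n - 1))) = pi ^ (m + 1) * c / 2"
      unfolding power_divide[of pi] by (simp add: field_simps del: power_Suc power_mult power_add)
    then show ?thesis by (metis of_real_mult of_real_power of_real_numeral)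
  qed
  finally have I: "(LBINT t:{0<..}. C_integrand m n t) = of_real (pi ^ (m + 1) * c / 2)" .
  have "C_num m n = 2 powi (1 + 2 * (int n - 1) * (1 - (- 1) ^ m)) / of_real pi ^ (m + 1) * of_real (pi ^ (m + 1) * c / 2)"
    unfolding C_num_def I ..
  also have "\<dots> = 2 powi (1 + 2 * (int n - 1) * (1 - (- 1) ^ m)) / 2 * of_real c"
    by simp
  also have "1 + 2 * (int n - 1) * (1 - (- 1) ^ m) = 1 + int (2 * (n - 1) * (if even m then 0 else 2))"
    using assms by (auto simp: of_nat_diff)
  also have "2 powi (1 + int (2 * (n - 1) * (if even m then 0 else 2))) / 2 = (2 :: complex) ^ (2 * (n - 1) * (if even m then 0 else 2))"
  proof -
    have "2 powi (1 + int K) / 2 = (2 :: complex) ^ K" for K by (simp add: power_int_add)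
    then show ?thesis .
  qed
  finally show "C_num m n = of_real (2 ^ (2 * (n - 1) * (if even m then 0 else 2)) * fps_nth (product_fps ^ m) (2 * (n - 1)))"
    by (simp add: c_def)
qed

lemma C_num_positive_integer:
  assumes "m > 0" "n > 0"
  shows "\<exists>k::nat. k > 0 \<and> C_num m n = of_nat k"
proof -
  define x where "x = 2 ^ (2 * (n - 1) * (if even m then 0 else 2)) * fps_nth (product_fps ^ m) (2 * (n - 1))"
  have "x > 0" unfolding x_def using product_fps_power_even_pos[OF assms(1)] by simp
  moreover have "x \<in> \<int>"
  proof (cases "even m")
    case True
    then show ?thesis using product_fps_even_power_Ints by (simp add: x_def)
  next
    case False
    \<comment> \<open>For odd m the prefactor is 2^(4 (n - 1)). Half of the exponent clears the
      denominators of the coefficient of y^m at 2 (n - 1); the other half is an integer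
      factor.\<close>
    have "x = 2 ^ (2 * (n - 1)) * (fps_nth (product_fps ^ m) (2 * (n - 1)) * 2 ^ (2 * (n - 1)))"
    proof -
      have "(2::real) ^ (2 * (n - 1) * 2) = 2 ^ (2 * (n - 1)) * 2 ^ (2 * (n - 1))"
        unfolding power_add[symmetric] by simp
      then show ?thesis using False by (simp only: x_def if_False mult_ac)
    qed
    then show ?thesis
      using fps_scaled_Ints_power[OF product_fps_scaled_Ints, of m "2 * (n - 1)"] by (metis Ints_mult Ints_power Ints_numeral)
  qed
  ultimately obtain i where i: "x = of_int i" "i > 0" by (auto elim: Ints_cases)
  then have "x = of_nat (nat i)" by simp
  then have "C_num m n = of_nat (nat i)"
    using C_integral(2)[OF assms] unfolding x_def[symmetric] by simp
  then show ?thesis using i by (intro exI[of _ "nat i"]) auto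
qed

text \<open>The case m = 4, by (a + i b)^4 - (a - i b)^4 = 8 i a b (a^2 - b^2); the constant 1 / (8
  pi) takes care of the 8 and of I0 = a / pi.\<close>

lemma A_integrand_eq:
  "complex_of_real (A_integrand n t) = of_real (2 ^ (2 * n - 1) / (8 * pi)) * diff_integrand 4 (2 * n - 1) t"
proof -
  define a where "a = complex_of_real (pi * bessel_I0 t)"
  define b where "b = complex_of_real (bessel_K0 t)"
  have "((a + \<i> * b) ^ 4 - (a - \<i> * b) ^ 4) = \<i> * (8 * a * b * (a\<^sup>2 - b\<^sup>2))"
    using i_squared by algebra
  then have "diff_integrand 4 (2 * n - 1) t = 8 * a * b * (a\<^sup>2 - b\<^sup>2) * b ^ 4 * of_real t ^ (2 * n - 1)"
    unfolding diff_integrand_def a_def[symmetric] b_def[symmetric] by simp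
  then have "of_real (2 ^ (2 * n - 1) / (8 * pi)) * diff_integrand 4 (2 * n - 1) t
      = (a\<^sup>2 - b\<^sup>2) * (a / of_real pi) * (b * b ^ 4) * of_real (2 * t) ^ (2 * n - 1)"
    by (simp add: power_mult_distrib)
  also have "b * b ^ 4 = b ^ 5" by (simp add: eval_nat_numeral)
  also have "a / of_real pi = of_real (bessel_I0 t)" by (simp add: a_def)
  finally show ?thesis by (simp add: A_integrand_def a_def b_def)
qed

lemma A_integral:
  assumes "n > 0"
  shows "set_integrable lborel {0<..} (A_integrand n)" and "A_num n \<in> \<int>"
proof -
  have odd: "odd (4 + (2 * n - 1))" using assms by simp
  have "set_integrable lborel {0<..} (\<lambda>t. complex_of_real (A_integrand n t))"
    unfolding A_integrand_eq by (intro set_integrable_mult_right diff_integral odd) auto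
  then show "set_integrable lborel {0<..} (A_integrand n)"
    using complex_of_real_integrable_eq[of lborel "\<lambda>x. indicator {0<..} x *\<^sub>R A_integrand n x"]
    unfolding set_integrable_def by (simp add: scaleR_conv_of_real)
  have "complex_of_real (LBINT t:{0<..}. A_integrand n t) = of_real (2 ^ (2 * n - 1) / (8 * pi)) *
     of_real (if 4 \<le> 2 * n - 1 + 1 then 2 * (pi / 2) ^ (4 + 1) * fps_nth (product_fps ^ 4) (2 * n - 1 + 1 - 4) / 2 ^ (2 * n - 1 + 1 - 4) else 0)"
    unfolding set_integral_complex_of_real[symmetric] A_integrand_eq set_integral_mult_right
    by (simp only: diff_integral(2)[OF zero_less_numeral odd])
  then have I: "(LBINT t:{0<..}. A_integrand n t) = (2 ^ (2 * n - 1) / (8 * pi)) *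
     (if 4 \<le> 2 * n - 1 + 1 then 2 * (pi / 2) ^ (4 + 1) * fps_nth (product_fps ^ 4) (2 * n - 1 + 1 - 4) / 2 ^ (2 * n - 1 + 1 - 4) else 0)"
    by (simp only: of_real_mult[symmetric] of_real_eq_iff)
  show "A_num n \<in> \<int>"
  proof (cases "n = 1")
    \<comment> \<open>Here t has the exponent 1 < m - 1 = 3, so the expansion contains no term 1 / z
      and the integral vanishes.\<close>
    case True
    show ?thesis unfolding A_num_def I using True by simp
  next
    case False
    then have "2 \<le> n" using assms by linarith
    then obtain k where "n = 2 + k" by (rule le_Suc_ex[THEN exE])
    \<comment> \<open>The powers of pi cancel, and those of 2 as well: 2^4 * 2^(2 n - 1) * 2 = 8 *
      2^5 * 2^(2 n - 4).\<close>
    then have "A_num n = fps_nth (product_fps ^ 4) (2 * k)"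
      unfolding A_num_def I by (simp add: power_add power_divide eval_nat_numeral field_simps)
    then show ?thesis by (simp add: product_fps_even_power_Ints)
  qed
qed

theorem theorem1:
  shows "(\<forall>m n :: nat. m > 1 \<and> (\<exists>k :: nat. k > 0 \<and> (real m - real n) / 2 = real k) \<longrightarrow>
            set_integrable lborel {0<..} (sum_integrand m n)
            \<and> (LBINT t:{0<..}. sum_integrand m n t) = 0)
       \<and> (\<forall>m n :: nat. m > 0 \<and> (\<exists>k :: nat. k > 0 \<and> (real m - real n - 1) / 2 = real k) \<longrightarrow>
            set_integrable lborel {0<..} (diff_integrand m n)
            \<and> (LBINT t:{0<..}. diff_integrand m n t) = 0)
       \<and> (\<forall>n :: nat. n > 0 \<longrightarrow>
            set_integrable lborel {0<..} (A_integrand n) \<and> A_num n \<in> \<int>)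
       \<and> (\<forall>m n :: nat. m > 0 \<and> n > 0 \<longrightarrow>
            set_integrable lborel {0<..} (C_integrand m n)
            \<and> (\<exists>k :: nat. k > 0 \<and> C_num m n = of_nat k))"
proof (intro conjI allI impI; (elim conjE exE)?)
  fix m n k :: nat assume "k > 0" "(real m - real n) / 2 = real k"
  then have "m = n + 2 * k" by (simp add: field_simps)
  then show "set_integrable lborel {0<..} (sum_integrand m n)" "(LBINT t:{0<..}. sum_integrand m n t) = 0"
    using sum_integral[of m n k] \<open>k > 0\<close> by auto
next
  fix m n k :: nat assume "m > 0" "k > 0" "(real m - real n - 1) / 2 = real k"
  \<comment> \<open>This makes m + n odd and m > n + 1, the branch in which
    \<open>diff_integral\<close> gives zero.\<close>
  then have "m = n + 2 * k + 1" by (simp add: field_simps)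
  then show "set_integrable lborel {0<..} (diff_integrand m n)" "(LBINT t:{0<..}. diff_integrand m n t) = 0"
    using diff_integral[of m n] \<open>k > 0\<close> by auto
qed (use A_integral C_integral(1) C_num_positive_integer in auto)

end
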